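(* Let $d\ge1$, $\ell>0$, let $(K_\epsilon)_{\epsilon>0}$ be kernels with $K_\epsilon\nearrow K_0$ as $\epsilon\searrow 0$, where $$\int_0^1 K_0(r)\,r^{d-1}\,dr=\infty,\qquad \int_\delta^\infty K_0(r)\min\{r^{d-2},r^{d-1}\}\,dr<\infty\quad\text{for all }\delta>0,$$ and let $\mathcal E_\epsilon$, $\epsilon\ge0$, be the energies defined in the context. Then for each $\lambda\in[0,1]$ and each $\epsilon\ge0$ there exists a minimizer $u$ of $\mathcal E_\epsilon$ in the class of functions $u\in BV(\mathbb T_\ell;\{0,1\})$ satisfying $\frac1{|\mathbb T_\ell|}\int_{\mathbb T_\ell}u\,dx=\lambda$.
   Context: $\mathbb T_\ell=\mathbb R^d/(\ell\mathbb Z)^d$ is the flat torus with side length $\ell$, $|\mathbb T_\ell|=\ell^d$; functions on $\mathbb T_\ell$ are identified with $(\ell\mathbb Z)^d$-periodic functions on $\mathbb R^d$. $B_1$ is the unit ball of $\mathbb R^d$ centred at $0$. $\omega_d$ is the volume of the unit ball in $\mathbb R^d$ ($\omega_0=1$). Kernels: $K_\epsilon:\mathbb R^d\to[0,\infty)$ is measurable and radial, $K_\epsilon(z)=K_\epsilon(|z|)$, with $K_\epsilon\in L^1(B_1)$ for $\epsilon>0$. $K_\epsilon\nearrow K_0$ means that $K_\epsilon$ increases pointwise to the radial function $K_0$ as $\epsilon$ decreases to $0$. $M_\epsilon:=\omega_{d-1}\int_0^1K_\epsilon(t)t^{d-1}\,dt$, and $M_\epsilon>0$ for $\epsilon>0$.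 For $u\in BV(\mathbb T_\ell;\{0,1\})$ and $\epsilon>0$, $$\mathcal E_\epsilon(u):=\frac{M_\epsilon}{|\mathbb T_\ell|}\int_{\mathbb T_\ell}|\nabla u|-\int_{\mathbb R^d}K_\epsilon(z)\,\frac1{|\mathbb T_\ell|}\int_{\mathbb T_\ell}\frac{|u(x+z)-u(x)|}{2|z|}\,dx\,dz ,$$ and $$\mathcal E_0(u)=\frac12\int_{\mathbb R^d}\frac{1}{|\mathbb T_\ell|}\int_{\mathbb T_\ell}K_0(|z|)\Big(\Big|\frac{z}{|z|}\cdot\nabla u(x)\Big|\,\chi_{B_1}(z)-\frac{|u(x+z)-u(x)|}{|z|}\Big)\,dx\,dz\in(-\infty,+\infty].$$ Here $\int_{\mathbb T_\ell}|\nabla u|$ is the total variation and, writing $\nabla u=\sigma|\nabla u|$ with $\sigma:\mathbb T_\ell\to\mathbb S^{d-1}$, $\int_{\mathbb T_\ell}|\omega\cdot\nabla u(x)|\,dx$ denotes $\int_{\mathbb T_\ell}|\omega\cdot\sigma|\,d|\nabla u|$; the $x$-integral is performed first. *)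

theory Defs
  imports "HOL-Analysis.Analysis"
begin

text \<open>
  The dimension is \<open>d = CARD('n)\<close>. The torus of side length \<open>l\<close> is represented by the half-open
  cell \<open>[0,l)^d\<close>, which is in Borel bijection with it; functions on the torus are \<open>l\<close>-periodic
  functions on \<open>real^'n\<close>. Functions in \<open>BV\<close> are represented by arbitrary Lebesgue measurable
  representatives of their classes modulo null sets.
\<close>

definition torus :: "real \<Rightarrow> (real^'n) set" where
  "torus l = {x. \<forall>i. 0 \<le> x $ i \<and> x $ i < l}"

definition periodic :: "real \<Rightarrow> (real^'n \<Rightarrow> 'b) \<Rightarrow> bool" where
  "periodic l u \<longleftrightarrow> (\<forall>x i. u (x + l *\<^sub>R axis i 1) = u x)"

text \<open>
  The distributional gradient of \<open>u\<close> on the torus is the finite vector measure \<open>\<sigma> \<mu>\<close>, in polar form: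
  \<open>\<mu>\<close> is the total variation measure \<open>|\<nabla>u|\<close> and \<open>\<sigma>\<close> takes values in the unit sphere. The test
  functions are the periodic \<open>C\<^sup>1\<close> functions \<open>\<phi>\<close>, with gradient \<open>g\<close>. If such a pair exists, then \<open>\<mu>\<close> is
  unique and \<open>\<sigma>\<close> is unique \<open>\<mu>\<close>-almost everywhere.
\<close>

definition is_polar_gradient ::
  "real \<Rightarrow> (real^'n \<Rightarrow> real) \<Rightarrow> (real^'n) measure \<Rightarrow> (real^'n \<Rightarrow> real^'n) \<Rightarrow> bool" where
  "is_polar_gradient l u \<mu> \<sigma> \<longleftrightarrow>
     finite_measure \<mu> \<and> sets \<mu> = sets (restrict_space borel (torus l)) \<and>
     \<sigma> \<in> borel_measurable \<mu> \<and> (\<forall>x\<in>torus l. norm (\<sigma> x) = 1) \<and>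
     (\<forall>\<phi> g. periodic l \<phi> \<and> continuous_on UNIV g \<and>
        (\<forall>x. (\<phi> has_derivative (\<lambda>h. g x \<bullet> h)) (at x)) \<longrightarrow>
        (LINT x:torus l|lebesgue. u x *\<^sub>R g x) = - (LINT x|\<mu>. \<phi> x *\<^sub>R \<sigma> x))"

definition BV :: "real \<Rightarrow> (real^'n \<Rightarrow> real) set" where
  "BV l = {u. periodic l u \<and> set_integrable lebesgue (torus l) u \<and>
              (\<exists>\<mu> \<sigma>. is_polar_gradient l u \<mu> \<sigma>)}"

definition BV01 :: "real \<Rightarrow> (real^'n \<Rightarrow> real) set" where
  "BV01 l = {u \<in> BV l. \<forall>x. u x \<in> {0, 1}}"

definition polar_gradient ::
  "real \<Rightarrow> (real^'n \<Rightarrow> real) \<Rightarrow> (real^'n) measure \<times> (real^'n \<Rightarrow> real^'n)" where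
  "polar_gradient l u = (SOME p. is_polar_gradient l u (fst p) (snd p))"

definition variation_measure :: "real \<Rightarrow> (real^'n \<Rightarrow> real) \<Rightarrow> (real^'n) measure" where
  "variation_measure l u = fst (polar_gradient l u)"

definition gradient_direction :: "real \<Rightarrow> (real^'n \<Rightarrow> real) \<Rightarrow> real^'n \<Rightarrow> real^'n" where
  "gradient_direction l u = snd (polar_gradient l u)"

definition total_variation :: "real \<Rightarrow> (real^'n \<Rightarrow> real) \<Rightarrow> real" where
  "total_variation l u = measure (variation_measure l u) (torus l)"

definition directional_variation :: "real \<Rightarrow> (real^'n \<Rightarrow> real) \<Rightarrow> real^'n \<Rightarrow> real" where
  "directional_variation l u \<omega> = (LINT x|variation_measure l u. \<bar>\<omega> \<bullet> gradient_direction l u x\<bar>)"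

definition torus_mean :: "real \<Rightarrow> (real^'n \<Rightarrow> real) \<Rightarrow> real" where
  "torus_mean l u = (1 / l ^ CARD('n)) * (LINT x:torus l|lebesgue. u x)"

text \<open>
  Kernels are given by their radial profiles, so that the kernel on \<open>real^'n\<close> is \<open>\<lambda>z. k (norm z)\<close>.
\<close>

definition kernel_mass :: "nat \<Rightarrow> (real \<Rightarrow> real) \<Rightarrow> real" where
  "kernel_mass d k = unit_ball_vol (real d - 1) * (LINT t:{0..1}|lebesgue. k t * t ^ (d - 1))"

text \<open>
  For \<open>\<epsilon> > 0\<close>. The double integral has a nonnegative integrand; it is finite for the kernels and
  functions of interest.
\<close>

definition energy_pos :: "real \<Rightarrow> (real \<Rightarrow> real) \<Rightarrow> (real^'n \<Rightarrow> real) \<Rightarrow> ereal" where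
  "energy_pos l k u =
     ereal (kernel_mass CARD('n) k / l ^ CARD('n) * total_variation l u)
     - enn2ereal (\<integral>\<^sup>+z. ennreal (k (norm z) *
         torus_mean l (\<lambda>x. \<bar>u (x + z) - u x\<bar> / (2 * norm z))) \<partial>lebesgue)"

text \<open>
  The integral of an extended real function whose negative part has finite integral.
\<close>

definition ereal_integral :: "'a measure \<Rightarrow> ('a \<Rightarrow> ereal) \<Rightarrow> ereal" where
  "ereal_integral M f =
     enn2ereal (\<integral>\<^sup>+x. e2ennreal (f x) \<partial>M) - enn2ereal (\<integral>\<^sup>+x. e2ennreal (- f x) \<partial>M)"

text \<open>
  The integral in \<open>x\<close> is performed first, and its \<open>x\<close>-independent factor \<open>K\<^sub>0 (norm z)\<close>, which may be
  infinite, is taken out of it.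
\<close>

definition energy_zero :: "real \<Rightarrow> (real \<Rightarrow> ennreal) \<Rightarrow> (real^'n \<Rightarrow> real) \<Rightarrow> ereal" where
  "energy_zero l k u =
     ereal (1 / 2) * ereal_integral lebesgue (\<lambda>z. enn2ereal (k (norm z)) *
       ereal (1 / l ^ CARD('n) * directional_variation l u (z /\<^sub>R norm z) * indicator (ball 0 1) z
              - torus_mean l (\<lambda>x. \<bar>u (x + z) - u x\<bar> / norm z)))"

definition energy ::
  "real \<Rightarrow> (real \<Rightarrow> real \<Rightarrow> real) \<Rightarrow> (real \<Rightarrow> ennreal) \<Rightarrow> real \<Rightarrow> (real^'n \<Rightarrow> real) \<Rightarrow> ereal" where
  "energy l K K\<^sub>0 \<epsilon> u = (if \<epsilon> = 0 then energy_zero l K\<^sub>0 u else energy_pos l (K \<epsilon>) u)"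

end

theory Submission
  imports Defs "HOL-Probability.Probability" "HOL-Complex_Analysis.Great_Picard"
begin

text \<open>
  Write \<open>V(u,\<omega>)\<close> for the directional variation and \<open>D(u,z)\<close> for the integral over the torus of
  \<open>|u(x+z) - u(x)|\<close>. Duality with test functions gives \<open>V(u,\<omega>) = sup {D(u,t\<omega>)/t | t > 0}\<close>, so \<open>V\<close> is
  lower semicontinuous under \<open>L\<^sup>1\<close> convergence, and averaging \<open>V\<close> over the sphere gives a multiple of the
  total variation. Hence for every \<open>\<epsilon> \<ge> 0\<close> the energy is a positive multiple of the integral of
  \<open>K (V(u,z/|z|) - D(u,z)/|z|)\<close> over the unit ball minus that of \<open>K D(u,z)/|z|\<close> over its complement. The
  first term is nonnegative and lower semicontinuous (Fatou), the second is bounded and continuous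
  (dominated convergence). Since \<open>D\<close> is bounded and \<open>K\<close> has positive mass in the unit ball away from
  the origin, the energy bounds the total variation, and the direct method applies.

  For compactness, a minimizing sequence is compared with its averages over small cells. That the
  limit has bounded variation follows from \<open>D(u,z) \<le> C |z|\<close>: the difference quotients of \<open>u\<close> are
  densities of measures of bounded mass, a weak limit of which is the gradient. Weak compactness of
  measures on the torus is reduced to Helly's selection theorem on the line along a space-filling curve.
\<close>

subsection \<open>Translations of the torus\<close>

text \<open>The two halves of the limit energy inside the unit ball are both infinite as soon as u
  has positive total variation, so only the gap between V and D/|z| can be integrated against
  \<open>K\<^sub>0\<close>. That the gap has a sign is therefore needed before anything can be said
  about the integral: it gives a value in [0,\<infinity>] and makes Fatou available. For \<epsilon>
  > 0 the energy is given in separated form, and the two forms match because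
  \<open>unit_ball_vol (d - 1)\<close> in \<open>kernel_mass\<close> is half the integral of
  |\<theta> . \<omega>| over the unit sphere in \<theta>, for every unit vector \<omega>; this
  number is obtained from the first moment of the ball, without a surface measure. A second obstacle
  is measurability: the kernels are measurable only as functions of z, while the hypotheses
  integrate over radii, and \<open>K\<^sub>0\<close> may be infinite. Profiles are therefore
  replaced by a Borel profile that agrees with them for almost every positive radius and at almost
  every point.\<close>

definition red :: "real \<Rightarrow> real^'n \<Rightarrow> real^'n" where
  "red l x = (\<chi> i. x $ i - l * of_int \<lfloor>x $ i / l\<rfloor>)"

text \<open>Completed Lebesgue measure, because representatives of BV classes are only Lebesgue
  measurable. The price is that translations have to be shown measurable for the completed
  sets.\<close>

definition torus_measure :: "real \<Rightarrow> (real^'n) measure" where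
  "torus_measure l = restrict_space lebesgue (torus l)"

lemma red_in_torus: "l > 0 \<Longrightarrow> red l x \<in> torus l"
proof -
  assume l: "l > 0"
  have "0 \<le> x $ i - l * of_int \<lfloor>x $ i / l\<rfloor> \<and> x $ i - l * of_int \<lfloor>x $ i / l\<rfloor> < l" for i
    using floor_divide_lower[OF l, of "x $ i"] floor_divide_upper[OF l, of "x $ i"] by (simp add: algebra_simps)
  then show ?thesis by (simp add: torus_def red_def)
qed

lemma periodic_nat:
  assumes p: "periodic l u"
  shows "u (x + (of_nat n * l) *\<^sub>R axis i 1) = u x"
proof (induction n)
  case (Suc n)
  have "u (x + (of_nat (Suc n) * l) *\<^sub>R axis i 1) = u ((x + (of_nat n * l) *\<^sub>R axis i 1) + l *\<^sub>R axis i 1)"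
    by (simp add: algebra_simps)
  with p Suc show ?case unfolding periodic_def by metis
qed simp

lemma periodic_int:
  assumes p: "periodic l u"
  shows "u (x + (of_int k * l) *\<^sub>R axis i 1) = u x"
proof (cases "k \<ge> 0")
  case True
  then show ?thesis using periodic_nat[OF p, of x "nat k" i] by simp
next
  case False
  then show ?thesis using periodic_nat[OF p, of "x + (of_int k * l) *\<^sub>R axis i 1" "nat (- k)" i]
    by (simp add: algebra_simps)
qed

lemma periodic_lattice:
  fixes u :: "real^'n \<Rightarrow> 'b"
  assumes p: "periodic l u"
  shows "u (x + l *\<^sub>R (\<chi> i. of_int (k i))) = u x"
proof -
  have "u (x + (\<Sum>i\<in>A. (of_int (k i) * l) *\<^sub>R axis i 1)) = u x" if "finite A" for A :: "'n set"
    using that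
  proof induction
    case (insert i A)
    then show ?case
      using periodic_int[OF p, of "x + (\<Sum>i\<in>A. (of_int (k i) * l) *\<^sub>R axis i 1)" "k i" i]
      by (simp add: algebra_simps)
  qed simp
  from this[of UNIV] have "u (x + (\<Sum>i\<in>UNIV. (of_int (k i) * l) *\<^sub>R axis i 1)) = u x" by simp
  also have "(\<Sum>i\<in>UNIV. (of_int (k i) * l) *\<^sub>R axis i (1::real)) = l *\<^sub>R (\<chi> i. of_int (k i))"
    by (simp add: vec_eq_iff axis_def if_distrib sum.delta cong: if_cong)
  finally show ?thesis .
qed

lemma periodic_red:
  assumes "periodic l u" shows "u (red l x) = u x"
proof -
  have "red l x = x + l *\<^sub>R (\<chi> i. of_int (- \<lfloor>x $ i / l\<rfloor>))"
    by (simp add: red_def vec_eq_iff)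
  then show ?thesis using periodic_lattice[OF assms] by metis
qed

lemma periodic_shift: "periodic l u \<Longrightarrow> periodic l (\<lambda>x. u (x + z))"
  unfolding periodic_def by (metis add.assoc add.commute)

lemma sets_torus [measurable]: "torus l \<in> sets borel"
proof -
  have "torus l = (\<Inter>i. {x::real^'n. 0 \<le> x $ i} \<inter> {x. x $ i < l})"
    by (auto simp: torus_def)
  also have "\<dots> \<in> sets borel"
    by (intro sets.finite_INT sets.Int) auto
  finally show ?thesis .
qed

lemma sets_torus_lebesgue: "torus l \<in> sets lebesgue"
  by simp

lemma torus_sub_cbox: "torus l \<subseteq> cbox 0 (\<chi> i. l)"
  by (auto simp: torus_def mem_box_cart less_imp_le)

lemma emeasure_torus:
  assumes "l > 0" shows "emeasure lborel (torus l :: (real^'n) set) = ennreal (l ^ CARD('n))"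
proof -
  let ?B = "(\<chi> i. l) :: real^'n"
  have "(\<Prod>b\<in>Basis. (?B - 0) \<bullet> b) = l ^ CARD('n)"
    by (simp add: Basis_vec_def prod.UNION_disjoint axis_eq_axis inner_axis)
  then have 1: "emeasure lborel (cbox 0 ?B :: (real^'n) set) = ennreal (l ^ CARD('n))"
       "emeasure lborel (box 0 ?B :: (real^'n) set) = ennreal (l ^ CARD('n))"
    using assms by (auto simp: emeasure_lborel_cbox_eq emeasure_lborel_box_eq Basis_vec_def inner_axis)
  have "box 0 ?B \<subseteq> torus l"
    by (auto simp: torus_def mem_box_cart less_imp_le)
  then have "emeasure lborel (box 0 ?B) \<le> emeasure lborel (torus l :: (real^'n) set)"
    by (intro emeasure_mono) auto
  moreover have "emeasure lborel (torus l :: (real^'n) set) \<le> emeasure lborel (cbox 0 ?B)"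
    by (intro emeasure_mono torus_sub_cbox) auto
  ultimately show ?thesis using 1 by simp
qed

lemma space_torus_measure [simp]: "space (torus_measure l) = torus l"
  by (simp add: torus_measure_def space_restrict_space)

lemma sets_torus_measure: "A \<in> sets (torus_measure l) \<longleftrightarrow> A \<in> sets lebesgue \<and> A \<subseteq> torus l"
  unfolding torus_measure_def by (subst sets_restrict_space_iff) auto

lemma emeasure_torus_measure: "emeasure (torus_measure l) (torus l :: (real^'n) set) = emeasure lborel (torus l :: (real^'n) set)"
  by (simp add: torus_measure_def emeasure_restrict_space)

lemma finite_torus_measure: "l > 0 \<Longrightarrow> finite_measure (torus_measure l)"
  by standard (simp add: emeasure_torus_measure emeasure_torus)

lemma measure_torus: "l > 0 \<Longrightarrow> measure (torus_measure l) (torus l :: (real^'n) set) = l ^ CARD('n)"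
  by (simp add: emeasure_torus_measure measure_def emeasure_torus)

lemma set_integral_torus:
  fixes f :: "real^'n \<Rightarrow> 'b::{banach, second_countable_topology}"
  shows "(LINT x:torus l|lebesgue. f x) = (\<integral>x. f x \<partial>torus_measure l)"
  unfolding torus_measure_def set_lebesgue_integral_def
  by (subst integral_restrict_space) auto

lemma set_integrable_torus:
  fixes f :: "real^'n \<Rightarrow> 'b::{banach, second_countable_topology}"
  shows "set_integrable lebesgue (torus l) f \<longleftrightarrow> integrable (torus_measure l) f"
  unfolding torus_measure_def set_integrable_def
  by (subst integrable_restrict_space) auto

lemma torus_measure_borel: "(\<lambda>x. x) \<in> measurable (torus_measure l) borel"
  unfolding torus_measure_def by (intro measurable_restrict_space1 measurable_completion) simp

lemma torus_measure_borel_fun: "f \<in> borel_measurable borel \<Longrightarrow> f \<in> borel_measurable (torus_measure l)"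
  using measurable_compose[OF torus_measure_borel] by fast

text \<open>\<open>l * k i\<close> is a difference of two numbers in \<open>[0,l)\<close>, so it
  lies strictly between \<open>-l\<close> and \<open>l\<close>. Positivity of \<open>l\<close>
  follows from the torus being inhabited.\<close>

lemma lattice_cell_unique:
  assumes "x \<in> torus l" "y \<in> torus l" "y = x + l *\<^sub>R (\<chi> i. of_int (k i))" shows "k i = 0"
proof -
  have "y $ i = x $ i + l * of_int (k i)" using assms(3) by simp
  moreover have "0 \<le> x $ i" "x $ i < l" "0 \<le> y $ i" "y $ i < l" using assms by (auto simp: torus_def)
  ultimately have *: "l * of_int (k i) < l" "- l < l * of_int (k i)" and l: "l > 0" by linarith+
  have "real_of_int (k i) < 1"
    using *(1) l by (simp add: mult_less_cancel_left2)
  moreover have "- 1 < real_of_int (k i)"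
  proof (rule ccontr)
    assume "\<not> - 1 < real_of_int (k i)"
    then have "l * real_of_int (k i) \<le> l * (- 1)" using l by (intro mult_left_mono) auto
    with *(2) show False by simp
  qed
  ultimately show ?thesis by linarith
qed

text \<open>
  The torus is a fundamental domain of the lattice, and so is each of its translates: cut one of them
  along the lattice translates of the other.
\<close>

lemma distr_torus_shift:
  fixes z :: "real^'n"
  assumes l: "l > 0"
  shows "(\<lambda>x. red l (x + z)) \<in> measurable (torus_measure l) (torus_measure l)"
    and "distr (torus_measure l) (torus_measure l) (\<lambda>x. red l (x + z)) = torus_measure l"
proof -
  define v :: "('n \<Rightarrow> int) \<Rightarrow> real^'n" where "v k = l *\<^sub>R (\<chi> i. of_int (k i))" for k
  have tr: "{x. x + w \<in> X} \<in> sets lebesgue" "emeasure lebesgue {x. x + w \<in> X} = emeasure lebesgue X"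
    if "X \<in> sets lebesgue" for X and w :: "real^'n"
  proof -
    have eq: "{x. x + w \<in> X} = (+) (- w) ` X"
    proof (intro set_eqI iffI)
      fix x assume "x \<in> {x. x + w \<in> X}"
      then show "x \<in> (+) (- w) ` X" by (intro image_eqI[where x = "x + w"]) (simp, blast)
    next
      fix x assume "x \<in> (+) (- w) ` X"
      then obtain y where "x = - w + y" "y \<in> X" by (rule imageE)
      then show "x \<in> {x. x + w \<in> X}" by simp
    qed
    show "{x. x + w \<in> X} \<in> sets lebesgue"
      unfolding eq using that by (rule lebesgue_sets_translation)
    show "emeasure lebesgue {x. x + w \<in> X} = emeasure lebesgue X"
    proof -
      have "(+) (- w) ` X = (\<lambda>x. 1 *\<^sub>R x + - w) ` X" by (intro image_cong refl) (simp only: scaleR_one add.commute)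
      then have "emeasure lebesgue ((+) (- w) ` X) = ennreal (\<bar>1\<bar> ^ DIM(real^'n)) * emeasure lebesgue X"
        using emeasure_lebesgue_affine[of 1 "-w" X] by (simp only:)
      then show ?thesis by (simp only: eq abs_one power_one ennreal_1 mult_1)
    qed
  qed
  have v_minus: "v (\<lambda>i. - k i) = - v k" for k by (simp add: v_def vec_eq_iff)
  have red_v: "\<exists>k. red l y = y + v k" for y
    by (rule exI[of _ "\<lambda>i. - \<lfloor>y $ i / l\<rfloor>"]) (simp add: red_def v_def vec_eq_iff)
  have red_eq: "red l y = y + v k" if "y + v k \<in> torus l" for y k
  proof -
    obtain k' where k': "red l y = y + v k'" using red_v by blast
    have eq: "(y + v k) = red l y + l *\<^sub>R (\<chi> i. of_int (k i - k' i))"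
      unfolding k' by (simp add: v_def vec_eq_iff algebra_simps)
    then have "k i - k' i = 0" for i
      using lattice_cell_unique[OF red_in_torus[OF l] that eq] by simp
    then have "k = k'" by (intro ext) simp
    then show ?thesis using k' by simp
  qed
  \<comment> \<open>\<open>P X k\<close> collects the points that need the lattice vector
    \<open>v k\<close> to land in \<open>X\<close> after the shift by \<open>z\<close>. By
    uniqueness of that vector the pieces are disjoint; shifting piece \<open>k\<close> by
    \<open>z + v k\<close> gives the piece \<open>Q k\<close> of \<open>X\<close>, and the
    \<open>Q k\<close> tile \<open>X\<close>.\<close>
  define P where "P X k = {x \<in> torus l. x + (z + v k) \<in> X}" for X k
  have pre: "(\<lambda>x. red l (x + z)) -` X \<inter> torus l = (\<Union>k. P X k)" if "X \<subseteq> torus l" for X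
  proof (intro set_eqI iffI)
    fix x assume x: "x \<in> (\<lambda>x. red l (x + z)) -` X \<inter> torus l"
    obtain k where "red l (x + z) = x + z + v k" using red_v by blast
    with x show "x \<in> (\<Union>k. P X k)" by (auto simp: P_def add.assoc)
  next
    fix x assume "x \<in> (\<Union>k. P X k)"
    then obtain k where k: "x \<in> torus l" "x + z + v k \<in> X" by (auto simp: P_def add.assoc)
    with that red_eq[of "x + z" k] show "x \<in> (\<lambda>x. red l (x + z)) -` X \<inter> torus l" by auto
  qed
  have disj: "disjoint_family (P X)" if XT: "X \<subseteq> torus l" for X
    unfolding disjoint_family_on_def
  proof (intro ballI impI, rule ccontr)
    fix k k' assume "k \<noteq> k'" "P X k \<inter> P X k' \<noteq> {}"
    then obtain x where "x + z + v k \<in> torus l" "x + z + v k' \<in> torus l"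
      using XT unfolding P_def by (auto simp: add.assoc)
    then have "v k = v k'" using red_eq by (metis add_left_cancel)
    then have "k = k'" using l by (auto simp: v_def vec_eq_iff)
    with \<open>k \<noteq> k'\<close> show False by simp
  qed
  have Pm: "P X k \<in> sets lebesgue" if "X \<in> sets lebesgue" for X k
  proof -
    have "P X k = torus l \<inter> {x. x + (z + v k) \<in> X}" by (auto simp: P_def)
    then show ?thesis using sets.Int[OF sets_torus_lebesgue tr(1)[OF that]] by metis
  qed

  show meas: "(\<lambda>x. red l (x + z)) \<in> measurable (torus_measure l) (torus_measure l)"
  proof (rule measurableI)
    fix x :: "real^'n" assume "x \<in> space (torus_measure l)"
    then show "red l (x + z) \<in> space (torus_measure l)" by (simp add: red_in_torus[OF l])
  next
    fix X :: "(real^'n) set" assume "X \<in> sets (torus_measure l)"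
    then have X: "X \<in> sets lebesgue" "X \<subseteq> torus l" by (auto simp: sets_torus_measure)
    \<comment> \<open>The lattice is countable because \<open>'n\<close> is finite.\<close>
    have "countable (UNIV :: ('n \<Rightarrow> int) set)" by simp
    then have "(\<Union>k. P X k) \<in> sets lebesgue" using Pm[OF X(1)] by (intro sets.countable_UN') auto
    moreover have "(\<Union>k. P X k) \<subseteq> torus l" by (auto simp: P_def)
    ultimately show "(\<lambda>x. red l (x + z)) -` X \<inter> space (torus_measure l) \<in> sets (torus_measure l)"
      using pre[OF X(2)] by (simp add: sets_torus_measure)
  qed
  show "distr (torus_measure l) (torus_measure l) (\<lambda>x. red l (x + z)) = torus_measure l"
  proof (rule measure_eqI)
    fix X assume "X \<in> sets (distr (torus_measure l) (torus_measure l) (\<lambda>x. red l (x + z)))"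
    then have Xm: "X \<in> sets (torus_measure l)" by simp
    then have X: "X \<in> sets lebesgue" "X \<subseteq> torus l" by (auto simp: sets_torus_measure)
    define Q where "Q k = {y \<in> X. y - (z + v k) \<in> torus l}" for k
    have Q: "Q k \<in> sets lebesgue" for k
    proof -
      have "Q k = X \<inter> {y. y + (- (z + v k)) \<in> torus l}"
        unfolding Q_def add_uminus_conv_diff by auto
      then show ?thesis using sets.Int[OF X(1) tr(1)[OF sets_torus_lebesgue]] by metis
    qed
    have "P X k = {x. x + (z + v k) \<in> Q k}" for k by (auto simp: P_def Q_def)
    then have PQ: "emeasure lebesgue (P X k) = emeasure lebesgue (Q k)" for k
      using tr(2)[OF Q] by simp
    have UQ: "(\<Union>k. Q k) = X"
    proof (intro set_eqI iffI)
      fix y assume y: "y \<in> X"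
      obtain k where "red l (y - z) = y - z + v k" using red_v by blast
      then have "y - (z + v (\<lambda>i. - k i)) \<in> torus l"
        using red_in_torus[OF l, of "y - z"] by (simp add: v_minus diff_diff_eq2 diff_add_eq)
      with y show "y \<in> (\<Union>k. Q k)" by (auto simp: Q_def)
    qed (auto simp: Q_def)
    have dQ: "disjoint_family Q"
      unfolding disjoint_family_on_def
    proof (intro ballI impI, rule ccontr)
      fix k k' assume kk: "k \<noteq> k'" "Q k \<inter> Q k' \<noteq> {}"
      then obtain y where y: "y - (z + v k) \<in> torus l" "y - (z + v k') \<in> torus l" by (auto simp: Q_def)
      have eq: "y - (z + v k') = y - (z + v k) + l *\<^sub>R (\<chi> i. of_int (k i - k' i))"
        by (simp add: v_def vec_eq_iff algebra_simps)
      have "k i - k' i = 0" for i by (rule lattice_cell_unique[OF y eq])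
      then have "k = k'" by (intro ext) simp
      with kk show False by simp
    qed
    have "emeasure (distr (torus_measure l) (torus_measure l) (\<lambda>x. red l (x + z))) X
        = emeasure lebesgue (\<Union>k. P X k)"
    proof -
      have "(\<Union>k. P X k) \<subseteq> torus l" by (auto simp: P_def)
      then have "emeasure (torus_measure l) (\<Union>k. P X k) = emeasure lebesgue (\<Union>k. P X k)"
        unfolding torus_measure_def by (intro emeasure_restrict_space) simp_all
      then show ?thesis
        using emeasure_distr[OF meas Xm] pre[OF X(2)] by simp
    qed
    also have "\<dots> = (\<integral>\<^sup>+k. emeasure lebesgue (P X k) \<partial>count_space UNIV)"
      using Pm[OF X(1)] disj[OF X(2)] by (intro emeasure_UN_countable) simp_all
    also have "\<dots> = (\<integral>\<^sup>+k. emeasure lebesgue (Q k) \<partial>count_space UNIV)"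
      by (simp add: PQ)
    also have "\<dots> = emeasure lebesgue (\<Union>k. Q k)"
      using Q dQ by (intro emeasure_UN_countable[symmetric]) simp_all
    also have "\<dots> = emeasure (torus_measure l) X"
      unfolding UQ torus_measure_def using X by (intro emeasure_restrict_space[symmetric]) simp_all
    finally show "emeasure (distr (torus_measure l) (torus_measure l) (\<lambda>x. red l (x + z))) X = emeasure (torus_measure l) X" .
  qed simp
qed

lemma torus_measure_shift_measurable:
  fixes f :: "real^'n \<Rightarrow> 'b::topological_space"
  assumes l: "l > 0" and p: "periodic l f" and f: "f \<in> borel_measurable (torus_measure l)"
  shows "(\<lambda>x. f (x + z)) \<in> borel_measurable (torus_measure l)"
  using measurable_compose[OF distr_torus_shift(1)[OF l] f, of z] by (simp add: periodic_red[OF p])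

lemma torus_measure_shift_integrable:
  fixes f :: "real^'n \<Rightarrow> 'b::{banach, second_countable_topology}"
  assumes l: "l > 0" and p: "periodic l f" and f: "integrable (torus_measure l) f"
  shows "integrable (torus_measure l) (\<lambda>x. f (x + z))"
  using integrable_distr_eq[OF distr_torus_shift(1)[OF l, of z], of f] f
  by (simp add: distr_torus_shift(2)[OF l] periodic_red[OF p])

lemma torus_measure_shift_integral:
  fixes f :: "real^'n \<Rightarrow> 'b::{banach, second_countable_topology}"
  assumes l: "l > 0" and p: "periodic l f" and f: "f \<in> borel_measurable (torus_measure l)"
  shows "(\<integral>x. f (x + z) \<partial>torus_measure l) = (\<integral>x. f x \<partial>torus_measure l)"
  using integral_distr[OF distr_torus_shift(1)[OF l, of z], of f] f
  by (simp add: distr_torus_shift(2)[OF l] periodic_red[OF p])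

subsection \<open>Test functions\<close>

text \<open>Repeats the premise on test pairs in \<open>is_polar_gradient\<close>, so that it can be
  folded there. Periodicity is asked of \<open>\<phi>\<close> only; that of the gradient is a
  consequence, see \<open>test_function_gradient_periodic\<close>.\<close>

definition test_function :: "real \<Rightarrow> (real^'n \<Rightarrow> real) \<Rightarrow> (real^'n \<Rightarrow> real^'n) \<Rightarrow> bool" where
  "test_function l \<phi> g \<longleftrightarrow> periodic l \<phi> \<and> continuous_on UNIV g \<and>
     (\<forall>x. (\<phi> has_derivative (\<lambda>h. g x \<bullet> h)) (at x))"

lemma test_function_continuous: "test_function l \<phi> g \<Longrightarrow> continuous_on UNIV \<phi>"
  unfolding test_function_def
  by (intro continuous_at_imp_continuous_on ballI) (blast intro: has_derivative_continuous)

lemma test_function_borel: "test_function l \<phi> g \<Longrightarrow> \<phi> \<in> borel_measurable borel"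
  by (intro borel_measurable_continuous_onI test_function_continuous)

lemma test_function_gradient_borel: "test_function l \<phi> g \<Longrightarrow> g \<in> borel_measurable borel"
  unfolding test_function_def by (intro borel_measurable_continuous_onI) auto

lemma test_function_const: "test_function l (\<lambda>_. c) (\<lambda>_. 0)"
  by (auto simp: test_function_def periodic_def)

lemma test_function_diff:
  assumes "test_function l \<phi> g" "test_function l \<psi> h"
  shows "test_function l (\<lambda>x. \<phi> x - \<psi> x) (\<lambda>x. g x - h x)"
  using assms unfolding test_function_def periodic_def
  by (auto intro!: derivative_eq_intros continuous_intros simp: inner_diff_left)

lemma test_function_mult:
  assumes "test_function l \<phi> g" "test_function l \<psi> h"
  shows "test_function l (\<lambda>x. \<phi> x * \<psi> x) (\<lambda>x. \<phi> x *\<^sub>R h x + \<psi> x *\<^sub>R g x)"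
  using assms test_function_continuous[OF assms(1)] test_function_continuous[OF assms(2)]
  unfolding test_function_def periodic_def
  by (auto intro!: derivative_eq_intros continuous_intros simp: inner_add_left)

text \<open>Serves twice: products over the coordinates approximate indicators of orthants, and
  products of complements approximate complements of finite unions.\<close>

lemma test_function_prod:
  assumes "finite A" "\<And>i. i \<in> A \<Longrightarrow> \<exists>g. test_function l (\<phi> i) g"
  shows "\<exists>g. test_function l (\<lambda>x. \<Prod>i\<in>A. \<phi> i x) g"
  using assms
proof induction
  case empty
  then show ?case using test_function_const[of l 1] by auto
next
  case (insert i A)
  then obtain g h where "test_function l (\<phi> i) g" "test_function l (\<lambda>x. \<Prod>i\<in>A. \<phi> i x) h" by blast
  from test_function_mult[OF this] insert show ?case by auto
qed

lemma test_function_shift: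
  assumes "test_function l \<phi> g"
  shows "test_function l (\<lambda>x. \<phi> (x + z)) (\<lambda>x. g (x + z))"
proof -
  have "((\<lambda>x. \<phi> (x + z)) has_derivative (\<lambda>h. g (x + z) \<bullet> h)) (at x)" for x
  proof -
    have 1: "((\<lambda>x. x + z) has_derivative (\<lambda>h. h)) (at x)"
      by (rule has_derivative_add_const, rule has_derivative_ident)
    have 2: "(\<phi> has_derivative (\<lambda>h. g (x + z) \<bullet> h)) (at (x + z))"
      using assms unfolding test_function_def by blast
    show ?thesis by (rule has_derivative_compose[OF 1 2])
  qed
  moreover have "continuous_on UNIV (\<lambda>x. g (x + z))"
  proof (rule continuous_on_compose2[of UNIV g])
    show "continuous_on UNIV g" using assms by (simp add: test_function_def)
  qed (auto intro!: continuous_intros)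
  moreover have "periodic l (\<lambda>x. \<phi> (x + z))"
    using assms periodic_shift[of l \<phi> z] by (simp add: test_function_def)
  ultimately show ?thesis by (simp add: test_function_def)
qed

lemma test_function_coordinate:
  assumes "\<And>t. p (t + l) = p t" "\<And>t. (p has_real_derivative p' t) (at t)" "continuous_on UNIV p'"
  shows "test_function l (\<lambda>x::real^'n. p (x $ i)) (\<lambda>x. p' (x $ i) *\<^sub>R axis i 1)"
  unfolding test_function_def
proof (intro conjI allI)
  show "periodic l (\<lambda>x::real^'n. p (x $ i))"
    using assms(1) assms(1)[where t = "_ :: real"] by (auto simp: periodic_def axis_def)
  show "continuous_on UNIV (\<lambda>x::real^'n. p' (x $ i) *\<^sub>R axis i (1::real))"
  proof (intro continuous_intros)
    show "continuous_on UNIV (\<lambda>x::real^'n. p' (x $ i))"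
      by (rule continuous_on_compose2[OF assms(3)]) (auto intro: continuous_on_component)
  qed
  fix x :: "real^'n"
  have "((\<lambda>x::real^'n. x $ i) has_derivative (\<lambda>h. h $ i)) (at x)"
    by (intro bounded_linear.has_derivative[OF bounded_linear_vec_nth] has_derivative_ident)
  from has_derivative_compose[OF this, of p "(*) (p' (x $ i))"]
  show "((\<lambda>x. p (x $ i)) has_derivative (\<lambda>h. (p' (x $ i) *\<^sub>R axis i 1) \<bullet> h)) (at x)"
    using assms(2)[of "x $ i"] by (simp add: has_field_derivative_def inner_axis')
qed

section \<open>Smooth periodic approximation of Borel sets\<close>

lemma has_real_derivative_pos_part_square:
  "((\<lambda>s. (max 0 s)\<^sup>2) has_real_derivative 2 * max 0 s) (at (s::real))"
proof -
  consider "s > 0" | "s < 0" | "s = 0" by linarith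
  then show ?thesis
  proof cases
    case 1
    have "((\<lambda>s. s\<^sup>2) has_real_derivative 2 * max 0 s) (at s)"
      using 1 by (auto intro!: derivative_eq_intros)
    then show ?thesis
      by (rule has_field_derivative_transform_within_open[of _ _ _ "{0<..}"]) (use 1 in auto)
  next
    case 2
    have "((\<lambda>s. 0) has_real_derivative 2 * max 0 s) (at s)"
      using 2 by auto
    then show ?thesis
      by (rule has_field_derivative_transform_within_open[of _ _ _ "{..<0}"]) (use 2 in auto)
  next
    case 3
    \<comment> \<open>At the kink the difference quotient is at most \<open>\<bar>h\<bar>\<close>;
      this is why the positive part is squared.\<close>
    have "((\<lambda>h. (max 0 h)\<^sup>2 / h) \<longlongrightarrow> 0) (at (0::real))"
    proof (rule Lim_null_comparison)
      show "\<forall>\<^sub>F h in at 0. norm ((max 0 h)\<^sup>2 / h) \<le> \<bar>h\<bar>"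
        by (intro always_eventually) (auto simp: max_def power2_eq_square)
      show "((\<lambda>h. \<bar>h\<bar>) \<longlongrightarrow> 0) (at (0::real))"
        by (rule tendsto_eq_intros refl | simp)+
    qed
    then show ?thesis using 3 by (simp add: DERIV_def)
  qed
qed

text \<open>
  The square of the positive part of \<open>cos (2 \<pi> (t - c) / l) - cos \<theta>\<close> is continuously differentiable
  and periodic, and on \<open>[0,l)\<close> it is positive exactly on the arc of half-length \<open>\<theta> l / (2 \<pi>)\<close> around \<open>c\<close>.
\<close>

lemma periodic_arc_function:
  assumes l: "l > 0" and a: "0 \<le> a" "a < l"
  obtains h h' :: "real \<Rightarrow> real" where "\<And>t. h (t + l) = h t" "\<And>t. (h has_real_derivative h' t) (at t)"
    "continuous_on UNIV h'" "\<And>t. 0 \<le> h t" "\<And>t. h t \<le> 1" "\<And>t. 0 \<le> t \<Longrightarrow> t < l \<Longrightarrow> h t > 0 \<longleftrightarrow> a < t"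
proof -
  \<comment> \<open>The arc is \<open>(a,l)\<close>: its midpoint is \<open>c\<close>, and its
    half-length \<open>(l - a) / 2\<close> becomes the angle \<open>\<theta>\<close> under the
    factor \<open>2 * pi / l\<close>.\<close>
  define c where "c = (a + l) / 2"
  define \<theta> where "\<theta> = pi * (l - a) / l"
  define q where "q t = 2 * pi * (t - c) / l" for t
  define s where "s t = cos (q t) - cos \<theta>" for t
  define s' where "s' t = - sin (q t) * (2 * pi / l)" for t
  have \<theta>: "0 < \<theta>" "\<theta> \<le> pi" using l a by (auto simp: \<theta>_def field_simps)
  have s': "(s has_real_derivative s' t) (at t)" for t
    unfolding s_def s'_def q_def using l by (auto intro!: derivative_eq_intros)
  have sper: "s (t + l) = s t" for t
  proof -
    have "q (t + l) = q t + 2 * pi" using l by (simp add: q_def field_simps)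
    then show ?thesis by (simp add: s_def)
  qed
  have sle: "s t \<le> 2" for t
    using cos_le_one[of "q t"] cos_ge_minus_one[of \<theta>] unfolding s_def by linarith
  have pos: "s t > 0 \<longleftrightarrow> a < t" if t: "0 \<le> t" "t < l" for t
  proof
    assume "a < t"
    then have "\<bar>t - c\<bar> < (l - a) / 2" using t by (auto simp: c_def abs_if field_simps)
    then have "2 * pi / l * \<bar>t - c\<bar> < 2 * pi / l * ((l - a) / 2)"
      using l by (intro mult_strict_left_mono) auto
    moreover have "2 * pi / l * \<bar>t - c\<bar> = \<bar>q t\<bar>" using l by (simp add: q_def abs_mult)
    moreover have "2 * pi / l * ((l - a) / 2) = \<theta>" by (simp add: \<theta>_def)
    ultimately have "\<bar>q t\<bar> < \<theta>" by simp
    then have "cos \<theta> < cos \<bar>q t\<bar>" using \<theta> by (intro cos_monotone_0_pi) auto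
    then show "s t > 0" by (simp add: s_def)
  next
    assume st: "s t > 0"
    show "a < t"
    proof (rule ccontr)
      assume "\<not> a < t"
      then have tc: "(l - a) / 2 \<le> c - t" "c - t \<le> (l + a) / 2" using t by (auto simp: c_def field_simps)
      have m: "2 * pi / l * ((l - a) / 2) \<le> 2 * pi / l * (c - t)" "2 * pi / l * (c - t) \<le> 2 * pi / l * ((l + a) / 2)"
        using l tc by (intro mult_left_mono; simp)+
      have e: "2 * pi / l * (c - t) = - q t" "2 * pi / l * ((l - a) / 2) = \<theta>" "2 * pi / l * ((l + a) / 2) = 2 * pi - \<theta>"
        using l by (auto simp: q_def \<theta>_def field_simps)
      have q: "\<theta> \<le> - q t" "- q t \<le> 2 * pi - \<theta>" using m unfolding e by auto
      have "cos (- q t) \<le> cos \<theta>"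
      proof (cases "- q t \<le> pi")
        case True
        then show ?thesis using q \<theta> by (intro cos_monotone_0_pi_le) auto
      next
        case False
        \<comment> \<open>Past the angle pi the cosine increases again, so the argument is reflected
          to \<open>2 * pi - (- q t)\<close>, which lies between \<open>\<theta>\<close> and
          pi.\<close>
        then have "cos (2 * pi - (- q t)) \<le> cos \<theta>" using q \<theta> by (intro cos_monotone_0_pi_le) auto
        then show ?thesis by (simp add: cos_diff cos_add)
      qed
      then show False using st by (simp add: s_def)
    qed
  qed
  \<comment> \<open>Since \<open>s\<close> is at most 2, division by 4 brings the square into
    [0,1].\<close>
  show thesis
  proof (rule that[of "\<lambda>t. (max 0 (s t))\<^sup>2 / 4" "\<lambda>t. 2 * max 0 (s t) * s' t / 4"])
    fix t
    show "((\<lambda>t. (max 0 (s t))\<^sup>2 / 4) has_real_derivative 2 * max 0 (s t) * s' t / 4) (at t)"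
      by (intro DERIV_cdivide DERIV_chain2[OF has_real_derivative_pos_part_square s'])
    have "(max 0 (s t))\<^sup>2 \<le> 2\<^sup>2" using sle[of t] by (intro power_mono) auto
    then show "(max 0 (s t))\<^sup>2 / 4 \<le> 1" by simp
    show "0 < (max 0 (s t))\<^sup>2 / 4 \<longleftrightarrow> a < t" if "0 \<le> t" "t < l"
      using pos[OF that] by (auto simp: zero_less_power2 max_def)
  next
    have "continuous_on UNIV s" by (intro continuous_at_imp_continuous_on ballI DERIV_isCont[OF s'])
    moreover have "continuous_on UNIV s'"
      unfolding s'_def q_def using l by (intro continuous_intros) auto
    ultimately show "continuous_on UNIV (\<lambda>t. 2 * max 0 (s t) * s' t / 4)"
      by (intro continuous_intros) auto
  qed (auto simp: sper)
qed

text \<open>With \<open>h\<close> positive exactly on the arc \<open>(a,l)\<close>, the powers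
  \<open>(1 - h t) ^ n\<close> tend to 0 on the arc and stay 1 on the rest of \<open>[0,l)\<close>.
  If \<open>a\<close> is outside \<open>[0,l)\<close>, the half-line contains the whole cell or
  misses it, and constants do.\<close>

lemma periodic_halfline_approx:
  assumes l: "l > 0"
  obtains P P' :: "nat \<Rightarrow> real \<Rightarrow> real" where "\<And>n t. P n (t + l) = P n t"
    "\<And>n t. (P n has_real_derivative P' n t) (at t)" "\<And>n. continuous_on UNIV (P' n)"
    "\<And>n t. 0 \<le> P n t" "\<And>n t. P n t \<le> 1"
    "\<And>t. 0 \<le> t \<Longrightarrow> t < l \<Longrightarrow> (\<lambda>n. P n t) \<longlonglongrightarrow> (if a < t then 1 else 0)"
proof -
  consider "a < 0" | "0 \<le> a" "a < l" | "l \<le> a" by linarith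
  then show thesis
  proof cases
    case 1
    show thesis by (rule that[of "\<lambda>_ _. 1" "\<lambda>_ _. 0"]) (use 1 in auto)
  next
    case 3
    show thesis by (rule that[of "\<lambda>_ _. 0" "\<lambda>_ _. 0"]) (use 3 in auto)
  next
    case 2
    obtain h h' where h: "\<And>t. h (t + l) = h t" "\<And>t. (h has_real_derivative h' t) (at t)"
      "continuous_on UNIV h'" "\<And>t. 0 \<le> h t" "\<And>t. h t \<le> 1" "\<And>t. 0 \<le> t \<Longrightarrow> t < l \<Longrightarrow> h t > 0 \<longleftrightarrow> a < t"
      using periodic_arc_function[OF l 2] by blast
    have hc: "continuous_on UNIV h" by (intro continuous_at_imp_continuous_on ballI DERIV_isCont[OF h(2)])
    show thesis
    proof (rule that[of "\<lambda>n t. 1 - (1 - h t) ^ n" "\<lambda>n t. real n * (1 - h t) ^ (n - 1) * h' t"])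
      fix n t
      show "((\<lambda>t. 1 - (1 - h t) ^ n) has_real_derivative real n * (1 - h t) ^ (n - 1) * h' t) (at t)"
        by (rule derivative_eq_intros h(2) refl)+ simp
      show "0 \<le> 1 - (1 - h t) ^ n" using h(4,5)[of t] by (simp add: power_le_one)
      show "1 - (1 - h t) ^ n \<le> 1" using h(5)[of t] by simp
    next
      fix n show "continuous_on UNIV (\<lambda>t. real n * (1 - h t) ^ (n - 1) * h' t)"
        by (intro continuous_intros hc h(3))
    next
      fix t assume t: "0 \<le> t" "t < l"
      show "(\<lambda>n. 1 - (1 - h t) ^ n) \<longlonglongrightarrow> (if a < t then 1 else 0)"
      proof (cases "a < t")
        case True
        then have "h t > 0" using h(6)[OF t] by simp
        then have "(\<lambda>n. (1 - h t) ^ n) \<longlonglongrightarrow> 0" using h(5)[of t] by (intro LIMSEQ_realpow_zero) auto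
        from tendsto_diff[OF tendsto_const[of 1] this] True show ?thesis by simp
      next
        case False
        then have "h t = 0" using h(6)[OF t] h(4)[of t] by simp
        then show ?thesis using False by simp
      qed
    qed (simp add: h(1))
  qed
qed

text \<open>Open orthants are stable under intersection and their indicators factor over the
  coordinates, so one-dimensional approximations suffice. A half-space is the union of the orthants
  whose remaining bounds are \<open>- real n\<close>.\<close>

lemma orthants_generate_borel:
  "(borel :: (real^'n) measure) = sigma UNIV (range (\<lambda>a::'n \<Rightarrow> real. {x. \<forall>i. a i < x $ i}))"
proof (rule borel_eq_sigmaI4[OF borel_eq_halfspace_greater])
  fix a :: real and b :: "real^'n"
  assume "(a, b) \<in> UNIV \<times> Basis"
  then obtain i where bi: "b = axis i 1" by (auto simp: Basis_vec_def)
  have "{x. a < x \<bullet> b} = (\<Union>n::nat. {x::real^'n. \<forall>j. (if j = i then a else - real n) < x $ j})"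
  proof (intro set_eqI iffI)
    fix x :: "real^'n" assume "x \<in> {x. a < x \<bullet> b}"
    then have x: "a < x $ i" by (simp add: bi inner_axis)
    obtain n where n: "norm x < real n" using reals_Archimedean2 by blast
    have "- real n < x $ j" for j using component_le_norm_cart[of x j] n by linarith
    with x show "x \<in> (\<Union>n::nat. {x. \<forall>j. (if j = i then a else - real n) < x $ j})" by auto
  next
    fix x :: "real^'n" assume "x \<in> (\<Union>n::nat. {x. \<forall>j. (if j = i then a else - real n) < x $ j})"
    then show "x \<in> {x. a < x \<bullet> b}" by (auto simp: bi inner_axis split: if_splits)
  qed
  also have "\<dots> \<in> sets (sigma UNIV (range (\<lambda>a::'n \<Rightarrow> real. {x. \<forall>i. a i < x $ i})))"
  proof (intro sets.countable_UN image_subsetI)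
    fix n :: nat
    show "{x::real^'n. \<forall>j. (if j = i then a else - real n) < x $ j} \<in> sets (sigma UNIV (range (\<lambda>a::'n \<Rightarrow> real. {x. \<forall>i. a i < x $ i})))"
      by (rule in_measure_of) auto
  qed
  finally show "{x. a < x \<bullet> b} \<in> sets (sigma UNIV (range (\<lambda>a::'n \<Rightarrow> real. {x. \<forall>i. a i < x $ i})))" .
next
  fix a :: "'n \<Rightarrow> real"
  have "{x::real^'n. \<forall>i. a i < x $ i} = (\<Inter>i. {x. a i < x $ i})" by auto
  also have "\<dots> \<in> sets borel" by (intro sets.finite_INT) auto
  finally show "{x::real^'n. \<forall>i. a i < x $ i} \<in> sets borel" .
qed

lemma abs_prod_diff_le:
  fixes a b :: "'i \<Rightarrow> real"
  assumes "\<And>i. i \<in> I \<Longrightarrow> \<bar>a i\<bar> \<le> 1" "\<And>i. i \<in> I \<Longrightarrow> \<bar>b i\<bar> \<le> 1"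
  shows "\<bar>(\<Prod>i\<in>I. a i) - (\<Prod>i\<in>I. b i)\<bar> \<le> (\<Sum>i\<in>I. \<bar>a i - b i\<bar>)"
  using norm_prod_diff[of I a b] assms by auto

lemma abs_diff_indicator_le: "0 \<le> p \<Longrightarrow> p \<le> 1 \<Longrightarrow> \<bar>p - indicator A x\<bar> \<le> (1::real)"
  by (auto simp: indicator_def)

text \<open>The sets that can be approximated form a Dynkin system containing the orthants. The
  measure is left general because both Lebesgue measure and the variation measure of a function are
  needed later.\<close>

lemma test_function_dense_set:
  fixes \<Lambda> :: "(real^'n) measure"
  assumes l: "l > 0" and fin: "finite_measure \<Lambda>" and sp: "space \<Lambda> = torus l"
    and mb: "(\<lambda>x. x) \<in> measurable \<Lambda> borel" and A: "A \<in> sets borel" and e: "e > 0"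
  shows "\<exists>\<psi> g. test_function l \<psi> g \<and> (\<forall>x. 0 \<le> \<psi> x \<and> \<psi> x \<le> 1) \<and> (\<integral>x. \<bar>\<psi> x - indicator A x\<bar> \<partial>\<Lambda>) < e"
proof -
  interpret finite_measure \<Lambda> by fact
  have bm: "f \<in> borel_measurable \<Lambda>" if "f \<in> borel_measurable borel" for f :: "real^'n \<Rightarrow> real"
    using measurable_compose[OF mb that] by simp
  have indm: "(indicator A :: _ \<Rightarrow> real) \<in> borel_measurable \<Lambda>" if "A \<in> sets borel" for A :: "(real^'n) set"
    using that by (intro bm borel_measurable_indicator)
  let ?G = "range (\<lambda>a::'n \<Rightarrow> real. {x::real^'n. \<forall>i. a i < x $ i})"
  let ?P = "\<lambda>A. \<forall>e>0. \<exists>\<psi> g. test_function l \<psi> g \<and> (\<forall>x. 0 \<le> \<psi> x \<and> \<psi> x \<le> 1) \<and> (\<integral>x. \<bar>\<psi> x - indicator A x\<bar> \<partial>\<Lambda>) < e"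
  note bd = abs_diff_indicator_le
  have intg: "integrable \<Lambda> (\<lambda>x. \<bar>\<psi> x - indicator A x\<bar>)"
    if "test_function l \<psi> g" "\<forall>x. 0 \<le> \<psi> x \<and> \<psi> x \<le> 1" "A \<in> sets borel" for \<psi> g A
    using bm[OF test_function_borel[OF that(1)]] indm[OF that(3)] that(2)
    by (intro integrable_const_bound[of _ 1]) (auto intro!: bd borel_measurable_abs borel_measurable_diff)
  have borel_sig: "sigma_sets UNIV ?G = sets borel"
    by (subst orthants_generate_borel) simp
  have "Int_stable ?G"
  proof (rule Int_stableI)
    fix X Y assume "X \<in> ?G" "Y \<in> ?G"
    then obtain a b where "X = {x. \<forall>i. a i < x $ i}" "Y = {x. \<forall>i. b i < x $ i}" by auto
    then have "X \<inter> Y = {x. \<forall>i. max (a i) (b i) < x $ i}" by auto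
    then show "X \<inter> Y \<in> ?G" by (intro image_eqI[where x = "\<lambda>i. max (a i) (b i)"]) simp_all
  qed
  moreover have "?G \<subseteq> Pow UNIV" by simp
  moreover have "A \<in> sigma_sets UNIV ?G" using A by (simp add: borel_sig)
  ultimately have "?P A"
  proof (induction rule: sigma_sets_induct_disjoint)
    case (basic A)
    then obtain a where Aa: "A = {x. \<forall>i. a i < x $ i}" by auto
    have Ab: "A \<in> sets borel" using basic borel_sig by blast
    have "\<exists>P. \<forall>n t. (\<exists>g. test_function l (\<lambda>x::real^'n. P n (x $ i)) g) \<and> 0 \<le> P n t \<and> P n t \<le> 1 \<and>
        (0 \<le> t \<longrightarrow> t < l \<longrightarrow> (\<lambda>n. P n t) \<longlonglongrightarrow> (if a i < t then 1 else 0))" for i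
    proof -
      obtain P P' where P: "\<And>n t. P n (t + l) = P n t"
        "\<And>n t. (P n has_real_derivative P' n t) (at t)" "\<And>n. continuous_on UNIV (P' n)"
        "\<And>n t. 0 \<le> P n t" "\<And>n t. P n t \<le> 1"
        "\<And>t. 0 \<le> t \<Longrightarrow> t < l \<Longrightarrow> (\<lambda>n. P n t) \<longlonglongrightarrow> (if a i < t then 1 else 0)"
        using periodic_halfline_approx[OF l, where a = "a i"] by blast
      have "test_function l (\<lambda>x::real^'n. P n (x $ i)) (\<lambda>x. P' n (x $ i) *\<^sub>R axis i 1)" for n
        by (rule test_function_coordinate) (use P in auto)
      with P show ?thesis by blast
    qed
    then obtain P where P: "\<And>i n. \<exists>g. test_function l (\<lambda>x::real^'n. P i n (x $ i)) g"
      "\<And>i n t. 0 \<le> P i n t" "\<And>i n t. P i n t \<le> 1"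
      "\<And>i t. 0 \<le> t \<Longrightarrow> t < l \<Longrightarrow> (\<lambda>n. P i n t) \<longlonglongrightarrow> (if a i < t then 1 else (0::real))"
      by metis
    define \<psi> where "\<psi> n x = (\<Prod>i\<in>UNIV. P i n (x $ i))" for n and x :: "real^'n"
    have "\<exists>g. test_function l (\<psi> n) g" for n
      unfolding \<psi>_def using P(1) by (intro test_function_prod) auto
    then obtain g where g: "\<And>n. test_function l (\<psi> n) (g n)" by metis
    have \<psi>01: "0 \<le> \<psi> n x" "\<psi> n x \<le> 1" for n x
      unfolding \<psi>_def using P(2,3) by (auto intro!: prod_nonneg prod_le_1)
    have "(\<lambda>n. \<integral>x. \<bar>\<psi> n x - indicator A x\<bar> \<partial>\<Lambda>) \<longlonglongrightarrow> (\<integral>x. 0 \<partial>\<Lambda>)"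
    proof (rule integral_dominated_convergence[where w = "\<lambda>_. 1"])
      show "(\<lambda>x. \<bar>\<psi> n x - indicator A x\<bar>) \<in> borel_measurable \<Lambda>" for n
        using intg[OF g _ Ab] \<psi>01 by (simp add: borel_measurable_integrable)
      show "AE x in \<Lambda>. (\<lambda>n. \<bar>\<psi> n x - indicator A x\<bar>) \<longlonglongrightarrow> 0"
      proof (rule AE_I2)
        fix x assume "x \<in> space \<Lambda>"
        then have "0 \<le> x $ i" "x $ i < l" for i using sp by (auto simp: torus_def)
        then have "(\<lambda>n. \<psi> n x) \<longlonglongrightarrow> (\<Prod>i\<in>UNIV. if a i < x $ i then 1 else 0)"
          unfolding \<psi>_def by (intro tendsto_prod P(4))
        also have "(\<Prod>i\<in>UNIV. if a i < x $ i then 1 else 0) = (indicator A x :: real)"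
          by (auto simp: Aa indicator_def)
        finally show "(\<lambda>n. \<bar>\<psi> n x - indicator A x\<bar>) \<longlonglongrightarrow> 0"
          using LIM_zero tendsto_rabs_zero by blast
      qed
      show "AE x in \<Lambda>. norm \<bar>\<psi> n x - indicator A x\<bar> \<le> 1" for n
        using \<psi>01 by (auto intro!: bd)
    qed auto
    then have lim: "(\<lambda>n. \<integral>x. \<bar>\<psi> n x - indicator A x\<bar> \<partial>\<Lambda>) \<longlonglongrightarrow> 0" by simp
    show ?case
    proof (intro allI impI)
      fix e :: real assume "e > 0"
      with lim have "\<forall>\<^sub>F n in sequentially. (\<integral>x. \<bar>\<psi> n x - indicator A x\<bar> \<partial>\<Lambda>) < e"
        by (rule order_tendstoD)
      then obtain n where "(\<integral>x. \<bar>\<psi> n x - indicator A x\<bar> \<partial>\<Lambda>) < e" by (auto simp: eventually_sequentially)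
      then show "\<exists>\<psi> g. test_function l \<psi> g \<and> (\<forall>x. 0 \<le> \<psi> x \<and> \<psi> x \<le> 1) \<and> (\<integral>x. \<bar>\<psi> x - indicator A x\<bar> \<partial>\<Lambda>) < e"
        using g \<psi>01 by blast
    qed
  next
    case empty
    show ?case
      using test_function_const[of l 0] by (intro allI impI exI[of _ "\<lambda>_. 0"] exI[of _ "\<lambda>_. 0"]) auto
  next
    case (compl A)
    show ?case
    proof (intro allI impI)
      fix e :: real assume "e > 0"
      with compl obtain \<psi> g where \<psi>: "test_function l \<psi> g" "\<forall>x. 0 \<le> \<psi> x \<and> \<psi> x \<le> 1"
        "(\<integral>x. \<bar>\<psi> x - indicator A x\<bar> \<partial>\<Lambda>) < e" by blast
      have "\<bar>(1 - \<psi> x) - indicator (UNIV - A) x\<bar> = \<bar>\<psi> x - indicator A x\<bar>" for x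
        by (auto simp: indicator_def)
      with \<psi> test_function_diff[OF test_function_const[of l 1] \<psi>(1)]
      show "\<exists>\<psi> g. test_function l \<psi> g \<and> (\<forall>x. 0 \<le> \<psi> x \<and> \<psi> x \<le> 1) \<and> (\<integral>x. \<bar>\<psi> x - indicator (UNIV - A) x\<bar> \<partial>\<Lambda>) < e"
        by (intro exI[of _ "\<lambda>x. 1 - \<psi> x"] exI[of _ "\<lambda>x. 0 - g x"]) auto
    qed
  next
    case (union A)
    have Ab: "A k \<in> sets borel" for k using union(2) borel_sig by auto
    show ?case
    proof (intro allI impI)
      fix e :: real assume e: "e > 0"
      let ?U = "\<lambda>N. \<Union>k<N. A k"
      have "(\<lambda>N. \<integral>x. \<bar>indicator (?U N) x - indicator (\<Union>k. A k) x\<bar> \<partial>\<Lambda>) \<longlonglongrightarrow> (\<integral>x. (0::real) \<partial>\<Lambda>)"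
      proof (rule integral_dominated_convergence[where w = "\<lambda>_. 1"])
        show "(\<lambda>x. \<bar>indicator (?U N) x - indicator (\<Union>k. A k) x :: real\<bar>) \<in> borel_measurable \<Lambda>" for N
          using Ab by (intro borel_measurable_abs borel_measurable_diff indm sets.finite_UN sets.countable_UN) auto
        show "AE x in \<Lambda>. (\<lambda>N. \<bar>indicator (?U N) x - indicator (\<Union>k. A k) x :: real\<bar>) \<longlonglongrightarrow> 0"
        proof (rule AE_I2)
          fix x
          show "(\<lambda>N. \<bar>indicator (?U N) x - indicator (\<Union>k. A k) x :: real\<bar>) \<longlonglongrightarrow> 0"
          proof (cases "x \<in> (\<Union>k. A k)")
            case True
            then obtain k where "x \<in> A k" by auto
            then have "\<forall>\<^sub>F N in sequentially. \<bar>indicator (?U N) x - indicator (\<Union>k. A k) x :: real\<bar> = 0"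
              by (intro eventually_sequentiallyI[of "Suc k"]) (auto simp: indicator_def)
            then show ?thesis by (rule tendsto_eventually)
          qed (auto simp: indicator_def)
        qed
      qed (auto simp: indicator_def)
      then have "(\<lambda>N. \<integral>x. \<bar>indicator (?U N) x - indicator (\<Union>k. A k) x\<bar> \<partial>\<Lambda>) \<longlonglongrightarrow> (0::real)" by simp
      then have "\<forall>\<^sub>F N in sequentially. (\<integral>x. \<bar>indicator (?U N) x - indicator (\<Union>k. A k) x\<bar> \<partial>\<Lambda>) < e / 2"
        using e by (intro order_tendstoD) auto
      then obtain N where N: "(\<integral>x. \<bar>indicator (?U N) x - indicator (\<Union>k. A k) x\<bar> \<partial>\<Lambda>) < e / 2"
        by (auto simp: eventually_sequentially)
      \<comment> \<open>Half of \<open>e\<close> pays for cutting the union off after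
        \<open>N\<close> sets, the other half for the \<open>N\<close> approximations; the
        \<open>+ 1\<close> covers \<open>N = 0\<close>.\<close>
      define d where "d = e / (2 * (real N + 1))"
      have d: "d > 0" "real N * d \<le> e / 2" using e by (auto simp: d_def field_simps)
      have "\<exists>\<psi> g. test_function l \<psi> g \<and> (\<forall>x. 0 \<le> \<psi> x \<and> \<psi> x \<le> 1) \<and> (\<integral>x. \<bar>\<psi> x - indicator (A k) x\<bar> \<partial>\<Lambda>) < d" for k
        using union(3)[of k] d by blast
      then obtain \<psi> g where \<psi>: "\<And>k. test_function l (\<psi> k) (g k)" "\<And>k x. 0 \<le> \<psi> k x \<and> \<psi> k x \<le> 1"
        "\<And>k. (\<integral>x. \<bar>\<psi> k x - indicator (A k) x\<bar> \<partial>\<Lambda>) < d" by metis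
      \<comment> \<open>The complement of a product of complements stays in [0,1], which the sum of
        the \<open>\<psi> k\<close> need not do.\<close>
      define \<Psi> where "\<Psi> x = 1 - (\<Prod>k<N. 1 - \<psi> k x)" for x
      have "\<exists>h. test_function l (\<lambda>x. \<Prod>k<N. 1 - \<psi> k x) h"
        using test_function_diff[OF test_function_const[of l 1] \<psi>(1)] by (intro test_function_prod) auto
      then obtain h where h: "test_function l \<Psi> h"
        unfolding \<Psi>_def using test_function_diff[OF test_function_const[of l 1]] by blast
      have "0 \<le> (\<Prod>k<N. 1 - \<psi> k x) \<and> (\<Prod>k<N. 1 - \<psi> k x) \<le> 1" for x
        using \<psi>(2) by (auto intro!: prod_nonneg prod_le_1)
      then have \<Psi>01: "\<forall>x. 0 \<le> \<Psi> x \<and> \<Psi> x \<le> 1" by (auto simp: \<Psi>_def)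
      have Ub: "?U N \<in> sets borel" "(\<Union>k. A k) \<in> sets borel" using Ab by auto
      have pt: "\<bar>\<Psi> x - indicator (\<Union>k. A k) x\<bar> \<le> (\<Sum>k<N. \<bar>\<psi> k x - indicator (A k) x\<bar>)
          + \<bar>indicator (?U N) x - indicator (\<Union>k. A k) x\<bar>" for x
      proof -
        have "indicator (?U N) x = 1 - (\<Prod>k<N. 1 - indicator (A k) x :: real)"
          by (auto simp: indicator_def)
        then have "\<bar>\<Psi> x - indicator (?U N) x\<bar> = \<bar>(\<Prod>k<N. 1 - \<psi> k x) - (\<Prod>k<N. 1 - indicator (A k) x)\<bar>"
          unfolding \<Psi>_def by linarith
        also have "\<dots> \<le> (\<Sum>k<N. \<bar>(1 - \<psi> k x) - (1 - indicator (A k) x)\<bar>)"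
          using \<psi>(2) by (intro abs_prod_diff_le) (auto simp: indicator_def)
        also have "\<dots> = (\<Sum>k<N. \<bar>\<psi> k x - indicator (A k) x\<bar>)"
          by (intro sum.cong refl) (simp add: abs_minus_commute)
        finally show ?thesis by linarith
      qed
      have i1: "integrable \<Lambda> (\<lambda>x. \<bar>indicator (?U N) x - indicator (\<Union>k. A k) x :: real\<bar>)"
        using indm[OF Ub(1)] indm[OF Ub(2)]
        by (intro integrable_const_bound[of _ 1] borel_measurable_abs borel_measurable_diff AE_I2) (simp_all, simp add: indicator_def)
      have i2: "integrable \<Lambda> (\<lambda>x. \<Sum>k<N. \<bar>\<psi> k x - indicator (A k) x\<bar>)"
        using intg[OF \<psi>(1) _ Ab] \<psi>(2) by auto
      have "(\<integral>x. \<bar>\<Psi> x - indicator (\<Union>k. A k) x\<bar> \<partial>\<Lambda>) \<le> (\<integral>x. (\<Sum>k<N. \<bar>\<psi> k x - indicator (A k) x\<bar>)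
          + \<bar>indicator (?U N) x - indicator (\<Union>k. A k) x\<bar> \<partial>\<Lambda>)"
        using intg[OF h \<Psi>01 Ub(2)] i1 i2 pt by (intro integral_mono) auto
      also have "\<dots> = (\<Sum>k<N. \<integral>x. \<bar>\<psi> k x - indicator (A k) x\<bar> \<partial>\<Lambda>)
          + (\<integral>x. \<bar>indicator (?U N) x - indicator (\<Union>k. A k) x\<bar> \<partial>\<Lambda>)"
        using i1 i2 intg[OF \<psi>(1) _ Ab] \<psi>(2) by (subst Bochner_Integration.integral_add) auto
      also have "(\<Sum>k<N. \<integral>x. \<bar>\<psi> k x - indicator (A k) x\<bar> \<partial>\<Lambda>) \<le> (\<Sum>k<N. d)"
        using \<psi>(3) by (intro sum_mono) (auto intro: less_imp_le)
      finally have "(\<integral>x. \<bar>\<Psi> x - indicator (\<Union>k. A k) x\<bar> \<partial>\<Lambda>) < e"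
        using N d by simp
      with h \<Psi>01 show "\<exists>\<psi> g. test_function l \<psi> g \<and> (\<forall>x. 0 \<le> \<psi> x \<and> \<psi> x \<le> 1) \<and> (\<integral>x. \<bar>\<psi> x - indicator (\<Union>k. A k) x\<bar> \<partial>\<Lambda>) < e"
        by blast
    qed
  qed
  with e show ?thesis by blast
qed

text \<open>The optimal \<open>\<psi>\<close> would be the sign of \<open>w\<close>. It is replaced
  by the difference of two test functions close to the indicators of the sets where \<open>w\<close>
  is positive and negative. The hypothesis \<open>app\<close> admits completed measures, whose
  measurable sets are Borel only up to null sets.\<close>

lemma test_function_dual:
  fixes \<Lambda> :: "(real^'n) measure" and w :: "real^'n \<Rightarrow> real"
  assumes l: "l > 0" and fin: "finite_measure \<Lambda>" and sp: "space \<Lambda> = torus l"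
    and mb: "(\<lambda>x. x) \<in> measurable \<Lambda> borel"
    and app: "\<And>A. A \<in> sets \<Lambda> \<Longrightarrow> \<exists>B\<in>sets borel. AE x in \<Lambda>. x \<in> A \<longleftrightarrow> x \<in> B"
    and w: "w \<in> borel_measurable \<Lambda>" and B: "\<And>x. x \<in> torus l \<Longrightarrow> \<bar>w x\<bar> \<le> B" and e: "e > 0"
  shows "\<exists>\<psi> g. test_function l \<psi> g \<and> (\<forall>x. \<bar>\<psi> x\<bar> \<le> 1) \<and> (\<integral>x. \<bar>w x\<bar> \<partial>\<Lambda>) \<le> (\<integral>x. \<psi> x * w x \<partial>\<Lambda>) + e"
proof -
  interpret finite_measure \<Lambda> by fact
  have bm: "f \<in> borel_measurable \<Lambda>" if "f \<in> borel_measurable borel" for f :: "real^'n \<Rightarrow> real"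
    using measurable_compose[OF mb that] by simp
  have B0: "B \<ge> 0" using B[of 0] l by (force simp: torus_def)
  \<comment> \<open>Each approximation errs by less than \<open>d\<close> in L1 and \<open>w\<close>
    is bounded by \<open>B\<close>, so at most \<open>2 * B * d\<close> is lost; the
    \<open>+ 1\<close> keeps the quotient meaningful for \<open>B = 0\<close>.\<close>
  define d where "d = e / (2 * (B + 1))"
  have d: "d > 0" "2 * B * d \<le> e" using e B0 by (auto simp: d_def field_simps add_pos_nonneg)
  obtain P where P: "P \<in> sets borel" "AE x in \<Lambda>. x \<in> {x \<in> space \<Lambda>. 0 < w x} \<longleftrightarrow> x \<in> P"
    using app[of "{x \<in> space \<Lambda>. 0 < w x}"] w by auto
  obtain N where N: "N \<in> sets borel" "AE x in \<Lambda>. x \<in> {x \<in> space \<Lambda>. w x < 0} \<longleftrightarrow> x \<in> N"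
    using app[of "{x \<in> space \<Lambda>. w x < 0}"] w by auto
  obtain p gp where p: "test_function l p gp" "\<forall>x. 0 \<le> p x \<and> p x \<le> 1" "(\<integral>x. \<bar>p x - indicator P x\<bar> \<partial>\<Lambda>) < d"
    using test_function_dense_set[OF l fin sp mb P(1) d(1)] by blast
  obtain q gq where q: "test_function l q gq" "\<forall>x. 0 \<le> q x \<and> q x \<le> 1" "(\<integral>x. \<bar>q x - indicator N x\<bar> \<partial>\<Lambda>) < d"
    using test_function_dense_set[OF l fin sp mb N(1) d(1)] by blast
  have [measurable]: "p \<in> borel_measurable \<Lambda>" "q \<in> borel_measurable \<Lambda>" "w \<in> borel_measurable \<Lambda>"
      "(indicator P :: _ \<Rightarrow> real) \<in> borel_measurable \<Lambda>" "(indicator N :: _ \<Rightarrow> real) \<in> borel_measurable \<Lambda>"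
    using bm[OF test_function_borel[OF p(1)]] bm[OF test_function_borel[OF q(1)]] w P(1) N(1) by (auto intro!: bm)
  have pq1: "\<bar>p x - q x\<bar> \<le> 1" for x using p(2) q(2) by (smt (verit))
  have ipw: "integrable \<Lambda> (\<lambda>x. (p x - q x) * w x)"
  proof (rule integrable_const_bound[of _ B])
    have "\<bar>(p x - q x) * w x\<bar> \<le> 1 * B" if "x \<in> torus l" for x
      unfolding abs_mult using pq1[of x] B[OF that] by (intro mult_mono) auto
    then show "AE x in \<Lambda>. norm ((p x - q x) * w x) \<le> B" by (intro AE_I2) (simp add: sp)
  qed measurable
  have iw: "integrable \<Lambda> (\<lambda>x. \<bar>w x\<bar>)"
    using B by (intro integrable_const_bound[of _ B] AE_I2) (auto simp: sp)
  have ip: "integrable \<Lambda> (\<lambda>x. \<bar>p x - indicator P x\<bar>)"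
    using p(2) by (intro integrable_const_bound[of _ 1] AE_I2) (auto intro!: abs_diff_indicator_le)
  have iq: "integrable \<Lambda> (\<lambda>x. \<bar>q x - indicator N x\<bar>)"
    using q(2) by (intro integrable_const_bound[of _ 1] AE_I2) (auto intro!: abs_diff_indicator_le)
  have "(\<integral>x. \<bar>w x\<bar> \<partial>\<Lambda>) - (\<integral>x. (p x - q x) * w x \<partial>\<Lambda>) = (\<integral>x. \<bar>w x\<bar> - (p x - q x) * w x \<partial>\<Lambda>)"
    using iw ipw by simp
  also have "\<dots> \<le> (\<integral>x. B * (\<bar>p x - indicator P x\<bar> + \<bar>q x - indicator N x\<bar>) \<partial>\<Lambda>)"
  proof (rule integral_mono_AE)
    show "AE x in \<Lambda>. \<bar>w x\<bar> - (p x - q x) * w x \<le> B * (\<bar>p x - indicator P x\<bar> + \<bar>q x - indicator N x\<bar>)"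
      using P(2) N(2) AE_space
    proof eventually_elim
      case (elim x)
      have "\<bar>w x\<bar> = (indicator P x - indicator N x) * w x"
        using elim by (auto simp: indicator_def)
      then have "\<bar>w x\<bar> - (p x - q x) * w x = ((indicator P x - p x) + (q x - indicator N x)) * w x"
        by (simp add: algebra_simps)
      also have "\<dots> \<le> \<bar>(indicator P x - p x) + (q x - indicator N x)\<bar> * \<bar>w x\<bar>"
        unfolding abs_mult[symmetric] by simp
      also have "\<dots> \<le> (\<bar>p x - indicator P x\<bar> + \<bar>q x - indicator N x\<bar>) * B"
        using B[of x] elim sp by (intro mult_mono) auto
      finally show ?case by (simp add: mult.commute)
    qed
  qed (use iw ipw ip iq in auto)
  also have "\<dots> = B * ((\<integral>x. \<bar>p x - indicator P x\<bar> \<partial>\<Lambda>) + (\<integral>x. \<bar>q x - indicator N x\<bar> \<partial>\<Lambda>))"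
    using ip iq by simp
  also have "\<dots> \<le> B * (d + d)" using p(3) q(3) B0 by (intro mult_left_mono) auto
  also have "\<dots> \<le> e" using d by (simp add: algebra_simps)
  finally have "(\<integral>x. \<bar>w x\<bar> \<partial>\<Lambda>) \<le> (\<integral>x. (p x - q x) * w x \<partial>\<Lambda>) + e" by simp
  with test_function_diff[OF p(1) q(1)] pq1 show ?thesis by blast
qed

subsection \<open>Weak compactness of measures on the torus\<close>

text \<open>A continuous function of period 2 that is 0 within 1/3 of even integers and 1 within 1/3
  of odd ones, because the cosine of pi/3 is 1/2. It stands in for the piecewise linear function of
  Schoenberg's construction, of which only the plateaus matter.\<close>

definition ternary_wave :: "real \<Rightarrow> real" where
  "ternary_wave t = max 0 (min 1 (1 / 2 - cos (pi * t)))"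

lemma ternary_wave_bounds: "0 \<le> ternary_wave t" "ternary_wave t \<le> 1"
  by (auto simp: ternary_wave_def)

lemma continuous_ternary_wave: "continuous_on UNIV ternary_wave"
  unfolding ternary_wave_def by (intro continuous_intros)

lemma ternary_wave_periodic: "ternary_wave (t + 2 * of_int m) = ternary_wave t"
proof -
  have "pi * (t + 2 * of_int m) = pi * t + 2 * pi * of_int m" by (simp add: algebra_simps)
  then have "cos (pi * (t + 2 * of_int m)) = cos (pi * t)"
    by (simp only: cos_add cos_int_2pin sin_int_2pin mult_1_right mult_zero_right diff_zero)
  then show ?thesis
    by (simp only: ternary_wave_def)
qed

lemma ternary_wave_digit:
  assumes "0 \<le> r" "r \<le> 1" "a \<in> {0, 1}" "\<bar>r - a\<bar> \<le> 1 / 3"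
  shows "ternary_wave r = a"
proof (cases "a = 0")
  case True
  then have "cos (pi / 3) \<le> cos (pi * r)" using assms by (intro cos_monotone_0_pi_le) auto
  then show ?thesis using True by (simp add: ternary_wave_def cos_60)
next
  case False
  then have "a = 1" using assms by auto
  then have "cos (pi * r) \<le> cos (2 * pi / 3)" using assms by (intro cos_monotone_0_pi_le) auto
  then show ?thesis using \<open>a = 1\<close> by (simp add: ternary_wave_def cos_120)
qed

text \<open>For a 0-1 sequence, the point of the Cantor set with ternary digits
  \<open>2 * a k\<close>. The absent digit 1 leaves the gaps that let a continuous function read the
  digits off.\<close>

definition ternary_code :: "(nat \<Rightarrow> real) \<Rightarrow> real" where
  "ternary_code a = (\<Sum>k. 2 * a k / 3 ^ Suc k)"

lemma sums_two_thirds: "(\<lambda>k. 2 / 3 ^ Suc k :: real) sums 1"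
proof -
  have "(\<lambda>k. (2 / 3) * (1 / 3) ^ k :: real) sums ((2 / 3) * (1 / (1 - 1 / 3)))"
    by (intro sums_mult geometric_sums) auto
  then show ?thesis by (simp add: power_divide field_simps)
qed

lemma ternary_code_summable:
  fixes a :: "nat \<Rightarrow> real"
  assumes "\<And>k. a k \<in> {0, 1}"
  shows "summable (\<lambda>k. 2 * a k / 3 ^ Suc k)"
proof (rule summable_comparison_test[OF _ sums_summable[OF sums_two_thirds]])
  have "norm (2 * a n / 3 ^ Suc n) \<le> 2 / 3 ^ Suc n" for n
    using assms[of n] by auto
  then show "\<exists>N. \<forall>n\<ge>N. norm (2 * a n / 3 ^ Suc n) \<le> 2 / 3 ^ Suc n" by blast
qed

lemma ternary_code_bounds:
  assumes a: "\<And>k. a k \<in> {0, 1}"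
  shows "0 \<le> ternary_code a" "ternary_code a \<le> 1"
proof -
  have b: "0 \<le> 2 * a k / 3 ^ Suc k" "2 * a k / 3 ^ Suc k \<le> 2 / 3 ^ Suc k" for k
    using a[of k] by auto
  show "0 \<le> ternary_code a" unfolding ternary_code_def using ternary_code_summable[of a, OF a] b(1) by (rule suminf_nonneg)
  have "ternary_code a \<le> (\<Sum>k. 2 / 3 ^ Suc k)"
    unfolding ternary_code_def using b(2) ternary_code_summable[of a, OF a] sums_summable[OF sums_two_thirds]
    by (intro suminf_le) auto
  then show "ternary_code a \<le> 1" using sums_unique[OF sums_two_thirds] by simp
qed

lemma ternary_code_shift:
  assumes a: "\<And>k. a k \<in> {0, 1}"
  shows "3 * ternary_code a = 2 * a 0 + ternary_code (\<lambda>k. a (Suc k))"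
proof -
  have "ternary_code a = (\<Sum>k. 2 * a (Suc k) / 3 ^ Suc (Suc k)) + 2 * a 0 / 3"
    unfolding ternary_code_def using suminf_split_head[OF ternary_code_summable[of a, OF a]] by simp
  also have "(\<Sum>k. 2 * a (Suc k) / 3 ^ Suc (Suc k)) = (\<Sum>k. (1 / 3) * (2 * a (Suc k) / 3 ^ Suc k))"
    by simp
  also have "\<dots> = (1 / 3) * ternary_code (\<lambda>k. a (Suc k))"
    unfolding ternary_code_def using a by (intro suminf_mult ternary_code_summable) auto
  finally show ?thesis by simp
qed

text \<open>Multiplication by 3 shifts the digits and adds the even integer \<open>2 * a 0\<close>,
  which the period absorbs. For the leading digit, \<open>ternary_code a - a 0\<close> is one third
  of a number in [-1,1].\<close>

lemma ternary_wave_code: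
  assumes a: "\<And>k. a k \<in> {0, 1}"
  shows "ternary_wave (3 ^ j * ternary_code a) = a j"
  using a
proof (induction j arbitrary: a)
  case 0
  have "\<bar>ternary_code a - a 0\<bar> \<le> 1 / 3"
  proof -
    have "0 \<le> a 0" "a 0 \<le> 1" using 0[of 0] by auto
    moreover have "0 \<le> ternary_code (\<lambda>k. a (Suc k))" "ternary_code (\<lambda>k. a (Suc k)) \<le> 1"
      using ternary_code_bounds[of "\<lambda>k. a (Suc k)"] 0 by blast+
    ultimately show ?thesis using ternary_code_shift[of a, OF 0] unfolding abs_le_iff by linarith
  qed
  then show ?case using ternary_code_bounds[of a, OF 0] 0[of 0] by (simp add: ternary_wave_digit)
next
  case (Suc j)
  have "\<exists>m::int. a 0 = of_int m" using Suc.prems[of 0] by (auto intro: exI[of _ 0] exI[of _ 1])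
  then obtain m :: int where m: "a 0 = of_int m" by blast
  have IH: "ternary_wave (3 ^ j * ternary_code (\<lambda>k. a (Suc k))) = a (Suc j)"
    using Suc.IH[of "\<lambda>k. a (Suc k)"] Suc.prems by blast
  have "3 ^ Suc j * ternary_code a = 3 ^ j * (3 * ternary_code a)" by simp
  also have "\<dots> = 3 ^ j * ternary_code (\<lambda>k. a (Suc k)) + 2 * of_int (3 ^ j * m)"
    unfolding ternary_code_shift[of a, OF Suc.prems] by (simp add: m algebra_simps)
  finally show ?case
    by (simp only: ternary_wave_periodic IH)
qed

text \<open>Written with floors so that the binary series telescopes and Borel measurability in
  \<open>y\<close> is immediate.\<close>

definition binary_digit :: "nat \<Rightarrow> real \<Rightarrow> real" where
  "binary_digit k y = of_int \<lfloor>2 ^ Suc k * y\<rfloor> - 2 * of_int \<lfloor>2 ^ k * y\<rfloor>"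

lemma binary_digit_01: "binary_digit k y \<in> {0, 1}"
proof -
  define z where "z = 2 ^ k * y"
  have "\<lfloor>2 * z\<rfloor> - 2 * \<lfloor>z\<rfloor> = 0 \<or> \<lfloor>2 * z\<rfloor> - 2 * \<lfloor>z\<rfloor> = 1" by linarith
  moreover have "binary_digit k y = of_int (\<lfloor>2 * z\<rfloor> - 2 * \<lfloor>z\<rfloor>)"
    by (simp add: binary_digit_def z_def mult.assoc)
  ultimately show ?thesis by auto
qed

lemma binary_digit_sums:
  assumes "0 \<le> y" "y < 1"
  shows "(\<lambda>k. binary_digit k y / 2 ^ Suc k) sums y"
proof -
  let ?f = "\<lambda>k. of_int \<lfloor>2 ^ k * y\<rfloor> / 2 ^ k :: real"
  have lim: "?f \<longlonglongrightarrow> y"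
  proof (rule tendsto_sandwich[of "\<lambda>k. y - (1 / 2) ^ k" _ _ "\<lambda>_. y"])
    have "y - (1 / 2) ^ k \<le> ?f k \<and> ?f k \<le> y" for k
    proof -
      have "2 ^ k * y - 1 \<le> of_int \<lfloor>2 ^ k * y\<rfloor>" "of_int \<lfloor>2 ^ k * y\<rfloor> \<le> 2 ^ k * y" by linarith+
      then have "(2 ^ k * y - 1) / 2 ^ k \<le> ?f k" "?f k \<le> (2 ^ k * y) / 2 ^ k"
        by (intro divide_right_mono; simp)+
      then show ?thesis by (simp add: diff_divide_distrib power_divide)
    qed
    then show "\<forall>\<^sub>F k in sequentially. y - (1 / 2) ^ k \<le> ?f k" "\<forall>\<^sub>F k in sequentially. ?f k \<le> y" by auto
    have "(\<lambda>k. y - (1 / 2) ^ k) \<longlonglongrightarrow> y - 0" by (intro tendsto_intros LIMSEQ_realpow_zero) auto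
    then show "(\<lambda>k. y - (1 / 2) ^ k) \<longlonglongrightarrow> y" by simp
  qed simp
  have "(\<lambda>k. ?f (Suc k) - ?f k) sums (y - ?f 0)" by (rule telescope_sums[OF lim])
  \<comment> \<open>Here the half-open cell counts: for \<open>y = 1\<close> the telescoping would
    start at 1.\<close>
  moreover have "?f 0 = 0" using assms by (simp add: floor_eq_iff)
  moreover have "?f (Suc k) - ?f k = binary_digit k y / 2 ^ Suc k" for k
    by (simp add: binary_digit_def diff_divide_distrib)
  ultimately show ?thesis by simp
qed

text \<open>
  Schoenberg's space-filling curve: the digit sequence read off the ternary expansion of \<open>t\<close> is
  distributed over the binary expansions of the coordinates.
\<close>

definition schoenberg_curve :: "real \<Rightarrow> real \<Rightarrow> real^'n" where
  "schoenberg_curve l t = (\<chi> i. l * (\<Sum>k. ternary_wave (3 ^ to_nat (k, i) * t) / 2 ^ Suc k))"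

text \<open>A right inverse of the curve on the torus: the binary digits of all coordinates are
  merged into one sequence by the enumeration of pairs (position, coordinate). Borel measurability
  of this map is enough for pushing measures forward; passing to the limit relies on the continuity
  of the curve alone.\<close>

definition schoenberg_section :: "real \<Rightarrow> real^'n \<Rightarrow> real" where
  "schoenberg_section l x = ternary_code (\<lambda>j. case from_nat j of (k, i) \<Rightarrow> binary_digit k (x $ i / l))"

lemma continuous_schoenberg_curve: "continuous_on UNIV (schoenberg_curve l :: real \<Rightarrow> real^'n)"
proof -
  have "continuous_on UNIV (\<lambda>t. \<Sum>k. ternary_wave (3 ^ to_nat (k, i) * t) / 2 ^ Suc k)" for i :: 'n
  proof (rule uniform_limit_theorem[OF _ Weierstrass_m_test[where M = "\<lambda>k. (1 / 2) ^ Suc k"]])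
    show "\<forall>\<^sub>F n in sequentially. continuous_on UNIV (\<lambda>t. \<Sum>k<n. ternary_wave (3 ^ to_nat (k, i) * t) / 2 ^ Suc k)"
      by (intro always_eventually allI continuous_intros continuous_on_compose2[OF continuous_ternary_wave]) auto
    show "norm (ternary_wave (3 ^ to_nat (n, i) * t) / 2 ^ Suc n) \<le> (1 / 2) ^ Suc n" for n t
      using ternary_wave_bounds[of "3 ^ to_nat (n, i) * t"] by (simp add: power_divide divide_right_mono)
    show "summable (\<lambda>k. (1 / 2 :: real) ^ Suc k)"
      using summable_geometric[of "1 / 2 :: real"] by (simp add: summable_mult)
  qed simp
  then show ?thesis
    unfolding schoenberg_curve_def
    by (intro continuous_on_vec_lambda continuous_intros) auto
qed

lemma schoenberg_curve_section:
  assumes "l > 0" "x \<in> torus l"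
  shows "schoenberg_curve l (schoenberg_section l x) = x"
proof -
  let ?a = "\<lambda>j. case from_nat j of (k, i) \<Rightarrow> binary_digit k (x $ i / l)"
  have a: "?a j \<in> {0, 1}" for j using binary_digit_01 by (auto split: prod.split)
  have "l * (\<Sum>k. ternary_wave (3 ^ to_nat (k, i) * schoenberg_section l x) / 2 ^ Suc k) = x $ i" for i
  proof -
    have "ternary_wave (3 ^ to_nat (k, i) * schoenberg_section l x) = binary_digit k (x $ i / l)" for k
      unfolding schoenberg_section_def using ternary_wave_code[OF a, of "to_nat (k, i)"] by simp
    moreover have "(\<lambda>k. binary_digit k (x $ i / l) / 2 ^ Suc k) sums (x $ i / l)"
      using assms by (intro binary_digit_sums) (auto simp: torus_def)
    ultimately show ?thesis using assms(1) by (simp add: sums_iff)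
  qed
  then show ?thesis by (simp add: schoenberg_curve_def vec_eq_iff)
qed

lemma schoenberg_section_bounds: "0 \<le> schoenberg_section l x" "schoenberg_section l x \<le> 1"
  unfolding schoenberg_section_def using binary_digit_01
  by (intro ternary_code_bounds; auto split: prod.split)+

lemma schoenberg_section_borel: "schoenberg_section l \<in> borel_measurable (borel :: (real^'n) measure)"
proof -
  have "(\<lambda>x::real^'n. 2 * (case from_nat j of (k, i) \<Rightarrow> binary_digit k (x $ i / l)) / 3 ^ Suc j) \<in> borel_measurable borel" for j
    unfolding binary_digit_def by (cases "from_nat j :: nat \<times> 'n") simp
  then show ?thesis
    unfolding schoenberg_section_def ternary_code_def by (intro borel_measurable_suminf)
qed

lemma red_measurable:
  assumes "l > 0" shows "(red l :: real^'n \<Rightarrow> real^'n) \<in> measurable borel (restrict_space borel (torus l))"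
proof (rule measurable_restrict_space2)
  have "(\<lambda>x::real^'n. red l x $ i) \<in> borel_measurable borel" for i
    unfolding red_def by simp
  then show "(red l :: real^'n \<Rightarrow> real^'n) \<in> borel_measurable borel"
    by (subst borel_measurable_euclidean_space) (auto simp: Basis_vec_def inner_axis)
qed (auto simp: red_in_torus[OF assms])

lemma periodic_continuous_bounded:
  fixes \<phi> :: "real^'n \<Rightarrow> 'b::real_normed_vector"
  assumes l: "l > 0" and p: "periodic l \<phi>" and c: "continuous_on UNIV \<phi>"
  obtains B where "\<And>x. norm (\<phi> x) \<le> B"
proof -
  have "compact (\<phi> ` cbox 0 (\<chi> i. l))"
    using c by (intro compact_continuous_image compact_cbox) (rule continuous_on_subset, auto)
  then have "bounded (\<phi> ` cbox 0 (\<chi> i. l))" by (rule compact_imp_bounded)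
  then obtain B where "\<And>x. x \<in> cbox 0 (\<chi> i. l) \<Longrightarrow> norm (\<phi> x) \<le> B"
    by (auto simp: bounded_iff)
  then have "norm (\<phi> (red l x)) \<le> B" for x
    using red_in_torus[OF l, of x] torus_sub_cbox by blast
  then have "norm (\<phi> x) \<le> B" for x by (simp add: periodic_red[OF p])
  then show thesis by (rule that)
qed

text \<open>The section carries the measures to [0,1], where tightness is automatic, and the curve
  carries the limit back. A periodic continuous \<open>\<phi>\<close> composed with the curve is
  bounded and continuous on the line. The curve fills the closed cube, whence the correction by
  \<open>red\<close>, which periodic functions do not see.\<close>

theorem torus_measures_weakly_compact:
  fixes N :: "nat \<Rightarrow> (real^'n) measure"
  assumes l: "l > 0" and prob: "\<And>n. prob_space (N n)" and sp: "\<And>n. space (N n) = torus l"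
    and mb: "\<And>n. (\<lambda>x. x) \<in> measurable (N n) borel"
  shows "\<exists>r \<nu>. strict_mono r \<and> prob_space \<nu> \<and> sets \<nu> = sets (restrict_space borel (torus l)) \<and>
    (\<forall>\<phi> :: real^'n \<Rightarrow> real. periodic l \<phi> \<longrightarrow> continuous_on UNIV \<phi> \<longrightarrow>
      (\<lambda>n. \<integral>x. \<phi> x \<partial>N (r n)) \<longlonglongrightarrow> (\<integral>x. \<phi> x \<partial>\<nu>))"
proof -
  let ?s = "schoenberg_section l :: real^'n \<Rightarrow> real" and ?c = "schoenberg_curve l :: real \<Rightarrow> real^'n"
  define \<mu> where "\<mu> n = distr (N n) borel ?s" for n
  have sm: "?s \<in> borel_measurable (N n)" for n
    using measurable_compose[OF mb schoenberg_section_borel] by simp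
  have rd: "real_distribution (\<mu> n)" for n
    unfolding \<mu>_def using prob_space.real_distribution_distr[OF prob sm] .
  \<comment> \<open>Tightness is phrased with intervals open on the left; the end -1 makes sure that
    the value 0 is included.\<close>
  have one: "measure (\<mu> n) {-1<..1} = 1" for n
  proof -
    have "?s -` {-1<..1} \<inter> space (N n) = space (N n)"
      by (auto simp: schoenberg_section_bounds less_le_trans[OF _ schoenberg_section_bounds(1)])
    then show ?thesis
      unfolding \<mu>_def using prob_space.prob_space[OF prob] by (subst measure_distr[OF sm]) auto
  qed
  have "tight \<mu>"
    unfolding tight_def
  proof (intro conjI allI impI rd)
    fix \<epsilon> :: real assume "\<epsilon> > 0"
    then show "\<exists>a b. a < b \<and> (\<forall>n. measure (\<mu> n) {a<..b} > 1 - \<epsilon>)"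
      using one by (intro exI[of _ "-1"] exI[of _ 1]) simp
  qed
  then obtain r M where r: "strict_mono r" "real_distribution M" "weak_conv_m (\<mu> \<circ> id \<circ> r) M"
    using tight_imp_convergent_subsubsequence[of \<mu> id] by (auto simp: strict_mono_id)
  interpret M: real_distribution M by fact
  have cb: "?c \<in> borel_measurable borel"
    by (intro borel_measurable_continuous_onI continuous_schoenberg_curve)
  have rcm: "(\<lambda>t. red l (?c t)) \<in> measurable M (restrict_space borel (torus l))"
    using measurable_compose[OF cb red_measurable[OF l]] by simp
  define \<nu> where "\<nu> = distr M (restrict_space borel (torus l)) (\<lambda>t. red l (?c t))"
  have "(\<lambda>n. \<integral>x. \<phi> x \<partial>N (r n)) \<longlonglongrightarrow> (\<integral>x. \<phi> x \<partial>\<nu>)"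
    if p: "periodic l \<phi>" and c: "continuous_on UNIV \<phi>" for \<phi> :: "real^'n \<Rightarrow> real"
  proof -
    obtain B where B: "\<And>x. norm (\<phi> x) \<le> B" using periodic_continuous_bounded[OF l p c] by blast
    have \<phi>b: "\<phi> \<in> borel_measurable borel" using c by (rule borel_measurable_continuous_onI)
    have cont: "continuous_on UNIV (\<lambda>t. \<phi> (?c t))"
      by (rule continuous_on_compose2[OF c continuous_schoenberg_curve]) simp
    have "(\<lambda>n. \<integral>t. \<phi> (?c t) \<partial>(\<mu> \<circ> id \<circ> r) n) \<longlonglongrightarrow> (\<integral>t. \<phi> (?c t) \<partial>M)"
      using r rd B cont
      by (intro weak_conv_imp_integral_bdd_continuous_conv[where B = B])
        (simp_all add: continuous_on_eq_continuous_within o_def)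
    moreover have "(\<integral>t. \<phi> (?c t) \<partial>(\<mu> \<circ> id \<circ> r) n) = (\<integral>x. \<phi> x \<partial>N (r n))" for n
    proof -
      have "(\<integral>t. \<phi> (?c t) \<partial>(\<mu> \<circ> id \<circ> r) n) = (\<integral>x. \<phi> (?c (?s x)) \<partial>N (r n))"
        unfolding \<mu>_def using measurable_compose[OF cb \<phi>b] by (simp add: integral_distr[OF sm])
      also have "\<dots> = (\<integral>x. \<phi> x \<partial>N (r n))"
        by (intro Bochner_Integration.integral_cong) (auto simp: sp schoenberg_curve_section[OF l])
      finally show ?thesis .
    qed
    moreover have "(\<integral>t. \<phi> (?c t) \<partial>M) = (\<integral>x. \<phi> x \<partial>\<nu>)"
      unfolding \<nu>_def using measurable_restrict_space1[OF \<phi>b]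
      by (subst integral_distr[OF rcm]) (auto simp: periodic_red[OF p])
    ultimately show ?thesis by simp
  qed
  moreover have "prob_space \<nu>" unfolding \<nu>_def by (rule M.prob_space_distr[OF rcm])
  moreover have "sets \<nu> = sets (restrict_space borel (torus l))" by (simp add: \<nu>_def)
  ultimately show ?thesis using r(1) by blast
qed

subsection \<open>Polar decomposition\<close>

text \<open>The sum of the measures dominates each of them and serves as one reference measure for
  the densities of all components.\<close>

lemma finite_sum_measure:
  fixes M :: "'i \<Rightarrow> 'a measure"
  assumes I: "finite I" and sets: "\<And>i. i \<in> I \<Longrightarrow> sets (M i) = sets N"
    and fin: "\<And>i. i \<in> I \<Longrightarrow> finite_measure (M i)"
  obtains L where "finite_measure L" "sets L = sets N" "\<And>i. i \<in> I \<Longrightarrow> absolutely_continuous L (M i)"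
proof -
  define L where "L = measure_of (space N) (sets N) (\<lambda>A. \<Sum>i\<in>I. emeasure (M i) A)"
  have sL: "sets L = sets N" "space L = space N" by (simp_all add: L_def)
  have eL: "emeasure L A = (\<Sum>i\<in>I. emeasure (M i) A)" if A: "A \<in> sets N" for A
  proof (rule emeasure_measure_of[OF L_def])
    show "countably_additive (sets L) (\<lambda>A. \<Sum>i\<in>I. emeasure (M i) A)"
    proof (rule countably_additiveI)
      fix B :: "nat \<Rightarrow> 'a set" assume B: "range B \<subseteq> sets L" "disjoint_family B"
      have "(\<Sum>n. \<Sum>i\<in>I. emeasure (M i) (B n)) = (\<Sum>i\<in>I. \<Sum>n. emeasure (M i) (B n))"
        by (rule suminf_sum) auto
      also have "\<dots> = (\<Sum>i\<in>I. emeasure (M i) (\<Union>n. B n))"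
        using B sets sL by (intro sum.cong refl suminf_emeasure) auto
      finally show "(\<Sum>n. \<Sum>i\<in>I. emeasure (M i) (B n)) = (\<Sum>i\<in>I. emeasure (M i) (\<Union>n. B n))" .
    qed
  qed (use A sL sets.sets_into_space[of _ N] in \<open>auto simp: positive_def\<close>)
  show thesis
  proof
    show "finite_measure L"
    proof
      have "emeasure (M i) (space N) \<noteq> \<infinity>" if "i \<in> I" for i
        using finite_measure.emeasure_finite[OF fin[OF that]] by simp
      then show "emeasure L (space L) \<noteq> \<infinity>"
        using I by (simp add: eL sL)
    qed
    show "sets L = sets N" by fact
    show "absolutely_continuous L (M i)" if "i \<in> I" for i
      unfolding absolutely_continuous_def
    proof
      fix A assume "A \<in> null_sets L"
      then have A: "A \<in> sets N" "(\<Sum>i\<in>I. emeasure (M i) A) = 0" using sL eL[of A] by (auto simp: null_sets_def)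
      then have "emeasure (M i) A = 0" using I that by simp
      then show "A \<in> null_sets (M i)" using A sets[OF that] by auto
    qed
  qed
qed

lemma real_density_exists:
  assumes L: "finite_measure L" and N: "finite_measure N" and ac: "absolutely_continuous L N" "sets N = sets L"
  obtains D :: "'a \<Rightarrow> real" where "D \<in> borel_measurable L" "integrable L D"
    "\<And>\<phi> :: 'a \<Rightarrow> real. \<phi> \<in> borel_measurable L \<Longrightarrow> (\<integral>x. \<phi> x \<partial>N) = (\<integral>x. D x * \<phi> x \<partial>L)"
proof -
  interpret L: finite_measure L by fact
  interpret N: finite_measure N by fact
  obtain D where D: "D \<in> borel_measurable L" "AE x in L. RN_deriv L N x = ennreal (D x)" "\<And>x. 0 \<le> D x"
    using L.real_RN_deriv[OF N ac] by metis
  have N_eq: "N = density L (\<lambda>x. ennreal (D x))"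
    using L.density_RN_deriv[OF ac] D(1,2) density_cong[of "RN_deriv L N" L "\<lambda>x. ennreal (D x)"] by simp
  show thesis
  proof
    show "D \<in> borel_measurable L" by fact
    have "(\<integral>\<^sup>+x. ennreal (D x) \<partial>L) = emeasure N (space N)"
      unfolding N_eq using D(1) by (simp add: emeasure_density space_density nn_integral_set_ennreal cong: nn_integral_cong)
    then show "integrable L D"
      using D(1,3) N.emeasure_finite[of "space N"] by (intro integrableI_nonneg) (auto simp: less_top[symmetric])
    show "(\<integral>x. \<phi> x \<partial>N) = (\<integral>x. D x * \<phi> x \<partial>L)" if "\<phi> \<in> borel_measurable L" for \<phi> :: "'a \<Rightarrow> real"
      unfolding N_eq using that D by (subst integral_density) auto
  qed
qed

text \<open>The components \<open>C * (\<beta> i - \<alpha> i)\<close> have densities with respect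
  to a common \<open>L\<close>, which together form a vector density \<open>F\<close>. Then
  \<open>\<mu>\<close> is \<open>L\<close> weighted by the norm of \<open>F\<close>, and
  \<open>\<sigma>\<close> is \<open>F\<close> normalized.\<close>

lemma polar_decomposition:
  fixes \<alpha> \<beta> :: "'n::finite \<Rightarrow> (real^'n) measure"
  assumes fin: "\<And>i. finite_measure (\<alpha> i)" "\<And>i. finite_measure (\<beta> i)"
    and sets: "\<And>i. sets (\<alpha> i) = sets N" "\<And>i. sets (\<beta> i) = sets N"
  shows "\<exists>\<mu> \<sigma>. finite_measure \<mu> \<and> sets \<mu> = sets N \<and> \<sigma> \<in> borel_measurable \<mu> \<and> (\<forall>x. norm (\<sigma> x) = 1) \<and>
    (\<forall>(\<phi> :: real^'n \<Rightarrow> real) B. \<phi> \<in> borel_measurable N \<longrightarrow> (\<forall>x. \<bar>\<phi> x\<bar> \<le> B) \<longrightarrow>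
      (\<integral>x. \<phi> x *\<^sub>R \<sigma> x \<partial>\<mu>) = (\<chi> i. C * ((\<integral>x. \<phi> x \<partial>\<beta> i) - (\<integral>x. \<phi> x \<partial>\<alpha> i))))"
proof -
  define M where "M p = (if snd p then \<beta> (fst p) else \<alpha> (fst p))" for p :: "'n \<times> bool"
  have M: "sets (M p) = sets N" "finite_measure (M p)" for p using fin sets by (auto simp: M_def)
  obtain L where L: "finite_measure L" "sets L = sets N" "\<And>p. absolutely_continuous L (M p)"
    using finite_sum_measure[of UNIV M N] M by auto
  have "\<exists>D :: real^'n \<Rightarrow> real. D \<in> borel_measurable L \<and> integrable L D \<and>
      (\<forall>\<phi> :: real^'n \<Rightarrow> real. \<phi> \<in> borel_measurable L \<longrightarrow> (\<integral>x. \<phi> x \<partial>M p) = (\<integral>x. D x * \<phi> x \<partial>L))" for p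
    using real_density_exists[OF L(1) M(2) L(3), of p] M(1)[of p] L(2) by metis
  then obtain D where D: "\<And>p. D p \<in> borel_measurable L" "\<And>p. integrable L (D p)"
      "\<And>p (\<phi> :: real^'n \<Rightarrow> real). \<phi> \<in> borel_measurable L \<Longrightarrow> (\<integral>x. \<phi> x \<partial>M p) = (\<integral>x. D p x * \<phi> x \<partial>L)"
    by metis
  define F :: "real^'n \<Rightarrow> real^'n" where "F x = (\<chi> i. C * (D (i, True) x - D (i, False) x))" for x
  have Fi: "integrable L (\<lambda>x. F x $ i)" for i unfolding F_def using D(2) by simp
  have F: "integrable L F"
  proof -
    have "F = (\<lambda>x. \<Sum>i\<in>UNIV. (F x $ i) *\<^sub>R axis i 1)"
      by (auto simp: vec_eq_iff axis_def if_distrib sum.delta cong: if_cong)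
    moreover have "integrable L (\<lambda>x. \<Sum>i\<in>UNIV. (F x $ i) *\<^sub>R (axis i 1 :: real^'n))"
      using Fi by (intro Bochner_Integration.integrable_sum integrable_scaleR_left) auto
    ultimately show ?thesis by simp
  qed
  then have [measurable]: "F \<in> borel_measurable L" by auto
  \<comment> \<open>A fixed unit vector for the \<open>\<mu>\<close>-null set where \<open>F\<close>
    vanishes, so that \<open>\<sigma>\<close> has norm 1 everywhere.\<close>
  define e where "e = (axis undefined 1 :: real^'n)"
  define \<sigma> where "\<sigma> x = (if F x = 0 then e else F x /\<^sub>R norm (F x))" for x
  define \<mu> where "\<mu> = density L (\<lambda>x. ennreal (norm (F x)))"
  have m\<mu>: "borel_measurable \<mu> = borel_measurable L" by (rule measurable_cong_sets) (simp_all add: \<mu>_def)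
  have \<sigma>m: "\<sigma> \<in> borel_measurable L" unfolding \<sigma>_def by measurable
  show ?thesis
  proof (intro exI conjI allI impI)
    show "sets \<mu> = sets N" by (simp add: \<mu>_def L(2))
    show "\<sigma> \<in> borel_measurable \<mu>" using \<sigma>m by (simp add: m\<mu>)
    show "norm (\<sigma> x) = 1" for x by (simp add: \<sigma>_def e_def)
    show "finite_measure \<mu>"
    proof
      have "emeasure \<mu> (space \<mu>) = (\<integral>\<^sup>+x. ennreal (norm (F x)) \<partial>L)"
        unfolding \<mu>_def by (simp add: emeasure_density space_density nn_integral_set_ennreal cong: nn_integral_cong)
      also have "\<dots> < \<infinity>" using F by (simp add: integrable_iff_bounded)
      finally show "emeasure \<mu> (space \<mu>) \<noteq> \<infinity>" by simp
    qed
    fix \<phi> :: "real^'n \<Rightarrow> real" and B assume \<phi>: "\<phi> \<in> borel_measurable N" "\<forall>x. \<bar>\<phi> x\<bar> \<le> B"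
    have \<phi>L[measurable]: "\<phi> \<in> borel_measurable L" using \<phi>(1) L(2) measurable_cong_sets by blast
    have int\<phi>: "integrable L (\<lambda>x. \<phi> x *\<^sub>R f x)" if "integrable L f" for f :: "real^'n \<Rightarrow> 'b::{banach,second_countable_topology}"
    proof (rule Bochner_Integration.integrable_bound[where f = "\<lambda>x. B * norm (f x)"])
      show "integrable L (\<lambda>x. B * norm (f x))" using that by simp
      show "(\<lambda>x. \<phi> x *\<^sub>R f x) \<in> borel_measurable L" using that by auto
      show "AE x in L. norm (\<phi> x *\<^sub>R f x) \<le> norm (B * norm (f x))"
      proof (rule AE_I2)
        fix x
        have "\<bar>\<phi> x\<bar> * norm (f x) \<le> B * norm (f x)" using \<phi>(2) by (intro mult_right_mono) auto
        also have "\<dots> \<le> norm (B * norm (f x))" by simp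
        finally show "norm (\<phi> x *\<^sub>R f x) \<le> norm (B * norm (f x))" by simp
      qed
    qed
    have "(\<integral>x. \<phi> x *\<^sub>R \<sigma> x \<partial>\<mu>) = (\<integral>x. norm (F x) *\<^sub>R (\<phi> x *\<^sub>R \<sigma> x) \<partial>L)"
      unfolding \<mu>_def using \<sigma>m by (intro integral_density) auto
    also have "\<dots> = (\<integral>x. \<phi> x *\<^sub>R F x \<partial>L)"
      by (intro Bochner_Integration.integral_cong) (auto simp: \<sigma>_def)
    finally have eq: "(\<integral>x. \<phi> x *\<^sub>R \<sigma> x \<partial>\<mu>) = (\<integral>x. \<phi> x *\<^sub>R F x \<partial>L)" .
    have "(\<integral>x. \<phi> x *\<^sub>R F x \<partial>L) $ i = C * ((\<integral>x. \<phi> x \<partial>\<beta> i) - (\<integral>x. \<phi> x \<partial>\<alpha> i))" for i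
    proof -
      have "(\<integral>x. \<phi> x *\<^sub>R F x \<partial>L) $ i = (\<integral>x. (\<phi> x *\<^sub>R F x) $ i \<partial>L)"
        using integral_bounded_linear[OF bounded_linear_vec_nth int\<phi>[OF F], of i] by simp
      also have "\<dots> = (\<integral>x. C * (\<phi> x *\<^sub>R D (i, True) x - \<phi> x *\<^sub>R D (i, False) x) \<partial>L)"
        by (intro Bochner_Integration.integral_cong) (auto simp: F_def algebra_simps)
      also have "\<dots> = C * ((\<integral>x. \<phi> x *\<^sub>R D (i, True) x \<partial>L) - (\<integral>x. \<phi> x *\<^sub>R D (i, False) x \<partial>L))"
        using int\<phi>[OF D(2)] by simp
      finally show ?thesis
        using D(3)[OF \<phi>L, of "(i, True)"] D(3)[OF \<phi>L, of "(i, False)"] by (simp add: M_def mult.commute)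
    qed
    then show "(\<integral>x. \<phi> x *\<^sub>R \<sigma> x \<partial>\<mu>) = (\<chi> i. C * ((\<integral>x. \<phi> x \<partial>\<beta> i) - (\<integral>x. \<phi> x \<partial>\<alpha> i)))"
      unfolding eq by (simp add: vec_eq_iff)
  qed
qed

subsection \<open>Translation differences and functions of bounded variation\<close>

definition translation_diff :: "real \<Rightarrow> (real^'n \<Rightarrow> real) \<Rightarrow> real^'n \<Rightarrow> real" where
  "translation_diff l u z = (\<integral>x. \<bar>u (x + z) - u x\<bar> \<partial>torus_measure l)"

text \<open>\<open>BV01\<close> without the gradient: the setting for limits whose bounded variation
  is yet to be proved.\<close>

definition binary_periodic :: "real \<Rightarrow> (real^'n \<Rightarrow> real) \<Rightarrow> bool" where
  "binary_periodic l u \<longleftrightarrow> periodic l u \<and> u \<in> borel_measurable (torus_measure l) \<and> (\<forall>x. u x \<in> {0, 1})"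

lemma binary_periodicD:
  assumes "binary_periodic l u"
  shows "periodic l u" "u \<in> borel_measurable (torus_measure l)" "u x \<in> {0, 1}" "0 \<le> u x" "u x \<le> 1" "\<bar>u x\<bar> \<le> 1"
    "\<bar>u y - u x\<bar> \<le> 1"
proof -
  have "u x \<in> {0, 1}" "u y \<in> {0, 1}" using assms by (auto simp: binary_periodic_def)
  then show "u x \<in> {0, 1}" "0 \<le> u x" "u x \<le> 1" "\<bar>u x\<bar> \<le> 1" "\<bar>u y - u x\<bar> \<le> 1" by auto
qed (use assms in \<open>auto simp: binary_periodic_def\<close>)

lemma integrable_torus_bounded:
  fixes f :: "real^'n \<Rightarrow> 'b::{banach, second_countable_topology}"
  assumes "l > 0" "f \<in> borel_measurable (torus_measure l)" "\<And>x. x \<in> torus l \<Longrightarrow> norm (f x) \<le> B"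
  shows "integrable (torus_measure l) f"
  using assms by (intro finite_measure.integrable_const_bound[OF finite_torus_measure[OF assms(1)], of f B] AE_I2) auto

lemma test_function_gradient_periodic:
  assumes "test_function l \<phi> g" shows "periodic l g"
  unfolding periodic_def
proof (intro allI)
  fix x and i :: 'a
  let ?w = "l *\<^sub>R axis i 1"
  have "(\<lambda>x. \<phi> (x + ?w)) = \<phi>" using assms by (auto simp: test_function_def periodic_def)
  then have "(\<phi> has_derivative (\<lambda>h. g (x + ?w) \<bullet> h)) (at x)" "(\<phi> has_derivative (\<lambda>h. g x \<bullet> h)) (at x)"
    using test_function_shift[OF assms, of ?w] assms by (auto simp: test_function_def)
  then have "(\<lambda>h. g (x + ?w) \<bullet> h) = (\<lambda>h. g x \<bullet> h)" by (rule has_derivative_unique)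
  then have "g (x + ?w) \<bullet> h = g x \<bullet> h" for h by meson
  then show "g (x + ?w) = g x" by (metis vector_eq_rdot)
qed

lemma test_function_bounds:
  assumes l: "l > 0" and t: "test_function l \<phi> g"
  obtains B where "B \<ge> 0" "\<And>x. norm (g x) \<le> B" "\<And>x. \<bar>\<phi> x\<bar> \<le> B" "\<And>x y. \<bar>\<phi> y - \<phi> x\<bar> \<le> B * norm (y - x)"
proof -
  obtain B1 where B1: "\<And>x. norm (g x) \<le> B1"
    using periodic_continuous_bounded[OF l test_function_gradient_periodic[OF t]] t
    unfolding test_function_def by blast
  obtain B2 where B2: "\<And>x. norm (\<phi> x) \<le> B2"
    using periodic_continuous_bounded[OF l, of \<phi>] t test_function_continuous[OF t]
    unfolding test_function_def by blast
  define B where "B = max B1 B2"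
  have g: "norm (g x) \<le> B" for x using B1[of x] by (simp add: B_def)
  have \<phi>: "\<bar>\<phi> x\<bar> \<le> B" for x using B2[of x] by (simp add: B_def)
  have B0: "B \<ge> 0" using g[of 0] norm_ge_zero order_trans by blast
  have "norm (\<phi> y - \<phi> x) \<le> B * norm (y - x)" for x y
  proof (rule differentiable_bound[of UNIV \<phi> "\<lambda>x h. g x \<bullet> h"])
    show "(\<phi> has_derivative (\<lambda>h. g x \<bullet> h)) (at x within UNIV)" for x using t by (simp add: test_function_def)
    show "onorm (\<lambda>h. g x \<bullet> h) \<le> B" for x
    proof (rule onorm_bound[OF B0])
      fix h show "norm (g x \<bullet> h) \<le> B * norm h"
        using Cauchy_Schwarz_ineq2[of "g x" h] mult_right_mono[OF g[of x], of "norm h"] by simp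
    qed
  qed auto
  then show thesis using B0 g \<phi> by (intro that[of B]) auto
qed

lemma test_function_line_derivative:
  assumes t: "test_function l \<phi> g"
  shows "((\<lambda>s. \<phi> (x + s *\<^sub>R z)) has_real_derivative g (x + s *\<^sub>R z) \<bullet> z) (at s)"
proof -
  have 1: "((\<lambda>s. x + s *\<^sub>R z) has_derivative (\<lambda>h. h *\<^sub>R z)) (at s)" by (auto intro!: derivative_eq_intros)
  have 2: "(\<phi> has_derivative (\<lambda>h. g (x + s *\<^sub>R z) \<bullet> h)) (at (x + s *\<^sub>R z))"
    using t unfolding test_function_def by blast
  show ?thesis
    using has_derivative_compose[OF 1 2] by (simp add: has_field_derivative_def mult.commute)
      (simp add: mult_commute_abs)
qed

text \<open>The test function is moved instead of \<open>u\<close>, which need not be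
  differentiable. Its Lipschitz constant bounds the difference quotients, so dominated convergence
  applies along every sequence of steps.\<close>

lemma integral_test_function_derivative:
  fixes u :: "real^'n \<Rightarrow> real"
  assumes l: "l > 0" and u: "binary_periodic l u" and t: "test_function l \<phi> g"
  shows "((\<lambda>s. \<integral>x. u x * \<phi> (x + s *\<^sub>R z) \<partial>torus_measure l) has_real_derivative
      (\<integral>x. u x * (g (x + s *\<^sub>R z) \<bullet> z) \<partial>torus_measure l)) (at s)"
  unfolding DERIV_def
proof (subst tendsto_at_iff_sequentially, intro allI impI)
  fix \<tau> :: "nat \<Rightarrow> real"
  assume \<tau>: "\<forall>i. \<tau> i \<in> UNIV - {0}" "\<tau> \<longlonglongrightarrow> 0"
  obtain B where B: "B \<ge> 0" "\<And>x. norm (g x) \<le> B" "\<And>x. \<bar>\<phi> x\<bar> \<le> B" "\<And>x y. \<bar>\<phi> y - \<phi> x\<bar> \<le> B * norm (y - x)"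
    using test_function_bounds[OF l t] by blast
  have mu: "u \<in> borel_measurable (torus_measure l)" using u by (simp add: binary_periodic_def)
  have m\<phi>: "(\<lambda>x. \<phi> (x + w)) \<in> borel_measurable (torus_measure l)" for w
    by (intro torus_measure_borel_fun test_function_borel[OF test_function_shift[OF t]])
  have mg: "(\<lambda>x. g (x + w)) \<in> borel_measurable (torus_measure l)" for w
    by (intro torus_measure_borel_fun test_function_gradient_borel[OF test_function_shift[OF t]])
  have i\<phi>: "integrable (torus_measure l) (\<lambda>x. u x * \<phi> (x + w))" for w
  proof (rule integrable_torus_bounded[OF l, of _ B])
    show "(\<lambda>x. u x * \<phi> (x + w)) \<in> borel_measurable (torus_measure l)" using mu m\<phi> by simp
    have "\<bar>u x\<bar> * \<bar>\<phi> (x + w)\<bar> \<le> 1 * B" for x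
      using B binary_periodicD(6)[OF u, of x] by (intro mult_mono) auto
    then show "norm (u x * \<phi> (x + w)) \<le> B" for x by (simp add: abs_mult)
  qed
  let ?q = "\<lambda>n x. u x * ((\<phi> (x + (s + \<tau> n) *\<^sub>R z) - \<phi> (x + s *\<^sub>R z)) / \<tau> n)"
  have "(\<lambda>n. \<integral>x. ?q n x \<partial>torus_measure l) \<longlonglongrightarrow> (\<integral>x. u x * (g (x + s *\<^sub>R z) \<bullet> z) \<partial>torus_measure l)"
  proof (rule integral_dominated_convergence[where w = "\<lambda>_. B * norm z"])
    show "(\<lambda>x. u x * (g (x + s *\<^sub>R z) \<bullet> z)) \<in> borel_measurable (torus_measure l)"
      using mu mg by (intro borel_measurable_times borel_measurable_inner) auto
    show "?q n \<in> borel_measurable (torus_measure l)" for n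
      using mu m\<phi> by (intro borel_measurable_times borel_measurable_divide borel_measurable_diff) auto
    show "integrable (torus_measure l) (\<lambda>_. B * norm z)"
      by (rule integrable_torus_bounded[OF l, where B = "B * norm z"]) (use B in auto)
    show "AE x in torus_measure l. (\<lambda>n. ?q n x) \<longlonglongrightarrow> u x * (g (x + s *\<^sub>R z) \<bullet> z)"
    proof (rule AE_I2)
      fix x
      have "((\<lambda>h. (\<phi> (x + (s + h) *\<^sub>R z) - \<phi> (x + s *\<^sub>R z)) / h) \<longlongrightarrow> g (x + s *\<^sub>R z) \<bullet> z) (at 0)"
        using test_function_line_derivative[OF t, of x z s] by (simp add: DERIV_def)
      then have "((\<lambda>h. (\<phi> (x + (s + h) *\<^sub>R z) - \<phi> (x + s *\<^sub>R z)) / h) \<circ> \<tau>) \<longlonglongrightarrow> g (x + s *\<^sub>R z) \<bullet> z"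
        using \<tau> unfolding tendsto_at_iff_sequentially by blast
      then show "(\<lambda>n. ?q n x) \<longlonglongrightarrow> u x * (g (x + s *\<^sub>R z) \<bullet> z)"
        unfolding o_def by (intro tendsto_mult tendsto_const)
    qed
    show "AE x in torus_measure l. norm (?q n x) \<le> B * norm z" for n
    proof (rule AE_I2)
      fix x
      have \<tau>n: "\<bar>\<tau> n\<bar> > 0" using \<tau>(1) by auto
      have "\<bar>\<phi> (x + (s + \<tau> n) *\<^sub>R z) - \<phi> (x + s *\<^sub>R z)\<bar> \<le> B * norm ((x + (s + \<tau> n) *\<^sub>R z) - (x + s *\<^sub>R z))"
        by (rule B(4))
      also have "(x + (s + \<tau> n) *\<^sub>R z) - (x + s *\<^sub>R z) = \<tau> n *\<^sub>R z" by (simp add: algebra_simps)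
      finally have "\<bar>\<phi> (x + (s + \<tau> n) *\<^sub>R z) - \<phi> (x + s *\<^sub>R z)\<bar> / \<bar>\<tau> n\<bar> \<le> B * norm z"
        using \<tau>n by (simp add: divide_le_eq mult_ac)
      then have "\<bar>u x\<bar> * (\<bar>\<phi> (x + (s + \<tau> n) *\<^sub>R z) - \<phi> (x + s *\<^sub>R z)\<bar> / \<bar>\<tau> n\<bar>) \<le> 1 * (B * norm z)"
        using binary_periodicD(6)[OF u, of x] by (intro mult_mono) auto
      then show "norm (?q n x) \<le> B * norm z" by (simp add: abs_mult abs_divide)
    qed
  qed
  moreover have "(\<integral>x. ?q n x \<partial>torus_measure l) = ((\<integral>x. u x * \<phi> (x + (s + \<tau> n) *\<^sub>R z) \<partial>torus_measure l)
      - (\<integral>x. u x * \<phi> (x + s *\<^sub>R z) \<partial>torus_measure l)) / \<tau> n" for n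
  proof -
    have "(\<integral>x. ?q n x \<partial>torus_measure l) =
        (\<integral>x. (u x * \<phi> (x + (s + \<tau> n) *\<^sub>R z) - u x * \<phi> (x + s *\<^sub>R z)) / \<tau> n \<partial>torus_measure l)"
      by (intro Bochner_Integration.integral_cong) (auto simp: right_diff_distrib)
    then show ?thesis using i\<phi> by simp
  qed
  ultimately have "(\<lambda>n. ((\<integral>x. u x * \<phi> (x + (s + \<tau> n) *\<^sub>R z) \<partial>torus_measure l)
      - (\<integral>x. u x * \<phi> (x + s *\<^sub>R z) \<partial>torus_measure l)) / \<tau> n) \<longlonglongrightarrow>
      (\<integral>x. u x * (g (x + s *\<^sub>R z) \<bullet> z) \<partial>torus_measure l)"
    by (simp only:)
  then show "((\<lambda>h. ((\<integral>x. u x * \<phi> (x + (s + h) *\<^sub>R z) \<partial>torus_measure l) -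
      (\<integral>x. u x * \<phi> (x + s *\<^sub>R z) \<partial>torus_measure l)) / h) \<circ> \<tau>) \<longlonglongrightarrow>
      (\<integral>x. u x * (g (x + s *\<^sub>R z) \<bullet> z) \<partial>torus_measure l)"
    by (simp add: o_def)
qed

text \<open>Discrete integration by parts: translation invariance moves the shift from
  \<open>u\<close> to \<open>\<phi>\<close> with the opposite sign.\<close>

lemma integral_shift_test_function:
  fixes u :: "real^'n \<Rightarrow> real"
  assumes l: "l > 0" and u: "binary_periodic l u" and t: "test_function l \<phi> g"
  shows "(\<integral>x. \<phi> x * (u (x + z) - u x) \<partial>torus_measure l) =
    (\<integral>x. u x * \<phi> (x - z) \<partial>torus_measure l) - (\<integral>x. u x * \<phi> x \<partial>torus_measure l)"
proof -
  obtain B where B: "B \<ge> 0" "\<And>x. \<bar>\<phi> x\<bar> \<le> B"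
    using test_function_bounds[OF l t] by metis
  have mu: "u \<in> borel_measurable (torus_measure l)" using u by (simp add: binary_periodic_def)
  have p\<phi>: "periodic l \<phi>" using t by (simp add: test_function_def)
  have m\<phi>: "(\<lambda>x. \<phi> (x + w)) \<in> borel_measurable (torus_measure l)" for w
    by (intro torus_measure_borel_fun test_function_borel[OF test_function_shift[OF t]])
  have bd: "\<bar>u x * \<phi> y\<bar> \<le> B" for x y
  proof -
    have "\<bar>u x\<bar> * \<bar>\<phi> y\<bar> \<le> 1 * B"
      using B binary_periodicD(6)[OF u, of x] by (intro mult_mono) auto
    then show ?thesis by (simp add: abs_mult)
  qed
  have i1: "integrable (torus_measure l) (\<lambda>x. u x * \<phi> (x + w))" for w
    using mu m\<phi> bd by (intro integrable_torus_bounded[OF l, of _ B]) auto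
  have per: "periodic l (\<lambda>x. u x * \<phi> (x - z))"
    using binary_periodicD(1)[OF u] periodic_shift[OF p\<phi>, of "- z"] by (auto simp: periodic_def)
  have i2: "integrable (torus_measure l) (\<lambda>x. u (x + z) * \<phi> x)"
    using torus_measure_shift_integrable[OF l per, of z] i1[of "- z"] by simp
  have "(\<integral>x. \<phi> x * (u (x + z) - u x) \<partial>torus_measure l) = (\<integral>x. u (x + z) * \<phi> x - u x * \<phi> x \<partial>torus_measure l)"
    by (intro Bochner_Integration.integral_cong) (auto simp: algebra_simps)
  also have "\<dots> = (\<integral>x. u (x + z) * \<phi> x \<partial>torus_measure l) - (\<integral>x. u x * \<phi> x \<partial>torus_measure l)"
    using i2 i1[of 0] by simp
  also have "(\<integral>x. u (x + z) * \<phi> x \<partial>torus_measure l) = (\<integral>x. u x * \<phi> (x - z) \<partial>torus_measure l)"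
    using torus_measure_shift_integral[OF l per, of z] i1[of "- z"] by auto
  finally show ?thesis .
qed

section \<open>Directional variation as the supremum of difference quotients\<close>

lemma is_polar_gradientD:
  fixes u :: "real^'n \<Rightarrow> real"
  assumes l: "l > 0" and p: "is_polar_gradient l u \<mu> \<sigma>"
  shows "finite_measure \<mu>" "space \<mu> = torus l" "(\<lambda>x. x) \<in> measurable \<mu> borel" "\<sigma> \<in> borel_measurable \<mu>"
    "\<And>x. x \<in> torus l \<Longrightarrow> norm (\<sigma> x) = 1"
    "\<And>\<phi> g. test_function l \<phi> g \<Longrightarrow> (\<integral>x. u x *\<^sub>R g x \<partial>torus_measure l) = - (\<integral>x. \<phi> x *\<^sub>R \<sigma> x \<partial>\<mu>)"
    "integrable \<mu> (\<lambda>x. \<bar>z \<bullet> \<sigma> x\<bar>)" "\<And>x. x \<in> torus l \<Longrightarrow> \<bar>z \<bullet> \<sigma> x\<bar> \<le> norm z"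
proof -
  show f: "finite_measure \<mu>" and m: "\<sigma> \<in> borel_measurable \<mu>" and n: "\<And>x. x \<in> torus l \<Longrightarrow> norm (\<sigma> x) = 1"
    using p by (auto simp: is_polar_gradient_def)
  have s: "sets \<mu> = sets (restrict_space borel (torus l))" using p by (simp add: is_polar_gradient_def)
  then show sp: "space \<mu> = torus l" using sets_eq_imp_space_eq[OF s] by (simp add: space_restrict_space)
  show "(\<lambda>x. x) \<in> measurable \<mu> borel"
    unfolding measurable_cong_sets[OF s refl] by (intro measurable_restrict_space1) simp
  show "\<And>\<phi> g. test_function l \<phi> g \<Longrightarrow> (\<integral>x. u x *\<^sub>R g x \<partial>torus_measure l) = - (\<integral>x. \<phi> x *\<^sub>R \<sigma> x \<partial>\<mu>)"
    using p unfolding is_polar_gradient_def test_function_def set_integral_torus by blast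
  show b: "\<bar>z \<bullet> \<sigma> x\<bar> \<le> norm z" if "x \<in> torus l" for x
    using Cauchy_Schwarz_ineq2[of z "\<sigma> x"] n[OF that] by simp
  show "integrable \<mu> (\<lambda>x. \<bar>z \<bullet> \<sigma> x\<bar>)"
    using b m by (intro finite_measure.integrable_const_bound[OF f, of _ "norm z"] AE_I2) (auto simp: sp)
qed

text \<open>Supplies the hypothesis \<open>app\<close> of \<open>test_function_dual\<close> for
  Lebesgue measure.\<close>

lemma torus_measure_almost_borel:
  assumes "A \<in> sets (torus_measure l)"
  shows "\<exists>B\<in>sets borel. AE x in torus_measure l. x \<in> A \<longleftrightarrow> x \<in> B"
proof -
  have "A \<in> sets lebesgue" using assms by (simp add: sets_torus_measure)
  then obtain S N N' where S: "A = S \<union> N" "N \<subseteq> N'" "N' \<in> null_sets lborel" "S \<in> sets lborel"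
    by (rule sets_completionE) auto
  have "AE x in lborel. x \<notin> N'" using S(3) by (rule AE_not_in)
  then have "AE x in lebesgue. x \<notin> N'" by (rule AE_completion)
  then have "AE x in torus_measure l. x \<notin> N'"
    unfolding torus_measure_def by (subst AE_restrict_space_iff) auto
  then have "AE x in torus_measure l. x \<in> A \<longleftrightarrow> x \<in> S"
    by eventually_elim (use S in auto)
  with S(4) show ?thesis by auto
qed

text \<open>For a \<open>\<psi>\<close> nearly optimal against \<open>u (x + z) - u x\<close>,
  discrete integration by parts writes the pairing as \<open>k 1 - k 0\<close>, where
  \<open>k s\<close> pairs \<open>u\<close> with \<open>\<psi>\<close> evaluated at
  \<open>x - s z\<close>. The mean value theorem turns this into a derivative, and the definition of
  the gradient turns the derivative into a pairing of \<open>z \<bullet> \<sigma>\<close> with a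
  translate of \<open>\<psi>\<close>, still bounded by 1.\<close>

lemma translation_diff_le_polar:
  fixes u :: "real^'n \<Rightarrow> real"
  assumes l: "l > 0" and u: "binary_periodic l u" and p: "is_polar_gradient l u \<mu> \<sigma>"
  shows "translation_diff l u z \<le> (\<integral>x. \<bar>z \<bullet> \<sigma> x\<bar> \<partial>\<mu>)"
proof (rule field_le_epsilon)
  fix e :: real assume e: "e > 0"
  note P = is_polar_gradientD[OF l p]
  interpret finite_measure \<mu> by (rule P(1))
  have mu: "u \<in> borel_measurable (torus_measure l)" using u by (simp add: binary_periodic_def)
  have mid: "(\<lambda>x. x) \<in> measurable (torus_measure l) borel" by (rule torus_measure_borel)
  have mw: "(\<lambda>x. u (x + z) - u x) \<in> borel_measurable (torus_measure l)"
    using torus_measure_shift_measurable[OF l binary_periodicD(1)[OF u] mu] mu by simp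
  obtain \<psi> g where \<psi>: "test_function l \<psi> g" "\<forall>x. \<bar>\<psi> x\<bar> \<le> 1"
    "translation_diff l u z \<le> (\<integral>x. \<psi> x * (u (x + z) - u x) \<partial>torus_measure l) + e"
    using test_function_dual[OF l finite_torus_measure[OF l] _ mid torus_measure_almost_borel mw _ e, of 1]
      binary_periodicD(7)[OF u] unfolding translation_diff_def by auto
  define k where "k s = (\<integral>x. u x * \<psi> (x + s *\<^sub>R (- z)) \<partial>torus_measure l)" for s
  define k' where "k' s = (\<integral>x. u x * (g (x + s *\<^sub>R (- z)) \<bullet> (- z)) \<partial>torus_measure l)" for s
  have dk: "(k has_real_derivative k' s) (at s)" for s
    unfolding k_def k'_def by (rule integral_test_function_derivative[OF l u \<psi>(1)])
  have k'_le: "k' s \<le> (\<integral>x. \<bar>z \<bullet> \<sigma> x\<bar> \<partial>\<mu>)" for s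
  proof -
    let ?\<psi> = "\<lambda>x. \<psi> (x + s *\<^sub>R (- z))" and ?g = "\<lambda>x. g (x + s *\<^sub>R (- z))"
    have T: "test_function l ?\<psi> ?g" by (rule test_function_shift[OF \<psi>(1)])
    obtain B where B: "\<And>x. norm (g x) \<le> B" using test_function_bounds[OF l \<psi>(1)] by metis
    have B0: "B \<ge> 0" using B[of 0] norm_ge_zero order_trans by blast
    have ig: "integrable (torus_measure l) (\<lambda>x. u x *\<^sub>R ?g x)"
    proof (rule integrable_torus_bounded[OF l, of _ B])
      show "(\<lambda>x. u x *\<^sub>R ?g x) \<in> borel_measurable (torus_measure l)"
        using mu torus_measure_borel_fun[OF test_function_gradient_borel[OF T]] by simp
      show "norm (u x *\<^sub>R ?g x) \<le> B" for x
        using mult_mono[OF binary_periodicD(6)[OF u, of x] B[of "x + s *\<^sub>R (- z)"]] by simp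
    qed
    have m\<psi>: "?\<psi> \<in> borel_measurable \<mu>"
      using measurable_compose[OF P(3) test_function_borel[OF T]] by simp
    have i\<psi>: "integrable \<mu> (\<lambda>x. ?\<psi> x *\<^sub>R \<sigma> x)"
      using \<psi>(2) P(5) m\<psi> P(4) by (intro integrable_const_bound[of _ 1] AE_I2) (auto simp: P(2))
    have "k' s = (\<integral>x. (u x *\<^sub>R ?g x) \<bullet> (- z) \<partial>torus_measure l)"
      unfolding k'_def by (intro Bochner_Integration.integral_cong) auto
    also have "\<dots> = (\<integral>x. u x *\<^sub>R ?g x \<partial>torus_measure l) \<bullet> (- z)"
      using ig by (intro integral_inner_left) auto
    also have "\<dots> = (\<integral>x. ?\<psi> x *\<^sub>R \<sigma> x \<partial>\<mu>) \<bullet> z"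
      unfolding P(6)[OF T] by simp
    also have "\<dots> = (\<integral>x. (?\<psi> x *\<^sub>R \<sigma> x) \<bullet> z \<partial>\<mu>)"
      using i\<psi> by (intro integral_inner_left[symmetric]) auto
    also have "\<dots> \<le> (\<integral>x. \<bar>z \<bullet> \<sigma> x\<bar> \<partial>\<mu>)"
    proof (rule integral_mono)
      show "integrable \<mu> (\<lambda>x. (?\<psi> x *\<^sub>R \<sigma> x) \<bullet> z)" using i\<psi> by (rule integrable_inner_left)
      show "integrable \<mu> (\<lambda>x. \<bar>z \<bullet> \<sigma> x\<bar>)" by (rule P(7))
      fix x
      have "(?\<psi> x *\<^sub>R \<sigma> x) \<bullet> z \<le> \<bar>?\<psi> x\<bar> * \<bar>\<sigma> x \<bullet> z\<bar>"
        by (simp add: abs_mult[symmetric])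
      also have "\<dots> \<le> 1 * \<bar>\<sigma> x \<bullet> z\<bar>" using \<psi>(2) by (intro mult_right_mono) auto
      finally show "(?\<psi> x *\<^sub>R \<sigma> x) \<bullet> z \<le> \<bar>z \<bullet> \<sigma> x\<bar>" by (simp add: inner_commute)
    qed
    finally show ?thesis .
  qed
  obtain \<xi> where "k 1 - k 0 = (1 - 0) * k' \<xi>"
    using MVT2[of 0 1 k k'] dk by auto
  moreover have "(\<integral>x. \<psi> x * (u (x + z) - u x) \<partial>torus_measure l) = k 1 - k 0"
    unfolding k_def integral_shift_test_function[OF l u \<psi>(1)] by simp
  ultimately show "translation_diff l u z \<le> (\<integral>x. \<bar>z \<bullet> \<sigma> x\<bar> \<partial>\<mu>) + e"
    using \<psi>(3) k'_le[of \<xi>] by simp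
qed

text \<open>Conversely, let \<open>\<psi>\<close> be nearly optimal against
  \<open>\<omega> \<bullet> \<sigma>\<close> for the variation measure. The pairing is the
  derivative at 0 of the corresponding function \<open>k\<close>, whose difference quotients are at
  most \<open>c\<close> because \<open>\<psi>\<close> is bounded by 1.\<close>

lemma polar_le_translation_diff:
  fixes u :: "real^'n \<Rightarrow> real"
  assumes l: "l > 0" and u: "binary_periodic l u" and p: "is_polar_gradient l u \<mu> \<sigma>"
    and c: "\<And>t. t > 0 \<Longrightarrow> translation_diff l u (t *\<^sub>R \<omega>) \<le> c * t"
  shows "(\<integral>x. \<bar>\<omega> \<bullet> \<sigma> x\<bar> \<partial>\<mu>) \<le> c"
proof (rule field_le_epsilon)
  fix e :: real assume e: "e > 0"
  note P = is_polar_gradientD[OF l p]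
  interpret finite_measure \<mu> by (rule P(1))
  have mu: "u \<in> borel_measurable (torus_measure l)" using u by (simp add: binary_periodic_def)
  have app: "\<exists>B\<in>sets borel. AE x in \<mu>. x \<in> A \<longleftrightarrow> x \<in> B" if "A \<in> sets \<mu>" for A
  proof -
    have "A \<in> sets (restrict_space borel (torus l))" using that p by (simp add: is_polar_gradient_def)
    then have "A \<in> sets borel" by (subst (asm) sets_restrict_space_iff) auto
    then show ?thesis by auto
  qed
  have m: "(\<lambda>x. \<omega> \<bullet> \<sigma> x) \<in> borel_measurable \<mu>" using P(4) by simp
  obtain \<psi> g where \<psi>: "test_function l \<psi> g" "\<forall>x. \<bar>\<psi> x\<bar> \<le> 1"
    "(\<integral>x. \<bar>\<omega> \<bullet> \<sigma> x\<bar> \<partial>\<mu>) \<le> (\<integral>x. \<psi> x * (\<omega> \<bullet> \<sigma> x) \<partial>\<mu>) + e"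
    using test_function_dual[OF l P(1,2,3) app m P(8) e] by auto
  define k where "k s = (\<integral>x. u x * \<psi> (x + s *\<^sub>R (- \<omega>)) \<partial>torus_measure l)" for s
  define k' where "k' = (\<integral>x. u x * (g (x + 0 *\<^sub>R (- \<omega>)) \<bullet> (- \<omega>)) \<partial>torus_measure l)"
  have dk: "(k has_real_derivative k') (at 0)"
    unfolding k_def k'_def by (rule integral_test_function_derivative[OF l u \<psi>(1)])
  have "k' = (\<integral>x. \<psi> x * (\<omega> \<bullet> \<sigma> x) \<partial>\<mu>)"
  proof -
    obtain B where B: "\<And>x. norm (g x) \<le> B" using test_function_bounds[OF l \<psi>(1)] by metis
    have ig: "integrable (torus_measure l) (\<lambda>x. u x *\<^sub>R g x)"
    proof (rule integrable_torus_bounded[OF l, of _ B])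
      show "(\<lambda>x. u x *\<^sub>R g x) \<in> borel_measurable (torus_measure l)"
        using mu torus_measure_borel_fun[OF test_function_gradient_borel[OF \<psi>(1)]] by simp
      show "norm (u x *\<^sub>R g x) \<le> B" for x
        using mult_mono[OF binary_periodicD(6)[OF u, of x] B[of x]] by simp
    qed
    have m\<psi>: "\<psi> \<in> borel_measurable \<mu>"
      using measurable_compose[OF P(3) test_function_borel[OF \<psi>(1)]] by simp
    have i\<psi>: "integrable \<mu> (\<lambda>x. \<psi> x *\<^sub>R \<sigma> x)"
      using \<psi>(2) P(5) m\<psi> P(4) by (intro integrable_const_bound[of _ 1] AE_I2) (auto simp: P(2))
    have "k' = (\<integral>x. (u x *\<^sub>R g x) \<bullet> (- \<omega>) \<partial>torus_measure l)"
      unfolding k'_def by (intro Bochner_Integration.integral_cong) auto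
    also have "\<dots> = (\<integral>x. u x *\<^sub>R g x \<partial>torus_measure l) \<bullet> (- \<omega>)"
      using ig by (intro integral_inner_left) auto
    also have "\<dots> = (\<integral>x. \<psi> x *\<^sub>R \<sigma> x \<partial>\<mu>) \<bullet> \<omega>"
      unfolding P(6)[OF \<psi>(1)] by simp
    also have "\<dots> = (\<integral>x. (\<psi> x *\<^sub>R \<sigma> x) \<bullet> \<omega> \<partial>\<mu>)"
      using i\<psi> by (intro integral_inner_left[symmetric]) auto
    finally show ?thesis by (simp add: inner_commute)
  qed
  \<comment> \<open>The limit from the right suffices and fits the hypothesis, which speaks of
    \<open>t > 0\<close>.\<close>
  moreover have "k' \<le> c"
  proof (rule tendsto_upperbound)
    have "((\<lambda>h. (k (0 + h) - k 0) / h) \<longlongrightarrow> k') (at 0)" using dk by (simp add: DERIV_def)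
    then show "((\<lambda>h. (k h - k 0) / h) \<longlongrightarrow> k') (at_right 0)"
      by (simp add: filterlim_at_split)
    have "(k h - k 0) / h \<le> c" if h: "h > 0" for h
    proof -
      have "k h - k 0 = (\<integral>x. \<psi> x * (u (x + h *\<^sub>R \<omega>) - u x) \<partial>torus_measure l)"
        unfolding k_def integral_shift_test_function[OF l u \<psi>(1)] by simp
      also have "\<dots> \<le> (\<integral>x. \<bar>u (x + h *\<^sub>R \<omega>) - u x\<bar> \<partial>torus_measure l)"
      proof (rule integral_mono)
        have md: "(\<lambda>x. u (x + h *\<^sub>R \<omega>) - u x) \<in> borel_measurable (torus_measure l)"
          using torus_measure_shift_measurable[OF l binary_periodicD(1)[OF u] mu] mu by simp
        then show "integrable (torus_measure l) (\<lambda>x. \<bar>u (x + h *\<^sub>R \<omega>) - u x\<bar>)"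
          using binary_periodicD(7)[OF u] by (intro integrable_torus_bounded[OF l, of _ 1]) auto
        have b: "\<bar>\<psi> x * (u (x + h *\<^sub>R \<omega>) - u x)\<bar> \<le> \<bar>u (x + h *\<^sub>R \<omega>) - u x\<bar>" for x
          using mult_right_mono[of "\<bar>\<psi> x\<bar>" 1 "\<bar>u (x + h *\<^sub>R \<omega>) - u x\<bar>"] \<psi>(2) by (simp add: abs_mult)
        then show "\<psi> x * (u (x + h *\<^sub>R \<omega>) - u x) \<le> \<bar>u (x + h *\<^sub>R \<omega>) - u x\<bar>" for x
          using abs_le_D1 by blast
        show "integrable (torus_measure l) (\<lambda>x. \<psi> x * (u (x + h *\<^sub>R \<omega>) - u x))"
          using md torus_measure_borel_fun[OF test_function_borel[OF \<psi>(1)]] order_trans[OF b binary_periodicD(7)[OF u]]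
          by (intro integrable_torus_bounded[OF l, of _ 1]) auto
      qed
      also have "\<dots> \<le> c * h" using c[OF h] by (simp add: translation_diff_def)
      finally show ?thesis using h by (simp add: divide_le_eq)
    qed
    then show "\<forall>\<^sub>F h in at_right 0. (k h - k 0) / h \<le> c"
      by (auto simp: eventually_at_filter)
  qed simp
  ultimately show "(\<integral>x. \<bar>\<omega> \<bullet> \<sigma> x\<bar> \<partial>\<mu>) \<le> c + e" using \<psi>(3) by simp
qed


section \<open>The gradient as a weak limit of difference quotients\<close>

lemma translation_diff_measurable:
  fixes u :: "real^'n \<Rightarrow> real"
  assumes l: "l > 0" and u: "binary_periodic l u"
  shows "(\<lambda>x. u (x + z) - u x) \<in> borel_measurable (torus_measure l)"
    and "integrable (torus_measure l) (\<lambda>x. u (x + z) - u x)"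
    and "integrable (torus_measure l) (\<lambda>x. \<bar>u (x + z) - u x\<bar>)"
proof -
  have mu: "u \<in> borel_measurable (torus_measure l)" using u by (simp add: binary_periodic_def)
  show m: "(\<lambda>x. u (x + z) - u x) \<in> borel_measurable (torus_measure l)"
    using torus_measure_shift_measurable[OF l binary_periodicD(1)[OF u] mu] mu by simp
  show "integrable (torus_measure l) (\<lambda>x. u (x + z) - u x)"
    using binary_periodicD(7)[OF u] m by (intro integrable_torus_bounded[OF l, of _ 1]) auto
  then show "integrable (torus_measure l) (\<lambda>x. \<bar>u (x + z) - u x\<bar>)" by (rule integrable_abs)
qed

lemma translation_diff_nonneg: "0 \<le> translation_diff l u z"
  unfolding translation_diff_def by (intro Bochner_Integration.integral_nonneg) simp

text \<open>\<open>w / C\<close> is written as a difference \<open>b - a\<close> of two probability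
  densities: adding \<open>\<bar>w\<bar>\<close> makes both nonnegative, and one constant brings
  both to mass 1 because \<open>w\<close> has mean zero. Weak compactness then applies to each in
  turn.\<close>

lemma torus_weak_limit_signed:
  fixes w :: "nat \<Rightarrow> real^'n \<Rightarrow> real"
  assumes l: "l > 0" and C: "C > 0" and w: "\<And>n. integrable (torus_measure l) (w n)"
    and w0: "\<And>n. (\<integral>x. w n x \<partial>torus_measure l) = 0"
    and wC: "\<And>n. (\<integral>x. \<bar>w n x\<bar> \<partial>torus_measure l) \<le> C"
  shows "\<exists>r \<alpha> \<beta>. strict_mono r \<and> prob_space \<alpha> \<and> prob_space \<beta> \<and>
    sets \<alpha> = sets (restrict_space borel (torus l)) \<and> sets \<beta> = sets (restrict_space borel (torus l)) \<and>
    (\<forall>\<phi>. periodic l \<phi> \<longrightarrow> continuous_on UNIV \<phi> \<longrightarrow>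
      (\<lambda>n. \<integral>x. \<phi> x * w (r n) x \<partial>torus_measure l) \<longlonglongrightarrow> C * ((\<integral>x. \<phi> x \<partial>\<beta>) - (\<integral>x. \<phi> x \<partial>\<alpha>)))"
proof -
  let ?T = "torus_measure l :: (real^'n) measure"
  let ?V = "l ^ CARD('n)"
  interpret T: finite_measure ?T by (rule finite_torus_measure[OF l])
  have V: "?V > 0" "measure ?T (space ?T) = ?V" using l by (auto simp: measure_torus)
  \<comment> \<open>The mass still missing from \<open>C\<close>, spread evenly over the
    torus.\<close>
  define c where "c n = (C - (\<integral>x. \<bar>w n x\<bar> \<partial>?T)) / ?V" for n
  have c0: "c n \<ge> 0" for n using wC[of n] V by (simp add: c_def)
  define a where "a n x = (\<bar>w n x\<bar> + c n) / C" for n x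
  define b where "b n x = (\<bar>w n x\<bar> + w n x + c n) / C" for n x
  have a0: "a n x \<ge> 0" and b0: "b n x \<ge> 0" for n x using c0[of n] C by (auto simp: a_def b_def)
  have [measurable]: "w n \<in> borel_measurable ?T" for n using w by auto
  have am[measurable]: "a n \<in> borel_measurable ?T" and bm[measurable]: "b n \<in> borel_measurable ?T" for n
    unfolding a_def b_def by measurable
  have ai: "integrable ?T (a n)" and bi: "integrable ?T (b n)" for n
    unfolding a_def b_def using w by auto
  have a1: "(\<integral>x. a n x \<partial>?T) = 1" and b1: "(\<integral>x. b n x \<partial>?T) = 1" for n
    unfolding a_def b_def using w w0 V C l by (simp_all add: c_def)
  have pr: "prob_space (density ?T (\<lambda>x. ennreal (h x)))"
    if "integrable ?T h" "\<And>x. h x \<ge> 0" "(\<integral>x. h x \<partial>?T) = 1" for h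
  proof
    have "emeasure (density ?T (\<lambda>x. ennreal (h x))) (space (density ?T (\<lambda>x. ennreal (h x)))) = (\<integral>\<^sup>+x. ennreal (h x) \<partial>?T)"
      using that(1) sets.top[of ?T] by (subst emeasure_density) (auto intro!: nn_integral_cong simp: indicator_def)
    also have "\<dots> = 1" using nn_integral_eq_integral[OF that(1)] that(2,3) by simp
    finally show "emeasure (density ?T (\<lambda>x. ennreal (h x))) (space (density ?T (\<lambda>x. ennreal (h x)))) = 1" .
  qed
  define N where "N h = density ?T (\<lambda>x. ennreal (h x))" for h :: "real^'n \<Rightarrow> real"
  have Nsp: "space (N h) = torus l" for h by (simp add: N_def)
  have Nm: "(\<lambda>x. x) \<in> measurable (N h) borel" for h
    unfolding N_def using torus_measure_borel by (simp cong: measurable_cong_sets)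
  obtain r1 \<alpha> where r1: "strict_mono r1" "prob_space \<alpha>" "sets \<alpha> = sets (restrict_space borel (torus l))"
    "\<And>\<phi> :: real^'n \<Rightarrow> real. periodic l \<phi> \<Longrightarrow> continuous_on UNIV \<phi> \<Longrightarrow> (\<lambda>n. \<integral>x. \<phi> x \<partial>N (a (r1 n))) \<longlonglongrightarrow> (\<integral>x. \<phi> x \<partial>\<alpha>)"
    using torus_measures_weakly_compact[of l "\<lambda>n. N (a n)", OF l pr[OF ai a0 a1, folded N_def] Nsp Nm] by blast
  obtain r2 \<beta> where r2: "strict_mono r2" "prob_space \<beta>" "sets \<beta> = sets (restrict_space borel (torus l))"
    "\<And>\<phi> :: real^'n \<Rightarrow> real. periodic l \<phi> \<Longrightarrow> continuous_on UNIV \<phi> \<Longrightarrow> (\<lambda>n. \<integral>x. \<phi> x \<partial>N (b (r1 (r2 n)))) \<longlonglongrightarrow> (\<integral>x. \<phi> x \<partial>\<beta>)"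
    using torus_measures_weakly_compact[of l "\<lambda>n. N (b (r1 n))", OF l pr[OF bi b0 b1, folded N_def] Nsp Nm] by blast
  show ?thesis
  proof (intro exI conjI allI impI)
    show "strict_mono (r1 \<circ> r2)" using r1(1) r2(1) by (rule strict_mono_o)
    fix \<phi> :: "real^'n \<Rightarrow> real" assume p: "periodic l \<phi>" and ct: "continuous_on UNIV \<phi>"
    obtain B where B: "\<And>x. norm (\<phi> x) \<le> B" using periodic_continuous_bounded[OF l p ct] by blast
    have \<phi>m[measurable]: "\<phi> \<in> borel_measurable ?T"
      using ct by (intro torus_measure_borel_fun borel_measurable_continuous_onI)
    have i\<phi>: "integrable ?T (\<lambda>x. \<phi> x * h x)" if "integrable ?T h" for h
    proof (rule Bochner_Integration.integrable_bound[where f = "\<lambda>x. B * \<bar>h x\<bar>"])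
      show "integrable ?T (\<lambda>x. B * \<bar>h x\<bar>)" using that by simp
      show "(\<lambda>x. \<phi> x * h x) \<in> borel_measurable ?T" using that by auto
      show "AE x in ?T. norm (\<phi> x * h x) \<le> norm (B * \<bar>h x\<bar>)"
      proof (rule AE_I2)
        fix x
        have "\<bar>\<phi> x\<bar> * \<bar>h x\<bar> \<le> \<bar>B\<bar> * \<bar>h x\<bar>" using B[of x] by (intro mult_right_mono) auto
        then show "norm (\<phi> x * h x) \<le> norm (B * \<bar>h x\<bar>)" by (simp add: abs_mult)
      qed
    qed
    have Nint: "(\<integral>x. \<phi> x \<partial>N h) = (\<integral>x. \<phi> x * h x \<partial>?T)" if "integrable ?T h" "\<And>x. h x \<ge> 0" for h
      unfolding N_def using that by (subst integral_density) (auto simp: mult.commute)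
    have eq: "(\<integral>x. \<phi> x * w n x \<partial>?T) = C * ((\<integral>x. \<phi> x \<partial>N (b n)) - (\<integral>x. \<phi> x \<partial>N (a n)))" for n
    proof -
      have "(\<integral>x. \<phi> x \<partial>N (b n)) - (\<integral>x. \<phi> x \<partial>N (a n)) = (\<integral>x. \<phi> x * b n x - \<phi> x * a n x \<partial>?T)"
        using i\<phi>[OF ai] i\<phi>[OF bi] by (simp add: Nint[OF ai a0] Nint[OF bi b0])
      also have "\<dots> = (\<integral>x. \<phi> x * w n x / C \<partial>?T)"
        by (intro Bochner_Integration.integral_cong) (auto simp: a_def b_def algebra_simps add_divide_distrib)
      finally show ?thesis using C by simp
    qed
    have "(\<lambda>n. \<integral>x. \<phi> x \<partial>N (a (r1 (r2 n)))) \<longlonglongrightarrow> (\<integral>x. \<phi> x \<partial>\<alpha>)"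
      using LIMSEQ_subseq_LIMSEQ[OF r1(4)[OF p ct] r2(1)] by (simp add: o_def)
    with r2(4)[OF p ct] have "(\<lambda>n. C * ((\<integral>x. \<phi> x \<partial>N (b (r1 (r2 n)))) - (\<integral>x. \<phi> x \<partial>N (a (r1 (r2 n)))))) \<longlonglongrightarrow>
        C * ((\<integral>x. \<phi> x \<partial>\<beta>) - (\<integral>x. \<phi> x \<partial>\<alpha>))"
      by (intro tendsto_intros)
    then show "(\<lambda>n. \<integral>x. \<phi> x * w ((r1 \<circ> r2) n) x \<partial>?T) \<longlonglongrightarrow> C * ((\<integral>x. \<phi> x \<partial>\<beta>) - (\<integral>x. \<phi> x \<partial>\<alpha>))"
      unfolding eq by (simp add: o_def)
  qed (use r1(2,3) r2(2,3) in auto)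
qed

text \<open>Component \<open>i\<close> of the gradient comes from the difference quotients along
  \<open>axis i 1\<close>, for which the steps \<open>1 / Suc n\<close> suffice. Their mean vanishes
  by translation invariance, and discrete integration by parts identifies the limit, as the quotient
  then falls on the test function.\<close>

lemma polar_gradient_exists:
  fixes u :: "real^'n \<Rightarrow> real"
  assumes l: "l > 0" and u: "binary_periodic l u" and C: "C > 0"
    and A: "\<And>i n. translation_diff l u ((1 / real (Suc n)) *\<^sub>R axis i 1) \<le> C / real (Suc n)"
  shows "\<exists>\<mu> \<sigma>. is_polar_gradient l u \<mu> \<sigma>"
proof -
  let ?T = "torus_measure l :: (real^'n) measure"
  let ?N = "restrict_space borel (torus l) :: (real^'n) measure"
  have mu: "u \<in> borel_measurable ?T" using u by (simp add: binary_periodic_def)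
  \<comment> \<open>Says that \<open>C * (\<beta> - \<alpha>)\<close> is the distributional
    derivative of \<open>u\<close> in direction \<open>i\<close>.\<close>
  define Q where "Q i \<alpha> \<beta> \<longleftrightarrow> prob_space \<alpha> \<and> prob_space \<beta> \<and> sets \<alpha> = sets ?N \<and> sets \<beta> = sets ?N \<and>
      (\<forall>\<phi> g. test_function l \<phi> g \<longrightarrow> - (\<integral>x. u x * g x $ i \<partial>?T) = C * ((\<integral>x. \<phi> x \<partial>\<beta>) - (\<integral>x. \<phi> x \<partial>\<alpha>)))"
    for i \<alpha> \<beta>
  have "\<exists>\<alpha> \<beta>. Q i \<alpha> \<beta>" for i
  proof -
    let ?e = "axis i 1 :: real^'n"
    define t where "t n = 1 / real (Suc n)" for n
    have t: "t n > 0" for n by (simp add: t_def)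
    define w where "w n x = (u (x + t n *\<^sub>R ?e) - u x) / t n" for n x
    have wi: "integrable ?T (w n)" for n
      unfolding w_def using translation_diff_measurable(2)[OF l u] by auto
    have w0: "(\<integral>x. w n x \<partial>?T) = 0" for n
      using integral_shift_test_function[OF l u test_function_const[of l 1], of "t n *\<^sub>R ?e"] by (simp add: w_def)
    have wC: "(\<integral>x. \<bar>w n x\<bar> \<partial>?T) \<le> C" for n
    proof -
      have "(\<integral>x. \<bar>w n x\<bar> \<partial>?T) = translation_diff l u (t n *\<^sub>R ?e) / t n"
        using t[of n] by (simp add: w_def translation_diff_def abs_divide)
      also have "\<dots> \<le> C"
      proof -
        have "translation_diff l u (t n *\<^sub>R ?e) \<le> C * t n" using A[where i = i and n = n] by (simp add: t_def)
        then show ?thesis using t[of n] by (simp add: divide_le_eq)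
      qed
      finally show ?thesis .
    qed
    obtain r \<alpha> \<beta> where r: "strict_mono r" "prob_space \<alpha>" "prob_space \<beta>" "sets \<alpha> = sets ?N" "sets \<beta> = sets ?N"
      "\<And>\<phi>. periodic l \<phi> \<Longrightarrow> continuous_on UNIV \<phi> \<Longrightarrow>
      (\<lambda>n. \<integral>x. \<phi> x * w (r n) x \<partial>?T) \<longlonglongrightarrow> C * ((\<integral>x. \<phi> x \<partial>\<beta>) - (\<integral>x. \<phi> x \<partial>\<alpha>))"
      using torus_weak_limit_signed[of l C w, OF l C wi w0 wC] by blast
    have "- (\<integral>x. u x * g x $ i \<partial>?T) = C * ((\<integral>x. \<phi> x \<partial>\<beta>) - (\<integral>x. \<phi> x \<partial>\<alpha>))" if T: "test_function l \<phi> g" for \<phi> g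
    proof -
      define k where "k s = (\<integral>x. u x * \<phi> (x + s *\<^sub>R (- ?e)) \<partial>?T)" for s
      have "(k has_real_derivative (\<integral>x. u x * (g (x + 0 *\<^sub>R (- ?e)) \<bullet> (- ?e)) \<partial>?T)) (at 0)"
        unfolding k_def by (rule integral_test_function_derivative[OF l u T])
      moreover have "(\<integral>x. u x * (g (x + 0 *\<^sub>R (- ?e)) \<bullet> (- ?e)) \<partial>?T) = - (\<integral>x. u x * g x $ i \<partial>?T)"
        by (simp add: inner_axis)
      ultimately have "((\<lambda>h. (k (0 + h) - k 0) / h) \<longlongrightarrow> - (\<integral>x. u x * g x $ i \<partial>?T)) (at 0)"
        by (simp add: DERIV_def)
      moreover have "filterlim (\<lambda>n. t (r n)) (at 0) sequentially"
      proof -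
        have "t \<longlonglongrightarrow> 0" unfolding t_def by (rule LIMSEQ_Suc[OF lim_1_over_n])
        then have "(\<lambda>n. t (r n)) \<longlonglongrightarrow> 0"
          using LIMSEQ_subseq_LIMSEQ[OF _ r(1), of t 0] by (simp add: o_def)
        then show ?thesis using t by (auto simp: filterlim_at less_imp_neq[symmetric])
      qed
      ultimately have "(\<lambda>n. (k (0 + t (r n)) - k 0) / t (r n)) \<longlonglongrightarrow> - (\<integral>x. u x * g x $ i \<partial>?T)"
        by (rule filterlim_compose)
      moreover have "(k (0 + t n) - k 0) / t n = (\<integral>x. \<phi> x * w n x \<partial>?T)" for n
        using integral_shift_test_function[OF l u T, of "t n *\<^sub>R ?e"] by (simp add: k_def w_def)
      ultimately have "(\<lambda>n. \<integral>x. \<phi> x * w (r n) x \<partial>?T) \<longlonglongrightarrow> - (\<integral>x. u x * g x $ i \<partial>?T)" by simp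
      moreover have "(\<lambda>n. \<integral>x. \<phi> x * w (r n) x \<partial>?T) \<longlonglongrightarrow> C * ((\<integral>x. \<phi> x \<partial>\<beta>) - (\<integral>x. \<phi> x \<partial>\<alpha>))"
        using T test_function_continuous[OF T] by (intro r(6)) (auto simp: test_function_def)
      ultimately show ?thesis by (rule LIMSEQ_unique)
    qed
    with r(2-5) have "Q i \<alpha> \<beta>" unfolding Q_def by blast
    then show ?thesis by blast
  qed
  then obtain \<alpha> \<beta> where Q: "\<And>i. Q i (\<alpha> i) (\<beta> i)" by metis
  have ab: "\<And>i. prob_space (\<alpha> i)" "\<And>i. prob_space (\<beta> i)" "\<And>i. sets (\<alpha> i) = sets ?N" "\<And>i. sets (\<beta> i) = sets ?N"
    "\<And>i \<phi> g. test_function l \<phi> g \<Longrightarrow> - (\<integral>x. u x * g x $ i \<partial>?T) = C * ((\<integral>x. \<phi> x \<partial>\<beta> i) - (\<integral>x. \<phi> x \<partial>\<alpha> i))"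
    using Q unfolding Q_def by blast+
  obtain \<mu> \<sigma> where P: "finite_measure \<mu>" "sets \<mu> = sets ?N" "\<sigma> \<in> borel_measurable \<mu>" "\<And>x. norm (\<sigma> x) = 1"
    "\<And>(\<phi> :: real^'n \<Rightarrow> real) B. \<phi> \<in> borel_measurable ?N \<Longrightarrow> (\<And>x. \<bar>\<phi> x\<bar> \<le> B) \<Longrightarrow>
      (\<integral>x. \<phi> x *\<^sub>R \<sigma> x \<partial>\<mu>) = (\<chi> i. C * ((\<integral>x. \<phi> x \<partial>\<beta> i) - (\<integral>x. \<phi> x \<partial>\<alpha> i)))"
    using polar_decomposition[of \<alpha> \<beta> ?N, OF prob_space.finite_measure[OF ab(1)] prob_space.finite_measure[OF ab(2)] ab(3,4), where C = C] by blast
  have main: "(\<integral>x. u x *\<^sub>R g x \<partial>?T) = - (\<integral>x. \<phi> x *\<^sub>R \<sigma> x \<partial>\<mu>)" if T: "test_function l \<phi> g" for \<phi> g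
  proof -
    obtain B where B: "\<And>x. norm (g x) \<le> B" "\<And>x. \<bar>\<phi> x\<bar> \<le> B" using test_function_bounds[OF l T] by metis
    have ig: "integrable ?T (\<lambda>x. u x *\<^sub>R g x)"
    proof (rule integrable_torus_bounded[OF l, of _ B])
      show "(\<lambda>x. u x *\<^sub>R g x) \<in> borel_measurable ?T"
        using mu torus_measure_borel_fun[OF test_function_gradient_borel[OF T]] by simp
      show "norm (u x *\<^sub>R g x) \<le> B" for x
        using mult_mono[OF binary_periodicD(6)[OF u, of x] B(1)[of x]] by simp
    qed
    have "\<phi> \<in> borel_measurable ?N" by (intro measurable_restrict_space1 test_function_borel[OF T])
    from P(5)[OF this B(2)] have "(\<integral>x. \<phi> x *\<^sub>R \<sigma> x \<partial>\<mu>) = (\<chi> i. - (\<integral>x. u x * g x $ i \<partial>?T))"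
      using ab(5)[OF T] by simp
    also have "\<dots> = - (\<integral>x. u x *\<^sub>R g x \<partial>?T)"
      using integral_bounded_linear[OF bounded_linear_vec_nth ig] by (simp add: vec_eq_iff)
    finally show ?thesis by simp
  qed
  have "is_polar_gradient l u \<mu> \<sigma>"
    unfolding is_polar_gradient_def set_integral_torus test_function_def[symmetric]
    by (intro conjI ballI allI impI P(1-4) main)
  then show ?thesis by blast
qed

subsection \<open>Radial integrals\<close>

text \<open>On [0,1] an antiderivative is minus the power \<open>n + 2\<close> of the root, divided
  by \<open>n + 2\<close>; the other half follows by reflection. The root is not differentiable at
  1, hence the version of the fundamental theorem that asks for derivatives in the interior
  only.\<close>

lemma nn_integral_abs_sqrt_power:
  "(\<integral>\<^sup>+y. indicator {-1..1} y * ennreal (\<bar>y\<bar> * sqrt (1 - y\<^sup>2) ^ n) \<partial>lborel) = ennreal (2 / (real n + 2))"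
proof -
  have half: "(\<integral>\<^sup>+y. ennreal (y * sqrt (1 - y\<^sup>2) ^ n) * indicator {0..1} y \<partial>lborel) = ennreal (1 / (real n + 2))"
  proof -
    have "((\<lambda>y. - (sqrt (1 - y\<^sup>2) ^ (n + 2)) / (real n + 2)) has_real_derivative y * sqrt (1 - y\<^sup>2) ^ n) (at y)"
      if "0 < y" "y < 1" for y :: real
    proof -
      have p: "1 - y\<^sup>2 > 0" using that by (simp add: abs_square_less_1)
      show ?thesis
        apply (rule derivative_eq_intros refl | use p in force)+
        using p apply (simp add: divide_simps)
        apply (simp add: algebra_simps) ?
        done
    qed
    then have "((\<lambda>y. y * sqrt (1 - y\<^sup>2) ^ n) has_integral
        (- (sqrt (1 - 1\<^sup>2) ^ (n + 2)) / (real n + 2)) - (- (sqrt (1 - 0\<^sup>2) ^ (n + 2)) / (real n + 2))) {0..1}"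
      by (intro fundamental_theorem_of_calculus_interior)
         (auto intro!: continuous_intros simp: has_real_derivative_iff_has_vector_derivative)
    then have "((\<lambda>y. y * sqrt (1 - y\<^sup>2) ^ n) has_integral 1 / (real n + 2)) {0..1}"
      by simp
    from nn_integral_has_integral_lebesgue[OF _ this]
    have "(\<integral>\<^sup>+x. ennreal (indicator {0..1} x * (x * sqrt (1 - x\<^sup>2) ^ n)) \<partial>lborel) = ennreal (1 / (real n + 2))"
      by (auto simp: abs_square_le_1)
    then show ?thesis
      by (subst (asm) nn_integral_cong[where v = "\<lambda>y. ennreal (y * sqrt (1 - y\<^sup>2) ^ n) * indicator {0..1} y"])
        (auto simp: indicator_def)
  qed
  have neg: "(\<integral>\<^sup>+y. ennreal (- y * sqrt (1 - y\<^sup>2) ^ n) * indicator {-1..0} y \<partial>lborel) = ennreal (1 / (real n + 2))"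
    unfolding half[symmetric]
    by (subst nn_integral_real_affine[of _ "-1" 0]) (auto simp: indicator_def intro!: nn_integral_cong)
  have "(\<integral>\<^sup>+y. indicator {-1..1} y * ennreal (\<bar>y\<bar> * sqrt (1 - y\<^sup>2) ^ n) \<partial>lborel)
    = (\<integral>\<^sup>+y. ennreal (y * sqrt (1 - y\<^sup>2) ^ n) * indicator {0..1} y
        + ennreal (- y * sqrt (1 - y\<^sup>2) ^ n) * indicator {-1..0} y \<partial>lborel)"
    by (intro nn_integral_cong) (auto simp: indicator_def abs_if)
  also have "\<dots> = ennreal (1 / (real n + 2)) + ennreal (1 / (real n + 2))"
    by (subst nn_integral_add) (use half neg in auto)
  also have "\<dots> = ennreal (2 / (real n + 2))"
    by (subst ennreal_plus[symmetric]) auto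
  finally show ?thesis .
qed

text \<open>The slice of the ball at height \<open>y\<close> along \<open>b\<close> is a ball of one
  dimension less, of squared radius \<open>1 - y * y\<close>; integrating its volume against
  \<open>\<bar>y\<bar>\<close> gives the constant. This is the origin of the unit ball volume in
  \<open>kernel_mass\<close>.\<close>

lemma nn_integral_cball_abs_inner_Basis:
  fixes b :: "'a::euclidean_space"
  assumes b: "b \<in> Basis"
  shows "(\<integral>\<^sup>+z. indicator (cball 0 1) z * ennreal \<bar>b \<bullet> z\<bar> \<partial>lborel)
    = ennreal (2 * unit_ball_vol (real DIM('a) - 1) / (real DIM('a) + 1))"
proof -
  let ?A = "Basis - {b}"
  let ?V = "\<lambda>f. \<Sum>b\<in>Basis. f b *\<^sub>R b :: 'a"
  have B: "Basis = insert b ?A" using b by auto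
  interpret product_sigma_finite "\<lambda>_. lborel"
    by standard
  have card: "card ?A = DIM('a) - 1" "real (DIM('a) - 1) = real DIM('a) - 1"
    using b by (auto simp: of_nat_diff Suc_leI)
  have inn: "b \<bullet> ?V f = f b" for f
    using b by (simp add: inner_sum_right inner_Basis if_distrib sum.delta cong: if_cong)
  have nrm: "norm (?V f) \<le> 1 \<longleftrightarrow> (\<Sum>i\<in>Basis. (f i)\<^sup>2) \<le> 1" for f
    using euclidean_dist_l2[of "0::'a" "?V f"] by (auto simp: L2_set_def)
  define h where "h f = indicator {f. (\<Sum>i\<in>Basis. (f i)\<^sup>2) \<le> 1} f * ennreal \<bar>f b\<bar>" for f :: "'a \<Rightarrow> real"
  have "h \<in> borel_measurable (Pi\<^sub>M Basis (\<lambda>_. lborel))"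
    unfolding h_def using b by measurable
  then have hm[measurable]: "h \<in> borel_measurable (Pi\<^sub>M (insert b ?A) (\<lambda>_. lborel))"
    by (subst B[symmetric])
  have "(\<integral>\<^sup>+z. indicator (cball 0 1) z * ennreal \<bar>b \<bullet> z\<bar> \<partial>lborel) =
      (\<integral>\<^sup>+z. indicator (cball 0 1) z * ennreal \<bar>b \<bullet> z\<bar> \<partial>distr (Pi\<^sub>M Basis (\<lambda>_. lborel)) borel ?V)"
    by (subst lborel_eq) simp
  also have "\<dots> = (\<integral>\<^sup>+f. indicator (cball 0 1) (?V f) * ennreal \<bar>b \<bullet> ?V f\<bar> \<partial>Pi\<^sub>M Basis (\<lambda>_. lborel))"
    by (subst nn_integral_distr) (measurable, auto)
  also have "\<dots> = (\<integral>\<^sup>+f. h f \<partial>Pi\<^sub>M Basis (\<lambda>_. lborel))"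
    unfolding h_def inn using nrm by (intro nn_integral_cong) (auto simp: indicator_def)
  also have "\<dots> = (\<integral>\<^sup>+y. \<integral>\<^sup>+x. h (x(b := y)) \<partial>Pi\<^sub>M ?A (\<lambda>_. lborel) \<partial>lborel)"
    by (subst B, subst product_nn_integral_insert_rev) (use hm in auto)
  also have "\<dots> = (\<integral>\<^sup>+y. \<integral>\<^sup>+x. indicator {-1..1} y * ennreal \<bar>y\<bar> * indicator ({f. sqrt ((\<Sum>i\<in>?A. (f i)\<^sup>2)) \<le>
               sqrt (1 - y\<^sup>2)} \<inter> space (Pi\<^sub>M ?A (\<lambda>_. lborel))) x \<partial>Pi\<^sub>M ?A (\<lambda>_. lborel) \<partial>lborel)"
  proof (intro nn_integral_cong)
    fix y :: real and x assume x: "x \<in> space (Pi\<^sub>M ?A (\<lambda>_. lborel :: real measure))"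
    have s: "(\<Sum>i\<in>Basis. ((x(b := y)) i)\<^sup>2) = y\<^sup>2 + (\<Sum>i\<in>?A. (x i)\<^sup>2)"
    proof -
      have "(\<Sum>i\<in>insert b ?A. ((x(b := y)) i)\<^sup>2) = y\<^sup>2 + (\<Sum>i\<in>?A. ((x(b := y)) i)\<^sup>2)"
        by (subst sum.insert) auto
      also have "(\<Sum>i\<in>?A. ((x(b := y)) i)\<^sup>2) = (\<Sum>i\<in>?A. (x i)\<^sup>2)"
        by (intro sum.cong) auto
      finally show ?thesis using B by metis
    qed
    have nn: "0 \<le> (\<Sum>i\<in>?A. (x i)\<^sup>2)" by (simp add: sum_nonneg)
    have "y\<^sup>2 + (\<Sum>i\<in>?A. (x i)\<^sup>2) \<le> 1 \<longleftrightarrow> y \<in> {-1..1} \<and> (\<Sum>i\<in>?A. (x i)\<^sup>2) \<le> 1 - y\<^sup>2"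
      using nn abs_square_le_1[of y] by auto
    then show "h (x(b := y)) = indicator {-1..1} y * ennreal \<bar>y\<bar> * indicator ({f. sqrt ((\<Sum>i\<in>?A. (f i)\<^sup>2)) \<le>
               sqrt (1 - y\<^sup>2)} \<inter> space (Pi\<^sub>M ?A (\<lambda>_. lborel))) x"
      using x unfolding h_def indicator_def mem_Collect_eq s by simp
  qed
  also have "\<dots> = (\<integral>\<^sup>+y. indicator {-1..1} y * ennreal \<bar>y\<bar> * emeasure (Pi\<^sub>M ?A (\<lambda>_. lborel))
       ({f. sqrt ((\<Sum>i\<in>?A. (f i)\<^sup>2)) \<le> sqrt (1 - y\<^sup>2)} \<inter> space (Pi\<^sub>M ?A (\<lambda>_. lborel))) \<partial>lborel)"
    by (intro nn_integral_cong, subst nn_integral_cmult) auto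
  also have "\<dots> = (\<integral>\<^sup>+y. indicator {-1..1} y * ennreal \<bar>y\<bar> *
      ennreal (unit_ball_vol (real DIM('a) - 1) * sqrt (1 - y\<^sup>2) ^ (DIM('a) - 1)) \<partial>lborel)"
  proof (intro nn_integral_cong_AE)
    \<comment> \<open>At the two poles the slice has radius 0, a case left out of the volume formula
      used below.\<close>
    have "AE y in lborel. y \<notin> {-1,1::real}"
      by (intro AE_not_in countable_imp_null_set_lborel) auto
    then show "AE y in lborel. indicator {-1..1} y * ennreal \<bar>y\<bar> * emeasure (Pi\<^sub>M ?A (\<lambda>_. lborel))
       ({f. sqrt ((\<Sum>i\<in>?A. (f i)\<^sup>2)) \<le> sqrt (1 - y\<^sup>2)} \<inter> space (Pi\<^sub>M ?A (\<lambda>_. lborel))) =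
       indicator {-1..1} y * ennreal \<bar>y\<bar> *
      ennreal (unit_ball_vol (real DIM('a) - 1) * sqrt (1 - y\<^sup>2) ^ (DIM('a) - 1))"
    proof eventually_elim
      case (elim y)
      show ?case
      proof (cases "y \<in> {-1..1}")
        case True
        with elim have "y\<^sup>2 < 1" by (auto simp: abs_square_less_1)
        then show ?thesis
          using emeasure_cball_aux[of ?A "sqrt (1 - y\<^sup>2)"] card by auto
      qed auto
    qed
  qed
  also have "\<dots> = (\<integral>\<^sup>+y. ennreal (unit_ball_vol (real DIM('a) - 1)) *
      (indicator {-1..1} y * ennreal (\<bar>y\<bar> * sqrt (1 - y\<^sup>2) ^ (DIM('a) - 1))) \<partial>lborel)"
  proof (intro nn_integral_cong)
    fix y :: real
    have "indicator {-1..1} y * ennreal \<bar>y\<bar> * ennreal (U * s) = ennreal U * (indicator {-1..1} y * ennreal (\<bar>y\<bar> * s))"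
      if "U \<ge> 0" for U s :: real
      using that by (auto simp: ennreal_mult'[symmetric] ennreal_mult''[symmetric] indicator_def mult_ac)
    moreover have "unit_ball_vol (real DIM('a) - 1) \<ge> 0"
      using card(2) by (metis of_nat_0_le_iff unit_ball_vol_nonneg)
    ultimately show "indicator {-1..1} y * ennreal \<bar>y\<bar> *
      ennreal (unit_ball_vol (real DIM('a) - 1) * sqrt (1 - y\<^sup>2) ^ (DIM('a) - 1)) =
      ennreal (unit_ball_vol (real DIM('a) - 1)) *
      (indicator {-1..1} y * ennreal (\<bar>y\<bar> * sqrt (1 - y\<^sup>2) ^ (DIM('a) - 1)))" by blast
  qed
  also have "\<dots> = ennreal (unit_ball_vol (real DIM('a) - 1)) * ennreal (2 / (real (DIM('a) - 1) + 2))"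
    by (subst nn_integral_cmult) (auto simp: nn_integral_abs_sqrt_power)
  also have "\<dots> = ennreal (2 * unit_ball_vol (real DIM('a) - 1) / (real DIM('a) + 1))"
    by (subst ennreal_mult'[symmetric]) (simp_all add: card(2) add.commute)
  finally show ?thesis .
qed

section \<open>Rotation invariance and integration in polar coordinates\<close>

lemma distr_lborel_plus: "distr lborel borel (\<lambda>x. c + x) = (lborel :: 'a::euclidean_space measure)"
  using lborel_affine[of 1 c] by (simp add: density_1)

lemma nn_integral_lborel_plus:
  fixes f :: "'a::euclidean_space \<Rightarrow> ennreal"
  assumes [measurable]: "f \<in> borel_measurable borel"
  shows "(\<integral>\<^sup>+x. f (c + x) \<partial>lborel) = (\<integral>\<^sup>+x. f x \<partial>lborel)"
  by (subst (2) distr_lborel_plus[symmetric, of c], subst nn_integral_distr) auto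

lemma nn_integral_lborel_uminus:
  fixes f :: "'a::euclidean_space \<Rightarrow> ennreal"
  assumes [measurable]: "f \<in> borel_measurable borel"
  shows "(\<integral>\<^sup>+x. f (- x) \<partial>lborel) = (\<integral>\<^sup>+x. f x \<partial>lborel)"
proof -
  have "distr lborel borel uminus = (lborel :: 'a measure)"
    using lborel_affine[of "-1" "0::'a"] by (simp add: density_1)
  then show ?thesis
    by (subst (2) \<open>_ = lborel\<close>[symmetric], subst nn_integral_distr) auto
qed

lemma sets_borel_cball [measurable]: "cball a r \<in> sets (borel :: 'a::metric_space measure)"
  by (intro borel_closed closed_cball)

text \<open>
  A \<open>\<sigma>\<close>-finite translation invariant Borel measure is proportional to \<open>lborel\<close>, here with the factor
  determined by the unit ball.
\<close>

lemma distr_lborel_orthogonal: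
  fixes f :: "'a::euclidean_space \<Rightarrow> 'a"
  assumes f: "orthogonal_transformation f"
  shows "distr lborel borel f = lborel"
proof -
  have lin: "linear f" and nf: "\<And>x. norm (f x) = norm x"
    using f by (auto simp: orthogonal_transformation_linear orthogonal_transformation_norm)
  have [measurable]: "f \<in> borel_measurable borel"
    using lin by (intro borel_measurable_continuous_onI linear_continuous_on)
      (simp add: linear_conv_bounded_linear)
  let ?\<nu> = "distr lborel borel f"
  let ?B = "cball 0 1 :: 'a set"
  have vB: "f -` ?B = ?B" using nf by auto
  have \<nu>B: "emeasure ?\<nu> ?B = emeasure lborel ?B"
    by (subst emeasure_distr) (auto simp: vB)
  have B: "emeasure lborel ?B \<noteq> 0" "emeasure lborel ?B \<noteq> \<infinity>"
    by (auto simp: emeasure_cball less_imp_neq[OF unit_ball_vol_pos, symmetric])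
  have "f -` cball 0 r = cball 0 r" for r using nf by auto
  then have fin: "emeasure ?\<nu> (cball 0 r) \<noteq> \<infinity>" for r
    using emeasure_lborel_cball_finite[of "0::'a" r] by (subst emeasure_distr) (auto simp: less_top[symmetric])
  interpret \<nu>: sigma_finite_measure ?\<nu>
    by standard (use fin in \<open>auto intro!: exI[of _ "range (\<lambda>n::nat. cball 0 (real n))"] simp: real_arch_simple\<close>)
  interpret P: pair_sigma_finite ?\<nu> lborel ..
  have inv: "(\<integral>\<^sup>+x. g (c + x) \<partial>?\<nu>) = (\<integral>\<^sup>+x. g x \<partial>?\<nu>)"
    if [measurable]: "g \<in> borel_measurable borel" for g :: "'a \<Rightarrow> ennreal" and c
  proof -
    \<comment> \<open>Since \<open>f\<close> is onto, a translation of the image measure is the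
      image of a translation of \<open>lborel\<close>.\<close>
    obtain c' where c': "c = f c'"
      using orthogonal_transformation_surj[OF f] by auto
    have "(\<integral>\<^sup>+x. g (c + x) \<partial>?\<nu>) = (\<integral>\<^sup>+x. g (f (c' + x)) \<partial>lborel)"
      by (subst nn_integral_distr) (auto simp: c' linear_add[OF lin])
    also have "\<dots> = (\<integral>\<^sup>+x. g (f x) \<partial>lborel)"
      by (rule nn_integral_lborel_plus[where f = "\<lambda>x. g (f x)"]) measurable
    finally show ?thesis by (subst (2) nn_integral_distr) auto
  qed
  have eq: "emeasure ?\<nu> A = emeasure lborel A" if [measurable]: "A \<in> sets borel" for A
  proof -
    \<comment> \<open>The double integral of \<open>indicator A x * indicator ?B (x + y)\<close> is
      computed in both orders: invariance of \<open>lborel\<close> in \<open>y\<close> gives this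
      product, invariance of \<open>?\<nu>\<close> under the shift by \<open>y\<close> gives the
      product with the two measures exchanged.\<close>
    have "emeasure ?\<nu> A * emeasure lborel ?B = (\<integral>\<^sup>+x. indicator A x * emeasure lborel ?B \<partial>?\<nu>)"
      by (subst nn_integral_multc) auto
    also have "\<dots> = (\<integral>\<^sup>+x. \<integral>\<^sup>+y. indicator A x * indicator ?B (x + y) \<partial>lborel \<partial>?\<nu>)"
    proof (intro nn_integral_cong)
      fix x
      have "(\<integral>\<^sup>+y. indicator ?B (x + y) \<partial>lborel) = emeasure lborel ?B"
        by (subst nn_integral_lborel_plus) (auto intro!: borel_measurable_indicator)
      then show "indicator A x * emeasure lborel ?B = (\<integral>\<^sup>+y. indicator A x * indicator ?B (x + y) \<partial>lborel)"
        by (subst nn_integral_cmult) measurable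
    qed
    also have "\<dots> = (\<integral>\<^sup>+y. \<integral>\<^sup>+x. indicator A x * indicator ?B (x + y) \<partial>?\<nu> \<partial>lborel)"
      by (rule P.Fubini'[symmetric]) measurable
    also have "\<dots> = (\<integral>\<^sup>+y. \<integral>\<^sup>+x. indicator A (x - y) * indicator ?B x \<partial>?\<nu> \<partial>lborel)"
    proof (rule nn_integral_cong)
      fix y show "(\<integral>\<^sup>+x. indicator A x * indicator ?B (x + y) \<partial>?\<nu>) = (\<integral>\<^sup>+x. indicator A (x - y) * indicator ?B x \<partial>?\<nu>)"
        using inv[of "\<lambda>x. indicator A (x - y) * indicator ?B x" y] by (simp add: add.commute)
    qed
    also have "\<dots> = (\<integral>\<^sup>+x. \<integral>\<^sup>+y. indicator A (x - y) * indicator ?B x \<partial>lborel \<partial>?\<nu>)"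
      by (rule P.Fubini') measurable
    also have "\<dots> = (\<integral>\<^sup>+x. emeasure lborel A * indicator ?B x \<partial>?\<nu>)"
    proof (intro nn_integral_cong)
      fix x
      have "(\<integral>\<^sup>+y. indicator A (x - y) \<partial>lborel) = (\<integral>\<^sup>+y. indicator A (x + y) \<partial>lborel)"
        using nn_integral_lborel_uminus[of "\<lambda>y. indicator A (x + y)"] by simp
      also have "\<dots> = emeasure lborel A"
        by (subst nn_integral_lborel_plus) auto
      finally show "(\<integral>\<^sup>+y. indicator A (x - y) * indicator ?B x \<partial>lborel) = emeasure lborel A * indicator ?B x"
        by (subst nn_integral_multc) auto
    qed
    also have "\<dots> = emeasure lborel A * emeasure ?\<nu> ?B"
      by (subst nn_integral_cmult) auto
    finally show ?thesis
      unfolding \<nu>B using B ennreal_mult_cancel_left[of "emeasure lborel ?B"] by (metis mult.commute infinity_ennreal_def)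
  qed
  show ?thesis
    by (rule measure_eqI) (auto simp: eq)
qed


lemma nn_integral_cball_homogeneous:
  fixes p :: "'a::euclidean_space \<Rightarrow> ennreal"
  assumes [measurable]: "p \<in> borel_measurable borel"
    and hom: "\<And>c z. c > 0 \<Longrightarrow> p (c *\<^sub>R z) = p z" and a: "a > 0"
  shows "(\<integral>\<^sup>+z. indicator (cball 0 a) z * p z \<partial>lborel)
    = ennreal (a ^ DIM('a)) * (\<integral>\<^sup>+z. indicator (cball 0 1) z * p z \<partial>lborel)"
proof -
  have L: "lborel = density (distr lborel borel (\<lambda>x::'a. 0 + a *\<^sub>R x)) (\<lambda>_. \<bar>a\<bar> ^ DIM('a))"
    using a by (intro lborel_affine) auto
  let ?D = "distr lborel borel (\<lambda>x::'a. 0 + a *\<^sub>R x)"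
  have "(\<integral>\<^sup>+z. indicator (cball 0 a) z * p z \<partial>lborel)
      = (\<integral>\<^sup>+z. indicator (cball 0 a) z * p z \<partial>density ?D (\<lambda>_. \<bar>a\<bar> ^ DIM('a)))"
    using L by (rule arg_cong)
  also have "\<dots> = (\<integral>\<^sup>+z. ennreal (\<bar>a\<bar> ^ DIM('a)) * (indicator (cball 0 a) z * p z) \<partial>?D)"
    by (rule nn_integral_density) (simp_all, measurable)
  also have "\<dots> = (\<integral>\<^sup>+z. ennreal (\<bar>a\<bar> ^ DIM('a)) * (indicator (cball 0 a) (0 + a *\<^sub>R z) * p (0 + a *\<^sub>R z)) \<partial>lborel)"
    by (rule nn_integral_distr) measurable
  also have "\<dots> = (\<integral>\<^sup>+z. ennreal (a ^ DIM('a)) * (indicator (cball 0 a) (a *\<^sub>R z) * p (a *\<^sub>R z)) \<partial>lborel)"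
    using a by simp
  also have "\<dots> = ennreal (a ^ DIM('a)) * (\<integral>\<^sup>+z. indicator (cball 0 a) (a *\<^sub>R z) * p (a *\<^sub>R z) \<partial>lborel)"
    by (subst nn_integral_cmult) auto
  also have "(\<integral>\<^sup>+z. indicator (cball 0 a) (a *\<^sub>R z) * p (a *\<^sub>R z) \<partial>lborel) = (\<integral>\<^sup>+z. indicator (cball 0 1) z * p z \<partial>lborel)"
    using a by (intro nn_integral_cong) (auto simp: hom indicator_def)
  finally show ?thesis .
qed

text \<open>Polar coordinates without a surface measure. With d the dimension, the image under the
  norm of the measure with density \<open>p\<close> and the measure with density
  \<open>d c r^(d-1)\<close> on the positive axis both give \<open>{..a}\<close> the mass
  \<open>c a^d\<close> for positive \<open>a\<close>, the former by homogeneity; half-lines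
  determine the measure.\<close>

lemma nn_integral_radial:
  fixes p :: "'a::euclidean_space \<Rightarrow> ennreal"
  assumes p[measurable]: "p \<in> borel_measurable borel" and hom: "\<And>c z. c > 0 \<Longrightarrow> p (c *\<^sub>R z) = p z"
    and c: "(\<integral>\<^sup>+z. indicator (cball 0 1) z * p z \<partial>lborel) = ennreal c" "c \<ge> 0"
    and f[measurable]: "f \<in> borel_measurable borel"
  shows "(\<integral>\<^sup>+z. f (norm z) * p z \<partial>lborel)
    = ennreal (real DIM('a) * c) * (\<integral>\<^sup>+r. indicator {0<..} r * (f r * ennreal (r ^ (DIM('a) - 1))) \<partial>lborel)"
proof -
  let ?M = "distr (density lborel p) borel norm"
  let ?g = "\<lambda>r. ennreal (real DIM('a) * c) * (indicator {0<..} r * ennreal (r ^ (DIM('a) - 1)))"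
  let ?N = "density lborel ?g"
  have M: "emeasure ?M {..a} = (if a > 0 then ennreal (c * a ^ DIM('a)) else 0)" for a
  proof -
    have v: "norm -` {..a} = cball (0::'a) a" by auto
    have "emeasure ?M {..a} = (\<integral>\<^sup>+z. indicator (cball 0 a) z * p z \<partial>lborel)"
      by (subst emeasure_distr) (auto simp: v emeasure_density mult.commute)
    also have "\<dots> = (if a > 0 then ennreal (c * a ^ DIM('a)) else 0)"
    proof (cases "a > 0")
      case True
      then show ?thesis
        using c by (subst nn_integral_cball_homogeneous[OF p hom]) (auto simp: ennreal_mult mult.commute)
    next
      case False
      have "AE z::'a in lborel. z \<noteq> 0" by (rule AE_lborel_singleton)
      then have "AE z::'a in lborel. indicator (cball 0 a) z * p z = 0"
      proof eventually_elim
        case (elim z)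
        then have "norm z > a" using False by (intro le_less_trans[of a 0]) auto
        then show ?case by (auto simp: indicator_def)
      qed
      then have "(\<integral>\<^sup>+z. indicator (cball 0 a) z * p z \<partial>lborel) = 0"
        by (subst nn_integral_0_iff_AE) measurable
      with False show ?thesis by simp
    qed
    finally show ?thesis .
  qed
  have N: "emeasure ?N {..a} = (if a > 0 then ennreal (c * a ^ DIM('a)) else 0)" for a
  proof -
    have "emeasure ?N {..a} = ennreal (real DIM('a) * c) * (\<integral>\<^sup>+r. ennreal (r ^ (DIM('a) - 1)) * indicator {0<..a} r \<partial>lborel)"
      by (subst emeasure_density, simp, simp, subst nn_integral_cmult[symmetric])
        (auto simp: indicator_def intro!: nn_integral_cong)
    also have "\<dots> = (if a > 0 then ennreal (c * a ^ DIM('a)) else 0)"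
    proof (cases "a > 0")
      case True
      have D: "DIM('a) = Suc (DIM('a) - 1)" using DIM_positive[where 'a='a] by simp
      have "(\<integral>\<^sup>+r. ennreal (r ^ (DIM('a) - 1)) * indicator {0<..a} r \<partial>lborel)
          = (\<integral>\<^sup>+r. ennreal (r ^ (DIM('a) - 1)) * indicator {0..a} r \<partial>lborel)"
        by (intro nn_integral_cong_AE, rule AE_mp[OF AE_lborel_singleton[of 0]]) (auto simp: indicator_def)
      also have "\<dots> = ennreal (a ^ DIM('a) / real DIM('a) - 0 ^ DIM('a) / real DIM('a))"
        using True D by (intro nn_integral_FTC_Icc) (auto intro!: derivative_eq_intros)
      finally show ?thesis
        using True c by (simp add: ennreal_mult'[symmetric] zero_power)
    qed (auto simp: indicator_def)
    finally show ?thesis .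
  qed
  have "?M = ?N"
  proof (rule measure_eqI_generator_eq[where E = "range atMost" and \<Omega> = UNIV and A = "\<lambda>n. {..real n}"])
    show "Int_stable (range atMost :: real set set)"
      by (auto simp: Int_stable_def)
    show "sets ?M = sigma_sets UNIV (range atMost)" "sets ?N = sigma_sets UNIV (range atMost)"
      by (auto simp: borel_eq_atMost)
    show "(\<Union>i. {..real i}) = UNIV" by (auto simp: real_arch_simple)
  qed (auto simp: M N[simplified])
  then have "(\<integral>\<^sup>+r. f r \<partial>?M) = (\<integral>\<^sup>+r. f r \<partial>?N)" by simp
  moreover have "(\<integral>\<^sup>+r. f r \<partial>?M) = (\<integral>\<^sup>+z. f (norm z) * p z \<partial>lborel)"
    by (subst nn_integral_distr) (auto simp: nn_integral_density mult.commute)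
  moreover have "(\<integral>\<^sup>+r. f r \<partial>?N) = ennreal (real DIM('a) * c) * (\<integral>\<^sup>+r. indicator {0<..} r * (f r * ennreal (r ^ (DIM('a) - 1))) \<partial>lborel)"
    by (subst nn_integral_density, simp, simp, subst nn_integral_cmult[symmetric])
      (auto simp: mult_ac intro!: nn_integral_cong)
  ultimately show ?thesis by simp
qed

lemma nn_integral_radial_one:
  assumes [measurable]: "f \<in> borel_measurable borel"
  shows "(\<integral>\<^sup>+z. f (norm (z::'a::euclidean_space)) \<partial>lborel)
    = ennreal (real DIM('a) * unit_ball_vol (real DIM('a))) *
      (\<integral>\<^sup>+r. indicator {0<..} r * (f r * ennreal (r ^ (DIM('a) - 1))) \<partial>lborel)"
  using nn_integral_radial[of "\<lambda>_::'a. 1" "unit_ball_vol (real DIM('a))" f] by (simp add: emeasure_cball)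

text \<open>A rotation carries \<open>\<omega>\<close> to a basis vector and preserves both the ball
  and the measure.\<close>

lemma nn_integral_cball_abs_inner:
  fixes \<omega> :: "real^'n"
  assumes \<omega>: "norm \<omega> = 1"
  shows "(\<integral>\<^sup>+z. indicator (cball 0 1) z * ennreal \<bar>\<omega> \<bullet> z\<bar> \<partial>lborel)
    = ennreal (2 * unit_ball_vol (real CARD('n) - 1) / (real CARD('n) + 1))"
proof -
  obtain b :: "real^'n" where b: "b \<in> Basis" using nonempty_Basis by blast
  obtain f where f: "orthogonal_transformation f" "f b = \<omega>"
    using orthogonal_transformation_exists[of b \<omega>] b \<omega> by auto
  have [measurable]: "f \<in> borel_measurable borel"
    using f(1) by (intro borel_measurable_continuous_onI linear_continuous_on)
      (simp add: linear_conv_bounded_linear[symmetric] orthogonal_transformation_linear)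
  have "(\<integral>\<^sup>+z. indicator (cball 0 1) z * ennreal \<bar>\<omega> \<bullet> z\<bar> \<partial>lborel)
      = (\<integral>\<^sup>+z. indicator (cball 0 1) z * ennreal \<bar>\<omega> \<bullet> z\<bar> \<partial>distr lborel borel f)"
    by (simp add: distr_lborel_orthogonal[OF f(1)])
  also have "\<dots> = (\<integral>\<^sup>+z. indicator (cball 0 1) (f z) * ennreal \<bar>\<omega> \<bullet> f z\<bar> \<partial>lborel)"
    by (rule nn_integral_distr) measurable
  also have "\<dots> = (\<integral>\<^sup>+z. indicator (cball 0 1) z * ennreal \<bar>b \<bullet> z\<bar> \<partial>lborel)"
    using f by (intro nn_integral_cong)
      (auto simp: indicator_def orthogonal_transformation_norm orthogonal_transformation_def)
  finally show ?thesis
    using nn_integral_cball_abs_inner_Basis[OF b] by simp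
qed

text \<open>The constant \<open>c\<close> of the homogeneous weight is found by testing the radial
  formula with \<open>f r = r\<close> on [0,1]. One side is then the first moment of the ball,
  \<open>2 unit_ball_vol (d - 1) / (d + 1)\<close>, the other is
  \<open>d c / (d + 1)\<close>.\<close>

lemma nn_integral_radial_abs_inner:
  fixes \<omega> :: "real^'n"
  assumes \<omega>: "norm \<omega> = 1" and [measurable]: "f \<in> borel_measurable borel"
  shows "(\<integral>\<^sup>+z. f (norm z) * ennreal \<bar>(z /\<^sub>R norm z) \<bullet> \<omega>\<bar> \<partial>lborel)
    = ennreal (2 * unit_ball_vol (real CARD('n) - 1)) *
      (\<integral>\<^sup>+r. indicator {0<..} r * (f r * ennreal (r ^ (CARD('n) - 1))) \<partial>lborel)"
proof -
  let ?p = "\<lambda>z::real^'n. ennreal \<bar>(z /\<^sub>R norm z) \<bullet> \<omega>\<bar>"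
  let ?I = "\<integral>\<^sup>+z. indicator (cball 0 1) z * ?p z \<partial>lborel"
  have le: "\<bar>(z /\<^sub>R norm z) \<bullet> \<omega>\<bar> \<le> 1" for z
    using Cauchy_Schwarz_ineq2[of "z /\<^sub>R norm z" \<omega>] \<omega> by (cases "z = 0") auto
  have "?I \<le> (\<integral>\<^sup>+z. indicator (cball 0 1) (z::real^'n) \<partial>lborel)"
    using le by (intro nn_integral_mono) (auto simp: indicator_def)
  also have "\<dots> < \<infinity>" by (simp add: emeasure_cball)
  finally obtain c where c: "?I = ennreal c" "c \<ge> 0"
    by (cases ?I) auto
  have hom: "?p (a *\<^sub>R z) = ?p z" if "a > 0" for a z
    using that by (simp add: field_simps)
  note R = nn_integral_radial[of ?p c, OF _ hom c, simplified DIM_cart DIM_real mult_1_right]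
  have D: "CARD('n) = Suc (CARD('n) - 1)" by simp
  have "ennreal (2 * unit_ball_vol (real CARD('n) - 1) / (real CARD('n) + 1))
      = (\<integral>\<^sup>+z. indicator (cball 0 1) z * ennreal \<bar>\<omega> \<bullet> z\<bar> \<partial>lborel)"
    using nn_integral_cball_abs_inner[OF \<omega>] by simp
  also have "\<dots> = (\<integral>\<^sup>+z. (indicator {0..1} (norm z) * ennreal (norm z)) * ?p z \<partial>lborel)"
  proof (intro nn_integral_cong)
    fix z :: "real^'n"
    show "indicator (cball 0 1) z * ennreal \<bar>\<omega> \<bullet> z\<bar> = (indicator {0..1} (norm z) * ennreal (norm z)) * ?p z"
      by (cases "z = 0") (auto simp: indicator_def ennreal_mult'[symmetric] abs_mult inner_commute)
  qed
  also have "\<dots> = ennreal (real CARD('n) * c) *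
      (\<integral>\<^sup>+r. indicator {0<..} r * (indicator {0..1} r * ennreal r * ennreal (r ^ (CARD('n) - 1))) \<partial>lborel)"
    by (subst R) auto
  also have "(\<integral>\<^sup>+r. indicator {0<..} r * (indicator {0..1} r * ennreal r * ennreal (r ^ (CARD('n) - 1))) \<partial>lborel)
      = (\<integral>\<^sup>+r. ennreal (r ^ CARD('n)) * indicator {0..1} r \<partial>lborel)"
    using D by (intro nn_integral_cong)
      (auto simp: indicator_def ennreal_mult'[symmetric] power_Suc[symmetric] simp del: power_Suc)
  also have "\<dots> = ennreal (1 ^ Suc CARD('n) / (real CARD('n) + 1) - 0 ^ Suc CARD('n) / (real CARD('n) + 1))"
  proof (intro nn_integral_FTC_Icc)
    fix r :: real
    show "((\<lambda>r. r ^ Suc CARD('n) / (real CARD('n) + 1)) has_real_derivative r ^ CARD('n)) (at r)"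
      by (rule derivative_eq_intros refl)+ (simp_all add: add.commute add_pos_nonneg less_imp_neq[symmetric])
  qed auto
  also have "\<dots> = ennreal (1 / (real CARD('n) + 1))" by simp
  also have "ennreal (real CARD('n) * c) * \<dots> = ennreal (real CARD('n) * c / (real CARD('n) + 1))"
    using c by (simp add: ennreal_mult'[symmetric])
  finally have "2 * unit_ball_vol (real CARD('n) - 1) / (real CARD('n) + 1) = real CARD('n) * c / (real CARD('n) + 1)"
    using c by (subst (asm) ennreal_inj) auto
  then have "2 * unit_ball_vol (real CARD('n) - 1) = real CARD('n) * c"
    by (simp add: field_simps)
  then show ?thesis by (subst R) auto
qed


section \<open>Measurability of radial profiles\<close>

lemma AE_norm_notin_null_set:
  assumes N: "N \<in> null_sets lborel"
  shows "AE z::'a::euclidean_space in lborel. norm z \<notin> N"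
proof -
  have [measurable]: "N \<in> sets borel" using N by auto
  have "AE r in lborel. r \<notin> N" using N by (rule AE_not_in)
  then have "AE r in lborel. indicator {0<..} r * (indicator N r * ennreal (r ^ (DIM('a) - 1))) = 0"
    by eventually_elim auto
  then have "(\<integral>\<^sup>+z. indicator N (norm (z::'a)) \<partial>lborel) = 0"
    by (subst nn_integral_radial_one) (auto simp: nn_integral_0_iff_AE)
  then have "AE z::'a in lborel. indicator N (norm z) = (0::ennreal)"
    by (subst (asm) nn_integral_0_iff_AE) auto
  then show ?thesis
    by eventually_elim (auto simp: indicator_def)
qed

text \<open>On the positive axis the radial weight \<open>r ^ (DIM('a) - 1)\<close> does not vanish,
  so a null preimage forces a null set of radii.\<close>

lemma null_set_of_norm_preimage:
  assumes [measurable]: "N \<in> sets borel" and N: "N \<subseteq> {0<..}"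
    and AE: "AE z::'a::euclidean_space in lborel. norm z \<notin> N"
  shows "N \<in> null_sets lborel"
proof -
  have "AE z::'a in lborel. indicator N (norm z) = (0::ennreal)"
    using AE by eventually_elim auto
  then have "(\<integral>\<^sup>+z. indicator N (norm (z::'a)) \<partial>lborel) = 0"
    by (subst nn_integral_0_iff_AE) auto
  then have "(\<integral>\<^sup>+r. indicator {0<..} r * (indicator N r * ennreal (r ^ (DIM('a) - 1))) \<partial>lborel) = 0"
    by (subst (asm) nn_integral_radial_one)
      (auto simp: ennreal_eq_0_iff mult_le_0_iff not_le[THEN iffD2, OF unit_ball_vol_pos[of "real DIM('a)"]])
  then have "AE r in lborel. indicator {0<..} r * (indicator N r * ennreal (r ^ (DIM('a) - 1))) = 0"
    by (subst (asm) nn_integral_0_iff_AE) auto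
  then have "AE r in lborel. r \<notin> N"
    by eventually_elim (use N in \<open>auto simp: indicator_def ennreal_eq_0_iff not_le[THEN iffD2, OF zero_less_power] split: if_splits\<close>)
  then show ?thesis
    using AE_iff_null_sets[of N lborel] by simp
qed

text \<open>
  Lebesgue measurable sets are \<open>\<sigma>\<close>-compact up to null sets, and the norm maps \<open>\<sigma>\<close>-compact sets to
  \<open>\<sigma>\<close>-compact sets.
\<close>

lemma radial_set_almost_borel:
  assumes "{z::'a::euclidean_space. norm z \<in> A} \<in> sets lebesgue"
  obtains B T where "B \<in> sets borel" "B \<subseteq> A" "negligible T" "{z::'a. norm z \<in> A - B} \<subseteq> T"
proof -
  obtain C T where CT: "fsigma C" "T \<in> null_sets lebesgue" "C \<union> T = {z::'a. norm z \<in> A}" "disjnt C T"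
    by (rule lebesgue_set_almost_fsigma[OF assms])
  obtain F :: "nat \<Rightarrow> 'a set" where F': "range F \<subseteq> Collect compact" "C = \<Union> (range F)"
    using CT(1) unfolding fsigma_Union_compact by blast
  then have F: "\<And>n. compact (F n)" by auto
  show thesis
  proof
    show "norm ` C \<in> sets borel"
      unfolding F'(2) image_UN
      by (intro sets.countable_UN) (simp_all add: image_subset_iff borel_compact compact_continuous_image continuous_on_norm_id F)
    show "norm ` C \<subseteq> A" using CT(3) by blast
    show "negligible T" using CT(2) by (simp add: negligible_iff_null_sets)
    show "{z. norm z \<in> A - norm ` C} \<subseteq> T" using CT(3) by blast
  qed
qed

text \<open>Inner approximations of \<open>A\<close> and of its complement leave a Borel set
  \<open>N\<close> of radii covered by neither. Its preimage is negligible, so \<open>N\<close> is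
  null, and by completeness every subset of \<open>N\<close> is measurable.\<close>

lemma radial_set_measurable:
  assumes A: "{z::'a::euclidean_space. norm z \<in> A} \<in> sets lebesgue"
  shows "A \<inter> {0<..} \<in> sets lebesgue"
proof -
  have "{z::'a. norm z \<in> - A} = - {z. norm z \<in> A}" by auto
  then have A': "{z::'a. norm z \<in> - A} \<in> sets lebesgue"
    using sets.compl_sets[OF A] by (simp add: Compl_eq_Diff_UNIV)
  obtain B T where B: "B \<in> sets borel" "B \<subseteq> A" "negligible T" "{z::'a. norm z \<in> A - B} \<subseteq> T"
    using radial_set_almost_borel[OF A] .
  obtain B' T' where B': "B' \<in> sets borel" "B' \<subseteq> - A" "negligible T'" "{z::'a. norm z \<in> - A - B'} \<subseteq> T'"
    using radial_set_almost_borel[OF A'] .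
  define N where "N = {0<..} - B - B'"
  have [measurable]: "N \<in> sets borel" using B(1) B'(1) unfolding N_def by (intro sets.Diff) auto
  have "{z::'a. norm z \<in> N} \<subseteq> T \<union> T'" using B B' by (auto simp: N_def)
  then have "negligible {z::'a. norm z \<in> N}"
    using B(3) B'(3) by (meson negligible_Un negligible_subset)
  then have "AE z::'a in lebesgue. norm z \<notin> N"
    by (intro AE_I[of _ _ "{z. norm z \<in> N}"]) (auto simp: negligible_iff_null_sets)
  then have "AE z::'a in lborel. norm z \<notin> N"
    by (subst (asm) AE_completion_iff) auto
  then have N: "N \<in> null_sets lborel"
    by (rule null_set_of_norm_preimage[rotated 2]) (measurable, auto simp: N_def)
  have "A \<inter> {0<..} = (B \<inter> {0<..}) \<union> (A \<inter> N)" using B B' by (auto simp: N_def)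
  moreover have "A \<inter> N \<in> sets lebesgue"
    using N null_sets_completion_subset[of "A \<inter> N" N lborel] null_sets_completionI by blast
  moreover have "B \<inter> {0<..} \<in> sets lebesgue" using B(1) by (intro sets.Int) auto
  ultimately show ?thesis by (metis sets.Un)
qed

text \<open>The kernels are measurable as functions of \<open>z\<close>, whereas the hypotheses of
  the theorem integrate over radii. Nothing is known about negative radii, hence the
  cut-off.\<close>

lemma radial_profile_measurable:
  fixes f :: "real \<Rightarrow> real"
  assumes f: "(\<lambda>z::'a::euclidean_space. f (norm z)) \<in> borel_measurable lebesgue"
  shows "(\<lambda>r. indicator {0<..} r * f r) \<in> borel_measurable lebesgue"
proof -
  have m: "{r. a < f r} \<inter> {0<..} \<in> sets lebesgue" for a
  proof (rule radial_set_measurable[where 'a = 'a])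
    have "{z::'a. a < f (norm z)} \<in> sets lebesgue"
      using f by (simp add: borel_measurable_iff_greater)
    then show "{z::'a. norm z \<in> {r. a < f r}} \<in> sets lebesgue" by simp
  qed
  have m0: "{..0::real} \<in> sets lebesgue" by (intro sets_completionI_sets) simp
  show ?thesis
    unfolding borel_measurable_iff_greater
  proof
    fix a
    have "{r \<in> space lebesgue. a < indicator {0<..} r * f r} =
        ({r. a < f r} \<inter> {0<..}) \<union> (if a < 0 then {..0} else {})"
      by (auto simp: indicator_def)
    then show "{r \<in> space lebesgue. a < indicator {0<..} r * f r} \<in> sets lebesgue"
      using m[of a] m0 by (simp add: sets.Un)
  qed
qed

text \<open>A Borel \<open>g\<close> stays measurable after composition with the norm. One choice
  serves both the integrals over radii and those over points, since null sets of radii have null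
  preimages.\<close>

lemma radial_borel_representative:
  fixes f :: "real \<Rightarrow> ennreal"
  assumes f: "(\<lambda>r. indicator {0<..} r * f r) \<in> borel_measurable lebesgue"
  obtains g where "g \<in> borel_measurable borel" "AE r in lborel. r > 0 \<longrightarrow> f r = g r"
    "AE z::'a::euclidean_space in lborel. f (norm z) = g (norm z)"
proof -
  obtain g where g: "g \<in> borel_measurable lborel" "AE r in lborel. indicator {0<..} r * f r = g r"
    using completion_ex_borel_measurable[OF f] by auto
  have 1: "AE r in lborel. r > 0 \<longrightarrow> f r = g r"
    using g(2) by eventually_elim auto
  then obtain N where N: "N \<in> null_sets lborel" "{r \<in> space lborel. \<not> (r > 0 \<longrightarrow> f r = g r)} \<subseteq> N"
    by (auto simp: eventually_ae_filter)
  have "AE z::'a in lborel. norm z \<notin> N" "AE z::'a in lborel. z \<noteq> 0"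
    using AE_norm_notin_null_set[OF N(1)] AE_lborel_singleton[of 0] by auto
  then have "AE z::'a in lborel. f (norm z) = g (norm z)"
  proof eventually_elim
    case (elim z)
    then have "norm z > 0" by simp
    show ?case
    proof (rule ccontr)
      assume "f (norm z) \<noteq> g (norm z)"
      with \<open>norm z > 0\<close> have "norm z \<in> N" by (intro subsetD[OF N(2)]) simp
      with elim show False by simp
    qed
  qed
  with g 1 show thesis by (intro that) auto
qed

subsection \<open>Compactness\<close>

lemma nn_integral_torus:
  "(\<integral>\<^sup>+x. f x \<partial>torus_measure l) = (\<integral>\<^sup>+x. f x * indicator (torus l) x \<partial>lborel)"
  unfolding torus_measure_def by (subst nn_integral_restrict_space) (auto simp: nn_integral_completion)

lemma AE_torus_iff: "(AE x in torus_measure l. P x) \<longleftrightarrow> (AE x in lborel. x \<in> torus l \<longrightarrow> P x)"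
  unfolding torus_measure_def by (subst AE_restrict_space_iff) (auto simp: AE_completion_iff)

lemma AE_lborel_translate:
  fixes z :: "'a::euclidean_space"
  assumes "AE x in lborel. P x" shows "AE x in lborel. P (x + z)"
proof -
  have "AE x in distr lborel borel (\<lambda>x. z + x). P x" unfolding distr_lborel_plus by (rule assms)
  then have "AE x in lborel. P (z + x)" by (rule AE_distrD[rotated]) simp
  then show ?thesis by (simp add: add.commute)
qed

text \<open>A Borel indicator in place of \<open>u\<close> makes the double integrals below
  accessible to Fubini.\<close>

lemma binary_periodic_borel_version:
  fixes u :: "real^'n \<Rightarrow> real"
  assumes u: "binary_periodic l u"
  obtains B where "B \<in> sets borel" "AE x in torus_measure l. u x = indicator B x"
proof -
  have [measurable]: "u \<in> borel_measurable (torus_measure l)"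
    using binary_periodicD(2)[OF u] .
  have "{x \<in> space (torus_measure l). u x = 1} \<in> sets (torus_measure l)"
    by measurable
  from torus_measure_almost_borel[OF this] obtain B where B: "B \<in> sets borel"
    "AE x in torus_measure l. x \<in> {x \<in> space (torus_measure l). u x = 1} \<longleftrightarrow> x \<in> B" by blast
  have "AE x in torus_measure l. u x = indicator B x"
    using B(2) AE_space
  proof eventually_elim
    case (elim x)
    then show ?case using binary_periodicD(3)[OF u, of x] by (auto simp: indicator_def)
  qed
  with B(1) show thesis by (rule that)
qed

section \<open>Grid cells and the L1 distance\<close>

definition cell :: "real \<Rightarrow> int^'n \<Rightarrow> (real^'n) set" where
  "cell s k = {y. \<forall>i. \<lfloor>y $ i / s\<rfloor> = k $ i}"

definition cell_index :: "real \<Rightarrow> real^'n \<Rightarrow> int^'n" where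
  "cell_index s x = (\<chi> i. \<lfloor>x $ i / s\<rfloor>)"

lemma in_cell_iff: "y \<in> cell s k \<longleftrightarrow> cell_index s y = k"
  by (simp add: cell_def cell_index_def vec_eq_iff)

lemma cell_eq:
  fixes k :: "int^'n"
  assumes "s > 0" shows "cell s k = {y. (- (s *\<^sub>R (\<chi> i. of_int (k $ i)))) + y \<in> torus s}"
proof -
  have "\<lfloor>y $ i / s\<rfloor> = k $ i \<longleftrightarrow> 0 \<le> - (s * of_int (k $ i)) + y $ i \<and> - (s * of_int (k $ i)) + y $ i < s" for y :: "real^'n" and i
    using assms by (auto simp: floor_eq_iff field_simps)
  then show ?thesis by (simp add: cell_def torus_def)
qed

lemma cell_borel [measurable]:
  assumes "s > 0" shows "cell s k \<in> sets borel"
proof -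
  have "(\<lambda>y. (- (s *\<^sub>R (\<chi> i. of_int (k $ i)))) + y) -` torus s \<inter> space borel \<in> sets borel"
    by (rule measurable_sets[where A = borel]) auto
  then show ?thesis by (simp add: cell_eq[OF assms] vimage_def)
qed

lemma emeasure_cell:
  assumes "s > 0" shows "emeasure lborel (cell s k :: (real^'n) set) = ennreal (s ^ CARD('n))"
proof -
  let ?c = "- (s *\<^sub>R (\<chi> i. of_int (k $ i))) :: real^'n"
  have "emeasure lborel (cell s k) = emeasure (distr lborel borel ((+) ?c)) (torus s)"
    by (subst emeasure_distr) (auto simp: cell_eq[OF assms] vimage_def)
  then show ?thesis using emeasure_torus[OF assms] by (simp only: distr_lborel_plus)
qed

text \<open>A side that divides \<open>l\<close> makes the grid fit: the indices of points of the
  torus run from 0 to \<open>N - 1\<close>, and every point with such indices is in the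
  torus.\<close>

lemma cell_subset_torus:
  assumes l: "l > 0" and N: "N > 0" and x: "x \<in> torus l" and s: "s = l / real N"
  shows "cell s (cell_index s x) \<subseteq> torus l"
proof
  fix y assume y: "y \<in> cell s (cell_index s x)"
  have s0: "s > 0" using l N s by simp
  have "0 \<le> y $ i \<and> y $ i < l" for i
  proof -
    have x: "0 \<le> x $ i" "x $ i < l" using x by (auto simp: torus_def)
    have eq: "\<lfloor>y $ i / s\<rfloor> = \<lfloor>x $ i / s\<rfloor>" using y by (simp add: cell_def cell_index_def)
    have "0 \<le> \<lfloor>x $ i / s\<rfloor>" using x s0 by simp
    then have "0 \<le> y $ i / s" unfolding eq[symmetric] by simp
    moreover have "x $ i / s < real N" using x s0 N unfolding s by (simp add: field_simps)
    then have "\<lfloor>x $ i / s\<rfloor> < int N" by (simp add: floor_less_iff)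
    then have "y $ i / s < real N" unfolding eq[symmetric] by (simp add: floor_less_iff)
    ultimately show ?thesis using s0 N l unfolding s by (auto simp: field_simps zero_le_mult_iff)
  qed
  then show "y \<in> torus l" by (simp add: torus_def)
qed

lemma same_cell_close:
  assumes s: "s > 0" and c: "cell_index s x = cell_index s y"
  shows "\<bar>y $ i - x $ i\<bar> \<le> s"
proof -
  have "\<lfloor>x $ i / s\<rfloor> = \<lfloor>y $ i / s\<rfloor>" using c by (simp add: cell_index_def vec_eq_iff)
  then have "\<bar>y $ i / s - x $ i / s\<bar> \<le> 1" by linarith
  then have "\<bar>y $ i - x $ i\<bar> / s \<le> 1" using s by (simp add: diff_divide_distrib[symmetric])
  then show ?thesis using s by (simp add: divide_le_eq)
qed

text \<open>
  Compare each point with the average over its cell of side \<open>s\<close>, and use Fubini: the difference of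
  two points of the same cell lies in \<open>[-s,s]^d\<close>.
\<close>

lemma cell_oscillation:
  fixes u :: "real^'n \<Rightarrow> real"
  assumes l: "l > 0" and u: "binary_periodic l u" and C: "C \<ge> 0" "\<And>z. translation_diff l u z \<le> C * norm z"
    and s: "s > 0" and B[measurable]: "B \<in> sets borel" and uB: "AE x in torus_measure l. u x = indicator B x"
  shows "(\<integral>\<^sup>+x. \<integral>\<^sup>+y. indicator (torus l) x * (indicator (torus l) y * (indicator (cell s (cell_index s x)) y *
      ennreal \<bar>indicator B x - indicator B y\<bar>)) \<partial>lborel \<partial>lborel)
    \<le> ennreal (C * (real CARD('n) * s) * (2 * s) ^ CARD('n))" (is "?S \<le> _")
proof -
  let ?W = "cbox (\<chi> i. - s) (\<chi> i. s) :: (real^'n) set"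
  let ?D = "\<lambda>x y. indicator (torus l) x * (indicator (torus l) y * ennreal \<bar>indicator B x - indicator B y\<bar>) :: ennreal"
  have "?S \<le> (\<integral>\<^sup>+x. \<integral>\<^sup>+y. indicator ?W (y - x) * ?D x y \<partial>lborel \<partial>lborel)"
  proof (rule nn_integral_mono, rule nn_integral_mono)
    fix x y :: "real^'n"
    have "y - x \<in> ?W" if "y \<in> cell s (cell_index s x)"
    proof -
      have "cell_index s x = cell_index s y" using that by (simp add: in_cell_iff)
      from same_cell_close[OF s this] have "\<bar>(y - x) $ i\<bar> \<le> s" for i by simp
      then have "- s \<le> (y - x) $ i \<and> (y - x) $ i \<le> s" for i by (simp only: abs_le_iff minus_le_iff)
      then show ?thesis by (simp add: mem_box_cart)
    qed
    then show "indicator (torus l) x * (indicator (torus l) y * (indicator (cell s (cell_index s x)) y *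
      ennreal \<bar>indicator B x - indicator B y\<bar>)) \<le> indicator ?W (y - x) * ?D x y"
      by (auto simp: indicator_def)
  qed
  also have "\<dots> = (\<integral>\<^sup>+x. \<integral>\<^sup>+z. indicator ?W z * ?D x (x + z) \<partial>lborel \<partial>lborel)"
  proof (rule nn_integral_cong)
    fix x :: "real^'n"
    show "(\<integral>\<^sup>+y. indicator ?W (y - x) * ?D x y \<partial>lborel) = (\<integral>\<^sup>+z. indicator ?W z * ?D x (x + z) \<partial>lborel)"
    proof -
      have m: "(\<lambda>y. indicator ?W (y - x) * ?D x y) \<in> borel_measurable borel" by measurable
      show ?thesis using nn_integral_lborel_plus[OF m, of x] by (simp only: add_diff_cancel_left')
    qed
  qed
  also have "\<dots> = (\<integral>\<^sup>+z. \<integral>\<^sup>+x. indicator ?W z * ?D x (x + z) \<partial>lborel \<partial>lborel)"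
    by (rule lborel_pair.Fubini') measurable
  also have "\<dots> \<le> (\<integral>\<^sup>+z. indicator ?W z * ennreal (C * (real CARD('n) * s)) \<partial>lborel)"
  proof (rule nn_integral_mono)
    fix z :: "real^'n"
    have "(\<integral>\<^sup>+x. indicator ?W z * ?D x (x + z) \<partial>lborel) = indicator ?W z * (\<integral>\<^sup>+x. ?D x (x + z) \<partial>lborel)"
      by (rule nn_integral_cmult) measurable
    also have "(\<integral>\<^sup>+x. ?D x (x + z) \<partial>lborel) \<le> (\<integral>\<^sup>+x. ennreal \<bar>u (x + z) - u x\<bar> * indicator (torus l) x \<partial>lborel)"
    proof (rule nn_integral_mono_AE)
      have 1: "AE x in lborel. x \<in> torus l \<longrightarrow> u x = indicator B x" using uB by (simp add: AE_torus_iff)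
      show "AE x in lborel. ?D x (x + z) \<le> ennreal \<bar>u (x + z) - u x\<bar> * indicator (torus l) x"
        using 1 AE_lborel_translate[OF 1, of z]
        by eventually_elim (auto simp: indicator_def abs_minus_commute)
    qed
    also have "\<dots> = ennreal (translation_diff l u z)"
      unfolding nn_integral_torus[symmetric] translation_diff_def
      by (rule nn_integral_eq_integral[OF translation_diff_measurable(3)[OF l u]]) simp
    also have "indicator ?W z * \<dots> \<le> indicator ?W z * ennreal (C * (real CARD('n) * s))"
    proof (cases "z \<in> ?W")
      case True
      then have "\<bar>z $ i\<bar> \<le> s" for i unfolding mem_box_cart abs_le_iff by (auto simp: minus_le_iff)
      then have "(\<Sum>i\<in>UNIV. \<bar>z $ i\<bar>) \<le> (\<Sum>i\<in>(UNIV::'n set). s)" by (intro sum_mono) auto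
      \<comment> \<open>The crude bound by the l1 norm is enough, as the constant only has to be
        independent of \<open>u\<close>.\<close>
      then have "norm z \<le> real CARD('n) * s" using norm_le_l1_cart[of z] by simp
      then have "C * norm z \<le> C * (real CARD('n) * s)" using C(1) by (rule mult_left_mono)
      then show ?thesis using True C(2)[of z] by (auto intro!: ennreal_leI)
    qed simp
    finally show "(\<integral>\<^sup>+x. indicator ?W z * ?D x (x + z) \<partial>lborel) \<le> indicator ?W z * ennreal (C * (real CARD('n) * s))"
      by (simp add: mult_left_mono)
  qed
  also have "\<dots> = emeasure lborel ?W * ennreal (C * (real CARD('n) * s))"
    by (subst nn_integral_multc) auto
  also have "emeasure lborel ?W = ennreal ((2 * s) ^ CARD('n))"
  proof -
    have "(\<Prod>b\<in>Basis. ((\<chi> i. s) - (\<chi> i. - s)) \<bullet> (b :: real^'n)) = (\<Prod>b\<in>(Basis :: (real^'n) set). 2 * s)"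
      by (rule prod.cong) (auto simp: Basis_vec_def inner_axis)
    moreover have "emeasure lborel ?W = ennreal (\<Prod>b\<in>Basis. ((\<chi> i. s) - (\<chi> i. - s)) \<bullet> (b :: real^'n))"
      using s by (intro emeasure_lborel_cbox) (auto simp: Basis_vec_def inner_axis)
    ultimately show ?thesis by simp
  qed
  finally show ?thesis using C(1) s by (simp add: ennreal_mult'[symmetric] mult_ac)
qed

text \<open>For the indicators, B(x) - B'(x) = (B(x) - B(y)) - (B'(x) - B'(y)) + (B(y) - B'(y)).
  Integration over \<open>y\<close> in the cell leaves two oscillations and a difference of cell
  integrals.\<close>

lemma cell_pointwise:
  fixes x :: "real^'n"
  assumes s: "s > 0" and [measurable]: "B \<in> sets borel" "B' \<in> sets borel" and Q: "Q = cell s (cell_index s x)"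
    and \<delta>: "\<bar>LINT y|restrict_space lborel Q. indicator B y - indicator B' y\<bar> \<le> \<delta>"
  shows "ennreal (s ^ CARD('n)) * ennreal \<bar>indicator B x - indicator B' x\<bar>
    \<le> (\<integral>\<^sup>+y. indicator Q y * ennreal \<bar>indicator B x - indicator B y\<bar> \<partial>lborel)
      + (\<integral>\<^sup>+y. indicator Q y * ennreal \<bar>indicator B' x - indicator B' y\<bar> \<partial>lborel) + ennreal \<delta>"
proof -
  let ?M = "restrict_space lborel Q"
  have Qm: "Q \<in> sets borel" using s unfolding Q by (rule cell_borel)
  have eQ: "emeasure lborel Q = ennreal (s ^ CARD('n))" unfolding Q by (rule emeasure_cell[OF s])
  interpret M: finite_measure ?M
    by standard (use Qm eQ in \<open>simp add: emeasure_restrict_space[of Q lborel Q] space_restrict_space\<close>)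
  have mM: "measure ?M (space ?M) = s ^ CARD('n)"
    using Qm eQ s by (simp add: measure_def emeasure_restrict_space[of Q lborel Q] space_restrict_space)
  have int: "integrable ?M (\<lambda>y. c - indicator A y :: real)" "integrable ?M (\<lambda>y. \<bar>c - indicator A y\<bar> :: real)"
    "integrable ?M (indicator A :: _ \<Rightarrow> real)"
    if "A \<in> sets borel" for A c
  proof -
    have m: "(indicator A :: _ \<Rightarrow> real) \<in> borel_measurable ?M"
      using that by (intro measurable_restrict_space1) simp
    show "integrable ?M (indicator A :: _ \<Rightarrow> real)"
      using m by (intro M.integrable_const_bound[of _ 1]) auto
    then show "integrable ?M (\<lambda>y. c - indicator A y :: real)" by simp
    then show "integrable ?M (\<lambda>y. \<bar>c - indicator A y\<bar> :: real)" by simp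
  qed
  have nn: "(\<integral>\<^sup>+y. indicator Q y * ennreal \<bar>c - indicator A y\<bar> \<partial>lborel) = ennreal (LINT y|?M. \<bar>c - indicator A y\<bar>)"
    if "A \<in> sets borel" for A c
  proof -
    have "(\<integral>\<^sup>+y. indicator Q y * ennreal \<bar>c - indicator A y\<bar> \<partial>lborel) = (\<integral>\<^sup>+y. ennreal \<bar>c - indicator A y\<bar> \<partial>?M)"
      using Qm by (subst nn_integral_restrict_space) (auto simp: mult.commute)
    also have "\<dots> = ennreal (LINT y|?M. \<bar>c - indicator A y\<bar>)"
      using int(2)[OF that] by (intro nn_integral_eq_integral) auto
    finally show ?thesis .
  qed
  let ?b = "indicator B x :: real" and ?b' = "indicator B' x :: real"
  have "s ^ CARD('n) * (?b - ?b') = (LINT y|?M. ?b - ?b')"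
    by (subst lebesgue_integral_const) (simp only: mM real_scaleR_def)
  also have "\<dots> = (LINT y|?M. (?b - indicator B y) - (?b' - indicator B' y) + (indicator B y - indicator B' y))"
    by (intro Bochner_Integration.integral_cong) auto
  also have "\<dots> = (LINT y|?M. ?b - indicator B y) - (LINT y|?M. ?b' - indicator B' y) + (LINT y|?M. indicator B y - indicator B' y)"
    using int[OF assms(2)] int[OF assms(3)] by (simp add: right_diff_distrib)
  finally have "\<bar>s ^ CARD('n) * (?b - ?b')\<bar> \<le> \<bar>LINT y|?M. ?b - indicator B y\<bar> + \<bar>LINT y|?M. ?b' - indicator B' y\<bar> + \<delta>"
    using \<delta> by linarith
  also have "\<bar>LINT y|?M. ?b - indicator B y\<bar> \<le> (LINT y|?M. \<bar>?b - indicator B y\<bar>)" by (rule integral_abs_bound)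
  also have "\<bar>LINT y|?M. ?b' - indicator B' y\<bar> \<le> (LINT y|?M. \<bar>?b' - indicator B' y\<bar>)" by (rule integral_abs_bound)
  finally have "s ^ CARD('n) * \<bar>?b - ?b'\<bar> \<le> (LINT y|?M. \<bar>?b - indicator B y\<bar>) + (LINT y|?M. \<bar>?b' - indicator B' y\<bar>) + \<delta>"
    using s by (simp add: abs_mult)
  then have "ennreal (s ^ CARD('n) * \<bar>?b - ?b'\<bar>) \<le> ennreal ((LINT y|?M. \<bar>?b - indicator B y\<bar>) + (LINT y|?M. \<bar>?b' - indicator B' y\<bar>) + \<delta>)"
    by (rule ennreal_leI)
  also have "\<dots> = ennreal (LINT y|?M. \<bar>?b - indicator B y\<bar>) + ennreal (LINT y|?M. \<bar>?b' - indicator B' y\<bar>) + ennreal \<delta>"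
    using \<delta> by (simp add: ennreal_plus Bochner_Integration.integral_nonneg)
  finally show ?thesis
    unfolding nn[OF assms(2)] nn[OF assms(3)] using s by (simp add: ennreal_mult')
qed

text \<open>Integrating \<open>cell_pointwise\<close> over the torus gives two oscillation terms of
  order \<open>s ^ (d + 1)\<close> and the term \<open>\<delta> * l ^ d\<close>; division by
  \<open>s ^ d\<close> leaves a factor \<open>s\<close> on the former. So functions with a common
  \<open>C\<close> are close in L1 once their cell integrals are close on a fine grid.\<close>

lemma torus_L1_cell_bound:
  fixes u v :: "real^'n \<Rightarrow> real"
  assumes l: "l > 0" and u: "binary_periodic l u" and v: "binary_periodic l v" and C: "C \<ge> 0"
    and uC: "\<And>z. translation_diff l u z \<le> C * norm z" and vC: "\<And>z. translation_diff l v z \<le> C * norm z"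
    and N: "N > 0" and s: "s = l / real N"
    and \<delta>: "\<delta> \<ge> 0" "\<And>k. \<bar>\<integral>x. indicator (cell s k) x * u x \<partial>torus_measure l - \<integral>x. indicator (cell s k) x * v x \<partial>torus_measure l\<bar> \<le> \<delta>"
  shows "(\<integral>x. \<bar>u x - v x\<bar> \<partial>torus_measure l) \<le> 2 * C * real CARD('n) * 2 ^ CARD('n) * s + \<delta> * l ^ CARD('n) / s ^ CARD('n)"
proof -
  let ?T = "torus_measure l :: (real^'n) measure"
  have s0: "s > 0" using s l N by simp
  obtain B where B[measurable]: "B \<in> sets borel" and uB: "AE x in ?T. u x = indicator B x"
    using binary_periodic_borel_version[OF u] by blast
  obtain B' where B'[measurable]: "B' \<in> sets borel" and vB: "AE x in ?T. v x = indicator B' x"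
    using binary_periodic_borel_version[OF v] by blast
  have mu[measurable]: "u \<in> borel_measurable ?T" "v \<in> borel_measurable ?T" using binary_periodicD(2) u v by auto
  let ?Q = "\<lambda>x. cell s (cell_index s x) :: (real^'n) set"
  let ?I = "\<lambda>B x. \<integral>\<^sup>+y. indicator (torus l) x * (indicator (torus l) y * (indicator (?Q x) y * ennreal \<bar>indicator B x - indicator B y\<bar>)) \<partial>lborel"
  have pt: "ennreal (s ^ CARD('n)) * (ennreal \<bar>indicator B x - indicator B' x\<bar> * indicator (torus l) x)
      \<le> ?I B x + ?I B' x + ennreal \<delta> * indicator (torus l) x" for x
  proof (cases "x \<in> torus l")
    case True
    have sub: "?Q x \<subseteq> torus l" by (rule cell_subset_torus[OF l N True s])
    have I: "?I B x = (\<integral>\<^sup>+y. indicator (?Q x) y * ennreal \<bar>indicator B x - indicator B y\<bar> \<partial>lborel)" for B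
      using sub True by (intro nn_integral_cong) (auto simp: indicator_def)
    have Qm: "?Q x \<in> sets borel" by (rule cell_borel[OF s0])
    have "(LINT y|restrict_space lborel (?Q x). indicat_real B y - indicat_real B' y) = (\<integral>y. indicat_real (?Q x) y * (indicat_real B y - indicat_real B' y) \<partial>lborel)"
      using Qm by (subst integral_restrict_space) auto
    also have "\<dots> = (\<integral>y. indicator (torus l) y *\<^sub>R (indicat_real (?Q x) y * (indicat_real B y - indicat_real B' y)) \<partial>lborel)"
      using sub by (intro Bochner_Integration.integral_cong) (auto simp: indicator_def)
    also have "\<dots> = (\<integral>y. indicator (torus l) y *\<^sub>R (indicat_real (?Q x) y * (indicat_real B y - indicat_real B' y)) \<partial>lebesgue)"
      using Qm by (intro integral_completion[symmetric] borel_measurable_scaleR borel_measurable_times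
          borel_measurable_diff borel_measurable_indicator) simp_all
    also have "\<dots> = (\<integral>y. indicat_real (?Q x) y * (indicat_real B y - indicat_real B' y) \<partial>?T)"
      unfolding torus_measure_def by (subst integral_restrict_space) auto
    also have "\<dots> = (\<integral>y. indicat_real (?Q x) y * (u y - v y) \<partial>?T)"
    proof (rule integral_cong_AE)
      have Qt: "(indicator (?Q x) :: _ \<Rightarrow> real) \<in> borel_measurable ?T"
        "(indicator B :: _ \<Rightarrow> real) \<in> borel_measurable ?T" "(indicator B' :: _ \<Rightarrow> real) \<in> borel_measurable ?T"
        using Qm by (auto intro!: torus_measure_borel_fun)
      then show "(\<lambda>y. indicat_real (?Q x) y * (indicat_real B y - indicat_real B' y) :: real) \<in> borel_measurable ?T"
        "(\<lambda>y. indicat_real (?Q x) y * (u y - v y)) \<in> borel_measurable ?T" by measurable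
      show "AE y in ?T. indicat_real (?Q x) y * (indicat_real B y - indicat_real B' y) = indicat_real (?Q x) y * (u y - v y)"
        using uB vB by eventually_elim simp
    qed
    also have "\<dots> = (\<integral>y. indicat_real (?Q x) y * u y \<partial>?T) - (\<integral>y. indicat_real (?Q x) y * v y \<partial>?T)"
    proof -
      have "integrable ?T (\<lambda>y. indicat_real (?Q x) y * w y)" if w: "binary_periodic l w" for w
      proof (rule integrable_torus_bounded[OF l, of _ 1])
        show "(\<lambda>y. indicat_real (?Q x) y * w y) \<in> borel_measurable ?T"
          using Qm by (intro borel_measurable_times binary_periodicD(2)[OF w] torus_measure_borel_fun) simp
        show "norm (indicat_real (?Q x) y * w y) \<le> 1" for y
          using binary_periodicD(6)[OF w] by (simp add: indicator_def)
      qed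
      from this[OF u] this[OF v] show ?thesis by (simp add: right_diff_distrib)
    qed
    finally have "\<bar>LINT y|restrict_space lborel (?Q x). indicat_real B y - indicat_real B' y\<bar> \<le> \<delta>" using \<delta>(2) by simp
    from cell_pointwise[OF s0 B B' refl this] show ?thesis
      unfolding I using True by simp
  qed simp
  \<comment> \<open>The cell moves with \<open>x\<close>, so joint measurability is at stake:
    membership is the equality of finitely many floors, taken as reals so that equality of Borel
    functions applies.\<close>
  have Im[measurable]: "?I A \<in> borel_measurable lborel" if [measurable]: "A \<in> sets borel" for A
  proof -
    let ?P = "\<lambda>p :: (real^'n) \<times> (real^'n). \<forall>i. real_of_int \<lfloor>snd p $ i / s\<rfloor> = real_of_int \<lfloor>fst p $ i / s\<rfloor>"
    have [measurable]: "(\<lambda>p :: (real^'n) \<times> (real^'n). fst p $ i) \<in> borel_measurable (borel \<Otimes>\<^sub>M borel)"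
      "(\<lambda>p :: (real^'n) \<times> (real^'n). snd p $ i) \<in> borel_measurable (borel \<Otimes>\<^sub>M borel)" for i
      unfolding borel_prod by (intro borel_measurable_continuous_onI continuous_intros)+
    have [measurable]: "Measurable.pred (borel \<Otimes>\<^sub>M borel) (\<lambda>p :: (real^'n) \<times> (real^'n).
        real_of_int \<lfloor>snd p $ i / s\<rfloor> = real_of_int \<lfloor>fst p $ i / s\<rfloor>)" for i
      unfolding pred_def by (rule borel_measurable_eq) measurable
    have [measurable]: "Measurable.pred (borel \<Otimes>\<^sub>M borel) ?P" by measurable
    have e: "indicator (?Q x) y = (if ?P (x, y) then 1 else 0 :: ennreal)" for x y :: "real^'n"
      by (simp add: cell_def cell_index_def indicator_def)
    have "(\<lambda>p. indicator (torus l) (fst p) * (indicator (torus l) (snd p) * ((if ?P p then 1 else 0) *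
        ennreal \<bar>indicat_real A (fst p) - indicat_real A (snd p)\<bar>))) \<in> borel_measurable (borel \<Otimes>\<^sub>M borel)"
      by measurable
    then have "(\<lambda>x. \<integral>\<^sup>+y. (\<lambda>p. indicator (torus l) (fst p) * (indicator (torus l) (snd p) * ((if ?P p then 1 else 0) *
        ennreal \<bar>indicat_real A (fst p) - indicat_real A (snd p)\<bar>))) (x, y) \<partial>lborel) \<in> borel_measurable borel"
      by (intro lborel.borel_measurable_nn_integral_fst) (simp cong: measurable_cong_sets)
    then show ?thesis unfolding e by simp
  qed
  have L: "(\<integral>\<^sup>+x. ennreal \<bar>u x - v x\<bar> \<partial>?T) = (\<integral>\<^sup>+x. ennreal \<bar>indicator B x - indicator B' x\<bar> * indicator (torus l) x \<partial>lborel)"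
    unfolding nn_integral_torus
  proof (rule nn_integral_cong_AE)
    show "AE x in lborel. ennreal \<bar>u x - v x\<bar> * indicator (torus l) x = ennreal \<bar>indicator B x - indicator B' x\<bar> * indicator (torus l) x"
      using uB vB unfolding AE_torus_iff by eventually_elim (auto simp: indicator_def)
  qed
  let ?K = "C * (real CARD('n) * s) * (2 * s) ^ CARD('n)"
  have "ennreal (s ^ CARD('n)) * (\<integral>\<^sup>+x. ennreal \<bar>u x - v x\<bar> \<partial>?T)
      = (\<integral>\<^sup>+x. ennreal (s ^ CARD('n)) * (ennreal \<bar>indicator B x - indicator B' x\<bar> * indicator (torus l) x) \<partial>lborel)"
    unfolding L by (subst nn_integral_cmult) auto
  also have "\<dots> \<le> (\<integral>\<^sup>+x. ?I B x + ?I B' x + ennreal \<delta> * indicator (torus l) x \<partial>lborel)"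
    by (intro nn_integral_mono pt)
  also have "\<dots> = (\<integral>\<^sup>+x. ?I B x \<partial>lborel) + (\<integral>\<^sup>+x. ?I B' x \<partial>lborel) + ennreal \<delta> * emeasure lborel (torus l :: (real^'n) set)"
    using Im[OF B] Im[OF B'] by (subst nn_integral_add, simp, simp, subst nn_integral_add) (auto simp: nn_integral_cmult)
  also have "\<dots> \<le> ennreal ?K + ennreal ?K + ennreal \<delta> * ennreal (l ^ CARD('n))"
    using cell_oscillation[OF l u C uC s0 B uB] cell_oscillation[OF l v C vC s0 B' vB] emeasure_torus[OF l, where 'n = 'n]
    by (intro add_mono) auto
  also have "\<dots> = ennreal (2 * ?K + \<delta> * l ^ CARD('n))"
    using C s0 \<delta>(1) l by (simp add: ennreal_mult'[symmetric] ennreal_plus[symmetric] del: ennreal_plus)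
  finally have "ennreal (s ^ CARD('n)) * (\<integral>\<^sup>+x. ennreal \<bar>u x - v x\<bar> \<partial>?T) \<le> ennreal (2 * ?K + \<delta> * l ^ CARD('n))" .
  moreover have "(\<integral>\<^sup>+x. ennreal \<bar>u x - v x\<bar> \<partial>?T) = ennreal (\<integral>x. \<bar>u x - v x\<bar> \<partial>?T)"
  proof (rule nn_integral_eq_integral)
    have "\<bar>u x - v x\<bar> \<le> 1" for x
      using binary_periodicD(4,5)[OF u, of x] binary_periodicD(4,5)[OF v, of x] by linarith
    then show "integrable ?T (\<lambda>x. \<bar>u x - v x\<bar>)" by (intro integrable_torus_bounded[OF l, of _ 1]) auto
  qed simp
  ultimately have "ennreal (s ^ CARD('n) * (\<integral>x. \<bar>u x - v x\<bar> \<partial>?T)) \<le> ennreal (2 * ?K + \<delta> * l ^ CARD('n))"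
    using s0 by (simp add: ennreal_mult')
  then have "s ^ CARD('n) * (\<integral>x. \<bar>u x - v x\<bar> \<partial>?T) \<le> 2 * ?K + \<delta> * l ^ CARD('n)"
    using C s0 \<delta>(1) l by (subst (asm) ennreal_le_iff) auto
  then have "(\<integral>x. \<bar>u x - v x\<bar> \<partial>?T) \<le> (2 * ?K + \<delta> * l ^ CARD('n)) / s ^ CARD('n)"
    using s0 by (simp add: pos_le_divide_eq mult.commute)
  also have "\<dots> = 2 * C * real CARD('n) * 2 ^ CARD('n) * s + \<delta> * l ^ CARD('n) / s ^ CARD('n)"
    using s0 by (simp add: add_divide_distrib power_mult_distrib)
  finally show ?thesis .
qed

text \<open>The cell integrals on all grids are countably many bounded sequences, so a diagonal
  subsequence makes all of them converge. The preceding bound then makes the functions Cauchy in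
  L1.\<close>

theorem binary_periodic_compact:
  fixes u :: "nat \<Rightarrow> real^'n \<Rightarrow> real"
  assumes l: "l > 0" and u: "\<And>n. binary_periodic l (u n)" and C: "C \<ge> 0"
    and uC: "\<And>n z. translation_diff l (u n) z \<le> C * norm z"
  shows "\<exists>r v. strict_mono r \<and> binary_periodic l v \<and> (\<lambda>n. \<integral>x. \<bar>u (r n) x - v x\<bar> \<partial>torus_measure l) \<longlonglongrightarrow> 0"
proof -
  let ?T = "torus_measure l :: (real^'n) measure"
  let ?d = "CARD('n)"
  interpret T: finite_measure ?T by (rule finite_torus_measure[OF l])
  have mu[measurable]: "u n \<in> borel_measurable ?T" for n using binary_periodicD(2)[OF u] .
  define s where "s N = l / real (Suc N)" for N
  have s0: "s N > 0" for N using l by (simp add: s_def)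
  define f where "f n p = (\<integral>x. indicator (cell (s (fst p)) (snd p)) x * u n x \<partial>?T)" for n and p :: "nat \<times> (int^'n)"
  have iu: "integrable ?T (u n)" for n
    using binary_periodicD(6)[OF u] by (intro integrable_torus_bounded[OF l, of _ 1]) auto
  have fb: "norm (f n p) \<le> l ^ ?d" for n p
  proof -
    have "\<bar>f n p\<bar> \<le> (\<integral>x. 1 \<partial>?T)"
      unfolding f_def
    proof (rule integral_abs_bound_integral)
      have [measurable]: "(indicator (cell (s (fst p)) (snd p)) :: _ \<Rightarrow> real) \<in> borel_measurable ?T"
        using cell_borel[OF s0] by (intro torus_measure_borel_fun borel_measurable_indicator)
      have "(\<lambda>x. indicator (cell (s (fst p)) (snd p)) x * u n x) \<in> borel_measurable ?T" by measurable
      then show "integrable ?T (\<lambda>x. indicator (cell (s (fst p)) (snd p)) x * u n x)"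
        by (rule integrable_torus_bounded[OF l, of _ 1])
          (use binary_periodicD(6)[OF u] in \<open>auto simp: indicator_def\<close>)
      show "\<bar>indicator (cell (s (fst p)) (snd p)) x * u n x\<bar> \<le> 1" for x
        using binary_periodicD(6)[OF u, of n x] by (auto simp: indicator_def)
    qed simp
    then show ?thesis using measure_torus[OF l, where 'n = 'n] by simp
  qed
  obtain k where k: "strict_mono k" "\<And>p. \<exists>L. (\<lambda>n. f (k n) p) \<longlonglongrightarrow> L"
    using function_convergent_subsequence[of "UNIV :: (nat \<times> (int^'n)) set" f "l ^ ?d"] fb by auto
  define w where "w n = u (k n)" for n
  have w: "binary_periodic l (w n)" for n using u by (simp add: w_def)
  have wd: "\<bar>w n x - w m x\<bar> \<le> 1" for n m x
    using binary_periodicD(4,5)[OF w, of n x] binary_periodicD(4,5)[OF w, of m x] by linarith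
  have cauchy: "\<exists>M. \<forall>n\<ge>M. \<forall>m\<ge>M. (\<integral>x. \<bar>w n x - w m x\<bar> \<partial>?T) < e" if e: "e > 0" for e
  proof -
    let ?c = "2 * C * real ?d * 2 ^ ?d"
    have "(\<lambda>N. ?c * s N) \<longlonglongrightarrow> ?c * 0"
      unfolding s_def by (intro tendsto_mult tendsto_const LIMSEQ_Suc[OF lim_const_over_n])
    then have "\<forall>\<^sub>F N in sequentially. ?c * s N < e / 2"
      using e by (intro order_tendstoD) auto
    then obtain N where N: "?c * s N < e / 2" by (auto simp: eventually_sequentially)
    \<comment> \<open>Chosen so that the second term of the bound is \<open>e / 4\<close>.\<close>
    define \<delta> where "\<delta> = e / 2 * s N ^ ?d / (2 * l ^ ?d)"
    have \<delta>: "\<delta> > 0" "\<delta> * l ^ ?d / s N ^ ?d < e / 2" using e s0[of N] l by (auto simp: \<delta>_def)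
    \<comment> \<open>Only finitely many cells meet the torus, so there is one index from which on
      all their integrals are \<open>\<delta>\<close>-close; on the other cells the integrals
      vanish.\<close>
    let ?K = "cell_index (s N) ` torus l :: (int^'n) set"
    have finK: "finite ?K"
    proof (rule finite_subset)
      show "?K \<subseteq> vec_lambda ` (UNIV \<rightarrow>\<^sub>E {0..int (Suc N)})"
      proof
        fix q assume "q \<in> ?K"
        then obtain x :: "real^'n" where x: "x \<in> torus l" "q = cell_index (s N) x" by blast
        have "q $ i \<in> {0..int (Suc N)}" for i
        proof -
          have "0 \<le> x $ i" "x $ i < l" using x by (auto simp: torus_def)
          then have "0 \<le> x $ i / s N" "x $ i / s N \<le> l / s N"
            using s0[of N] by (auto intro!: divide_right_mono)
          moreover have "l / s N = real (Suc N)" using l by (simp add: s_def)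
          ultimately have "0 \<le> \<lfloor>x $ i / s N\<rfloor>" "\<lfloor>x $ i / s N\<rfloor> \<le> int (Suc N)" by linarith+
          then show ?thesis unfolding x by (simp add: cell_index_def)
        qed
        then show "q \<in> vec_lambda ` (UNIV \<rightarrow>\<^sub>E {0..int (Suc N)})"
          by (intro image_eqI[of _ _ "\<lambda>i. q $ i"]) auto
      qed
    qed (auto intro!: finite_PiE)
    have "\<exists>M. \<forall>n\<ge>M. \<forall>m\<ge>M. \<bar>f (k n) (N, q) - f (k m) (N, q)\<bar> < \<delta>" for q
    proof -
      have "Cauchy (\<lambda>n. f (k n) (N, q))" using k(2)[of "(N, q)"] by (auto intro: LIMSEQ_imp_Cauchy)
      then show ?thesis using \<delta>(1) unfolding Cauchy_def dist_real_def by blast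
    qed
    then obtain M where M: "\<And>q n m. n \<ge> M q \<Longrightarrow> m \<ge> M q \<Longrightarrow> \<bar>f (k n) (N, q) - f (k m) (N, q)\<bar> < \<delta>" by metis
    have "(\<integral>x. \<bar>w n x - w m x\<bar> \<partial>?T) < e" if nm: "n \<ge> Max (M ` ?K)" "m \<ge> Max (M ` ?K)" for n m
    proof -
      have "\<bar>(\<integral>x. indicator (cell (s N) q) x * w n x \<partial>?T) - (\<integral>x. indicator (cell (s N) q) x * w m x \<partial>?T)\<bar> \<le> \<delta>" for q
      proof (cases "q \<in> ?K")
        case True
        then have "M q \<le> Max (M ` ?K)" using finK by simp
        then show ?thesis using M[of q n m] nm by (simp add: f_def w_def)
      next
        case False
        then have "indicator (cell (s N) q) x = (0::real)" if "x \<in> torus l" for x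
          using that by (auto simp: in_cell_iff indicator_def)
        then have "(\<integral>x. indicator (cell (s N) q) x * w n x \<partial>?T) = (\<integral>x. 0 \<partial>?T)" for n
          by (intro Bochner_Integration.integral_cong) auto
        then show ?thesis using \<delta>(1) by simp
      qed
      then have "(\<integral>x. \<bar>w n x - w m x\<bar> \<partial>?T) \<le> ?c * s N + \<delta> * l ^ ?d / s N ^ ?d"
        using \<delta>(1) by (intro torus_L1_cell_bound[OF l w w C _ _ _ s_def[of N]]) (auto simp: w_def uC)
      with N \<delta>(2) show ?thesis by linarith
    qed
    then show ?thesis by blast
  qed
  have iw: "integrable ?T (w n)" for n unfolding w_def by (rule iu)
  obtain r where r: "strict_mono r" "AE x in ?T. Cauchy (\<lambda>n. w (r n) x)"
    using cauchy_L1_AE_cauchy_subseq[of ?T w] iw cauchy by (auto simp: real_norm_def)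
  define W where "W n = w (r n)" for n
  have W: "binary_periodic l (W n)" for n using w by (simp add: W_def)
  \<comment> \<open>The pointwise limit with default 0 rather than an L1 limit: this makes
    \<open>v\<close> periodic and 0-1 valued at every point, as \<open>binary_periodic\<close>
    asks.\<close>
  define v where "v x = (if \<exists>L. (\<lambda>n. W n x) \<longlonglongrightarrow> L then lim (\<lambda>n. W n x) else 0)" for x
  have lim: "AE x in ?T. (\<lambda>n. W n x) \<longlonglongrightarrow> v x"
    using r(2)
  proof eventually_elim
    case (elim x)
    then have "convergent (\<lambda>n. W n x)" by (simp add: Cauchy_convergent_iff W_def)
    then show ?case by (auto simp: v_def convergent_def convergent_LIMSEQ_iff[symmetric] limI)
  qed
  have v01: "v x \<in> {0, 1}" for x
  proof (cases "\<exists>L. (\<lambda>n. W n x) \<longlonglongrightarrow> L")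
    case True
    then have "(\<lambda>n. W n x) \<longlonglongrightarrow> v x" by (auto simp: v_def limI)
    moreover have "closed {0, 1 :: real}" by simp
    ultimately show ?thesis
      using binary_periodicD(3)[OF W] closed_sequentially[of "{0, 1 :: real}" "\<lambda>n. W n x" "v x"] by blast
  qed (simp add: v_def)
  have vp: "periodic l v"
    using binary_periodicD(1)[OF W] by (simp add: periodic_def v_def)
  have mW[measurable]: "W n \<in> borel_measurable ?T" for n using binary_periodicD(2)[OF W] .
  have vm: "v \<in> borel_measurable ?T"
  proof -
    have "(\<lambda>x. if Cauchy (\<lambda>n. W n x) then lim (\<lambda>n. W n x) else 0) \<in> borel_measurable ?T"
      by measurable
    then show ?thesis unfolding v_def convergent_def[symmetric] Cauchy_convergent_iff[symmetric] .
  qed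
  have v: "binary_periodic l v" using vp vm v01 by (simp add: binary_periodic_def)
  have "(\<lambda>n. \<integral>x. \<bar>W n x - v x\<bar> \<partial>?T) \<longlonglongrightarrow> (\<integral>x. 0 \<partial>?T)"
  proof (rule integral_dominated_convergence[where w = "\<lambda>_. 1"])
    show "AE x in ?T. (\<lambda>n. \<bar>W n x - v x\<bar>) \<longlonglongrightarrow> 0"
      using lim by eventually_elim (simp add: LIM_zero tendsto_rabs_zero)
    show "AE x in ?T. norm \<bar>W n x - v x\<bar> \<le> 1" for n
    proof (rule AE_I2)
      fix x show "norm \<bar>W n x - v x\<bar> \<le> 1"
        using binary_periodicD(4,5)[OF W, of n x] binary_periodicD(4,5)[OF v, of x] by simp
    qed
  qed (use vm in auto)
  then have "(\<lambda>n. \<integral>x. \<bar>u ((k \<circ> r) n) x - v x\<bar> \<partial>?T) \<longlonglongrightarrow> 0" by (simp add: W_def w_def)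
  moreover have "strict_mono (k \<circ> r)" using k(1) r(1) by (rule strict_mono_o)
  ultimately show ?thesis using v by blast
qed

subsection \<open>Directional variation\<close>

lemma torus_mean_eq: "torus_mean l (f :: real^'n \<Rightarrow> real) = (\<integral>x. f x \<partial>torus_measure l) / l ^ CARD('n)"
  by (simp add: torus_mean_def set_integral_torus)

lemma torus_mean_translation_diff:
  "torus_mean l (\<lambda>x. \<bar>u (x + z) - u x\<bar> / c) = translation_diff l u z / l ^ CARD('n) / c"
  for u :: "real^'n \<Rightarrow> real"
  by (simp add: torus_mean_eq translation_diff_def)

lemma BV01_binary_periodic: "u \<in> BV01 l \<Longrightarrow> binary_periodic l u"
  unfolding BV01_def BV_def binary_periodic_def set_integrable_torus by auto

lemma BV01I:
  assumes "l > 0" "binary_periodic l u" "\<exists>\<mu> \<sigma>. is_polar_gradient l u \<mu> \<sigma>"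
  shows "u \<in> BV01 l"
proof -
  have "integrable (torus_measure l) u"
    using binary_periodicD(2,6)[OF assms(2)] by (intro integrable_torus_bounded[OF assms(1), of _ 1]) auto
  then show ?thesis
    using assms unfolding BV01_def BV_def set_integrable_torus binary_periodic_def by auto
qed

lemma BV01_polar_gradient:
  assumes "u \<in> BV01 l"
  shows "is_polar_gradient l u (variation_measure l u) (gradient_direction l u)"
proof -
  obtain \<mu> \<sigma> where "is_polar_gradient l u \<mu> \<sigma>" using assms by (auto simp: BV01_def BV_def)
  then have "is_polar_gradient l u (fst (\<mu>, \<sigma>)) (snd (\<mu>, \<sigma>))" by simp
  then show ?thesis
    unfolding variation_measure_def gradient_direction_def polar_gradient_def by (rule someI)
qed

lemma directional_variation_nonneg: "0 \<le> directional_variation l u \<omega>"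
  unfolding directional_variation_def by (intro Bochner_Integration.integral_nonneg) simp

lemma total_variation_nonneg: "0 \<le> total_variation l u"
  unfolding total_variation_def by simp

lemma directional_variation_scaleR: "directional_variation l u (c *\<^sub>R \<omega>) = \<bar>c\<bar> * directional_variation l u \<omega>"
  unfolding directional_variation_def by (simp add: abs_mult)

lemma translation_diff_le_directional_variation:
  assumes "l > 0" "u \<in> BV01 l"
  shows "translation_diff l u z \<le> directional_variation l u z"
  using translation_diff_le_polar[OF assms(1) BV01_binary_periodic[OF assms(2)] BV01_polar_gradient[OF assms(2)]]
  by (simp add: directional_variation_def)

lemma directional_variation_le:
  assumes "l > 0" "u \<in> BV01 l" "\<And>t. t > 0 \<Longrightarrow> translation_diff l u (t *\<^sub>R \<omega>) \<le> c * t"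
  shows "directional_variation l u \<omega> \<le> c"
  using polar_le_translation_diff[OF assms(1) BV01_binary_periodic[OF assms(2)] BV01_polar_gradient[OF assms(2)] assms(3)]
  by (simp add: directional_variation_def)

lemma directional_variation_le_total_variation:
  fixes u :: "real^'n \<Rightarrow> real"
  assumes l: "l > 0" and u: "u \<in> BV01 l"
  shows "directional_variation l u \<omega> \<le> norm \<omega> * total_variation l u"
proof -
  note P = is_polar_gradientD[OF l BV01_polar_gradient[OF u]]
  interpret finite_measure "variation_measure l u" by (rule P(1))
  have "directional_variation l u \<omega> \<le> (\<integral>x. norm \<omega> \<partial>variation_measure l u)"
    unfolding directional_variation_def using P(2,7,8) by (intro integral_mono) auto
  then show ?thesis using P(2) by (simp add: total_variation_def mult.commute)
qed

lemma translation_diff_le_total_variation: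
  assumes l: "l > 0" and u: "u \<in> BV01 l"
  shows "translation_diff l u z \<le> total_variation l u * norm z"
  using translation_diff_le_directional_variation[OF l u, of z] directional_variation_le_total_variation[OF l u, of z]
  by (simp add: mult.commute)

text \<open>Sublinearity in the direction. The continuity obtained makes the integrands of the
  energy Borel in \<open>z\<close>.\<close>

lemma directional_variation_lipschitz:
  fixes u :: "real^'n \<Rightarrow> real"
  assumes l: "l > 0" and u: "u \<in> BV01 l"
  shows "\<bar>directional_variation l u \<omega> - directional_variation l u \<omega>'\<bar> \<le> total_variation l u * norm (\<omega> - \<omega>')"
proof -
  have *: "directional_variation l u \<omega> \<le> directional_variation l u \<omega>' + directional_variation l u (\<omega> - \<omega>')" for \<omega> \<omega>'
  proof -
    note P = is_polar_gradientD[OF l BV01_polar_gradient[OF u]]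
    have "directional_variation l u \<omega> \<le> (\<integral>x. \<bar>\<omega>' \<bullet> gradient_direction l u x\<bar> + \<bar>(\<omega> - \<omega>') \<bullet> gradient_direction l u x\<bar> \<partial>variation_measure l u)"
      unfolding directional_variation_def
      by (intro integral_mono Bochner_Integration.integrable_add P(7)) (simp add: inner_diff_left)
    then show ?thesis using P(7) by (simp add: directional_variation_def)
  qed
  have "directional_variation l u (\<omega>' - \<omega>) = directional_variation l u (\<omega> - \<omega>')"
    using directional_variation_scaleR[of l u "-1" "\<omega> - \<omega>'"] by simp
  then show ?thesis
    using *[of \<omega> \<omega>'] *[of \<omega>' \<omega>] directional_variation_le_total_variation[OF l u, of "\<omega> - \<omega>'"]
    by (simp add: mult.commute abs_le_iff)
qed

lemma directional_variation_borel:
  fixes u :: "real^'n \<Rightarrow> real"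
  assumes "l > 0" "u \<in> BV01 l"
  shows "(\<lambda>z. directional_variation l u (z /\<^sub>R norm z)) \<in> borel_measurable borel"
proof -
  have "(total_variation l u)-lipschitz_on UNIV (directional_variation l u)"
    using directional_variation_lipschitz[OF assms] total_variation_nonneg
    by (intro lipschitz_onI) (auto simp: dist_norm)
  then have "continuous_on UNIV (directional_variation l u)" by (rule lipschitz_on_continuous_on)
  then have "directional_variation l u \<in> borel_measurable borel" by (rule borel_measurable_continuous_onI)
  then show ?thesis by (rule measurable_compose[rotated]) simp
qed

text \<open>By translation invariance, passing from \<open>x + z'\<close> to \<open>x + z\<close>
  costs the difference at \<open>z - z'\<close>. Continuity in \<open>z\<close> follows.\<close>

lemma translation_diff_triangle:
  fixes u :: "real^'n \<Rightarrow> real"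
  assumes l: "l > 0" and u: "binary_periodic l u"
  shows "translation_diff l u z \<le> translation_diff l u z' + translation_diff l u (z - z')"
proof -
  let ?T = "torus_measure l :: (real^'n) measure"
  note M = translation_diff_measurable[OF l u]
  have p: "periodic l (\<lambda>y. \<bar>u (y + (z - z')) - u y\<bar>)"
    using binary_periodicD(1)[OF u] periodic_shift[OF binary_periodicD(1)[OF u], of "z - z'"] by (simp add: periodic_def)
  have i: "integrable ?T (\<lambda>x. \<bar>u (x + z) - u (x + z')\<bar>)"
    using torus_measure_shift_integrable[OF l p M(3), of z'] by (simp add: add.assoc)
  have e: "(\<integral>x. \<bar>u (x + z) - u (x + z')\<bar> \<partial>?T) = translation_diff l u (z - z')"
    using torus_measure_shift_integral[OF l p borel_measurable_integrable[OF M(3)], of z']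
    by (simp add: translation_diff_def add.assoc)
  have "translation_diff l u z \<le> (\<integral>x. \<bar>u (x + z') - u x\<bar> + \<bar>u (x + z) - u (x + z')\<bar> \<partial>?T)"
    unfolding translation_diff_def by (intro integral_mono Bochner_Integration.integrable_add M(3) i) simp
  also have "\<dots> = translation_diff l u z' + translation_diff l u (z - z')"
    using M(3) i e by (simp add: translation_diff_def)
  finally show ?thesis .
qed

lemma translation_diff_borel:
  fixes u :: "real^'n \<Rightarrow> real"
  assumes l: "l > 0" and u: "u \<in> BV01 l"
  shows "translation_diff l u \<in> borel_measurable borel"
proof -
  have "\<bar>translation_diff l u z - translation_diff l u z'\<bar> \<le> total_variation l u * norm (z - z')" for z z'
    using translation_diff_triangle[OF l BV01_binary_periodic[OF u], of z z']
      translation_diff_triangle[OF l BV01_binary_periodic[OF u], of z' z]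
      translation_diff_le_total_variation[OF l u, of "z - z'"] translation_diff_le_total_variation[OF l u, of "z' - z"]
    by (simp add: abs_le_iff norm_minus_commute)
  then have "(total_variation l u)-lipschitz_on UNIV (translation_diff l u)"
    using total_variation_nonneg by (intro lipschitz_onI) (auto simp: dist_norm)
  then show ?thesis by (intro borel_measurable_continuous_onI lipschitz_on_continuous_on)
qed

lemma integrable_abs_diff_binary:
  fixes u v :: "real^'n \<Rightarrow> real"
  assumes l: "l > 0" and u: "binary_periodic l u" and v: "binary_periodic l v"
  shows "integrable (torus_measure l) (\<lambda>x. \<bar>u x - v x\<bar>)"
proof -
  have "\<bar>u x - v x\<bar> \<le> 1" for x
    using binary_periodicD(4,5)[OF u, of x] binary_periodicD(4,5)[OF v, of x] by linarith
  then show ?thesis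
    using binary_periodicD(2)[OF u] binary_periodicD(2)[OF v]
    by (intro integrable_torus_bounded[OF l, of _ 1]) auto
qed

text \<open>The L1 distance enters twice, at \<open>x\<close> and at \<open>x + z\<close>, with the
  same value by translation invariance.\<close>

lemma translation_diff_perturb:
  fixes u v :: "real^'n \<Rightarrow> real"
  assumes l: "l > 0" and u: "binary_periodic l u" and v: "binary_periodic l v"
  shows "translation_diff l u z \<le> translation_diff l v z + 2 * (\<integral>x. \<bar>u x - v x\<bar> \<partial>torus_measure l)"
proof -
  let ?T = "torus_measure l :: (real^'n) measure"
  note i = integrable_abs_diff_binary[OF l u v]
  have p: "periodic l (\<lambda>x. \<bar>u x - v x\<bar>)"
    using binary_periodicD(1)[OF u] binary_periodicD(1)[OF v] by (simp add: periodic_def)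
  note ish = torus_measure_shift_integrable[OF l p i, of z]
  have "translation_diff l u z \<le> (\<integral>x. \<bar>v (x + z) - v x\<bar> + (\<bar>u (x + z) - v (x + z)\<bar> + \<bar>u x - v x\<bar>) \<partial>?T)"
    unfolding translation_diff_def
    by (intro integral_mono Bochner_Integration.integrable_add translation_diff_measurable(3)[OF l u]
        translation_diff_measurable(3)[OF l v] i ish) simp
  also have "\<dots> = translation_diff l v z + ((\<integral>x. \<bar>u (x + z) - v (x + z)\<bar> \<partial>?T) + (\<integral>x. \<bar>u x - v x\<bar> \<partial>?T))"
    using translation_diff_measurable(3)[OF l v] i ish by (simp add: translation_diff_def)
  also have "(\<integral>x. \<bar>u (x + z) - v (x + z)\<bar> \<partial>?T) = (\<integral>x. \<bar>u x - v x\<bar> \<partial>?T)"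
    by (rule torus_measure_shift_integral[OF l p borel_measurable_integrable[OF i]])
  finally show ?thesis by simp
qed

lemma translation_diff_tendsto:
  fixes u :: "nat \<Rightarrow> real^'n \<Rightarrow> real"
  assumes l: "l > 0" and u: "\<And>n. binary_periodic l (u n)" and v: "binary_periodic l v"
    and lim: "(\<lambda>n. \<integral>x. \<bar>u n x - v x\<bar> \<partial>torus_measure l) \<longlonglongrightarrow> 0"
  shows "(\<lambda>n. translation_diff l (u n) z) \<longlonglongrightarrow> translation_diff l v z"
proof -
  have "(\<lambda>n. 2 * (\<integral>x. \<bar>u n x - v x\<bar> \<partial>torus_measure l)) \<longlonglongrightarrow> 0"
    using tendsto_mult[OF tendsto_const[of "2 :: real"] lim] by (simp only: mult_zero_right)
  moreover have "norm (translation_diff l (u n) z - translation_diff l v z) \<le> 2 * (\<integral>x. \<bar>u n x - v x\<bar> \<partial>torus_measure l)" for n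
    using translation_diff_perturb[OF l u v, of n z] translation_diff_perturb[OF l v u, of z n]
    by (simp add: abs_minus_commute abs_le_iff)
  ultimately have "(\<lambda>n. translation_diff l (u n) z - translation_diff l v z) \<longlonglongrightarrow> 0"
    by (rule Lim_null_comparison[rotated, OF _ always_eventually, OF _ allI])
  then show ?thesis by (rule LIM_zero_cancel)
qed

text \<open>The integrand is at most 1. Unlike the bound by the total variation this one is uniform
  in \<open>u\<close>; it controls the far part and yields coercivity.\<close>

lemma translation_diff_le_volume:
  fixes u :: "real^'n \<Rightarrow> real"
  assumes l: "l > 0" and u: "binary_periodic l u"
  shows "translation_diff l u z \<le> l ^ CARD('n)"
proof -
  interpret finite_measure "torus_measure l :: (real^'n) measure" by (rule finite_torus_measure[OF l])
  have "translation_diff l u z \<le> (\<integral>x. 1 \<partial>(torus_measure l :: (real^'n) measure))"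
    unfolding translation_diff_def using binary_periodicD(7)[OF u]
    by (intro integral_mono translation_diff_measurable(3)[OF l u]) auto
  then show ?thesis by (simp add: measure_torus[OF l])
qed

text \<open>After Fubini the integral over \<open>z\<close> has the same value for every unit vector
  \<open>gradient_direction l u x\<close>, so the integration over \<open>x\<close> only contributes
  the mass of the variation measure.\<close>

lemma nn_integral_radial_directional_variation:
  fixes u :: "real^'n \<Rightarrow> real"
  assumes l: "l > 0" and u: "u \<in> BV01 l" and f[measurable]: "f \<in> borel_measurable borel"
  shows "(\<integral>\<^sup>+z. f (norm z) * ennreal (directional_variation l u (z /\<^sub>R norm z)) \<partial>lborel)
    = ennreal (2 * unit_ball_vol (real CARD('n) - 1)) * ennreal (total_variation l u) *
      (\<integral>\<^sup>+r. indicator {0<..} r * (f r * ennreal (r ^ (CARD('n) - 1))) \<partial>lborel)"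
proof -
  let ?\<mu> = "variation_measure l u" and ?\<sigma> = "gradient_direction l u"
  note P = is_polar_gradientD[OF l BV01_polar_gradient[OF u]]
  interpret \<mu>: finite_measure ?\<mu> by (rule P(1))
  interpret pair_sigma_finite lborel ?\<mu> ..
  have \<sigma>[measurable]: "?\<sigma> \<in> borel_measurable ?\<mu>" by (rule P(4))
  have "(\<integral>\<^sup>+z. f (norm z) * ennreal (directional_variation l u (z /\<^sub>R norm z)) \<partial>lborel)
      = (\<integral>\<^sup>+z. \<integral>\<^sup>+x. f (norm z) * ennreal \<bar>(z /\<^sub>R norm z) \<bullet> ?\<sigma> x\<bar> \<partial>?\<mu> \<partial>lborel)"
  proof (rule nn_integral_cong)
    fix z :: "real^'n"
    have "ennreal (directional_variation l u (z /\<^sub>R norm z)) = (\<integral>\<^sup>+x. ennreal \<bar>(z /\<^sub>R norm z) \<bullet> ?\<sigma> x\<bar> \<partial>?\<mu>)"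
      unfolding directional_variation_def by (rule nn_integral_eq_integral[OF P(7), symmetric]) simp
    then show "f (norm z) * ennreal (directional_variation l u (z /\<^sub>R norm z)) =
        (\<integral>\<^sup>+x. f (norm z) * ennreal \<bar>(z /\<^sub>R norm z) \<bullet> ?\<sigma> x\<bar> \<partial>?\<mu>)"
      by (simp add: nn_integral_cmult)
  qed
  also have "\<dots> = (\<integral>\<^sup>+x. \<integral>\<^sup>+z. f (norm z) * ennreal \<bar>(z /\<^sub>R norm z) \<bullet> ?\<sigma> x\<bar> \<partial>lborel \<partial>?\<mu>)"
    by (rule Fubini'[symmetric]) measurable
  also have "\<dots> = (\<integral>\<^sup>+x. ennreal (2 * unit_ball_vol (real CARD('n) - 1)) *
      (\<integral>\<^sup>+r. indicator {0<..} r * (f r * ennreal (r ^ (CARD('n) - 1))) \<partial>lborel) \<partial>?\<mu>)"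
    by (intro nn_integral_cong nn_integral_radial_abs_inner P(5) f) (simp add: P(2))
  also have "\<dots> = ennreal (2 * unit_ball_vol (real CARD('n) - 1)) *
      (\<integral>\<^sup>+r. indicator {0<..} r * (f r * ennreal (r ^ (CARD('n) - 1))) \<partial>lborel) * emeasure ?\<mu> (space ?\<mu>)"
    by simp
  also have "emeasure ?\<mu> (space ?\<mu>) = ennreal (total_variation l u)"
    by (simp add: total_variation_def P(2) \<mu>.emeasure_eq_measure)
  finally show ?thesis by (simp add: mult_ac)
qed

section \<open>Slabs as admissible functions\<close>

lemma distr_torus_coordinate:
  assumes l: "l > 0"
  shows "distr (torus_measure l :: (real^'n) measure) borel (\<lambda>x. x $ i) =
    density lborel (\<lambda>t. ennreal (l ^ (CARD('n) - 1)) * indicator {0..<l} t)" (is "?M = ?N")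
proof (rule measure_eqI_lessThan)
  have m: "(\<lambda>x::real^'n. x $ i) \<in> borel_measurable (torus_measure l)"
    by (rule torus_measure_borel_fun) simp
  show "sets ?M = sets borel" "sets ?N = sets borel" by simp_all
  have D: "CARD('n) = Suc (CARD('n) - 1)" by simp
  have M: "emeasure ?M {a<..} = ennreal (l ^ (CARD('n) - 1)) * emeasure lborel ({0..<l} \<inter> {a<..})" for a
  proof -
    \<comment> \<open>The bound \<open>a\<close> clipped to \<open>[0,l]\<close>. The part of the
      torus above \<open>a\<close> then lies between the open and the closed box with lower corner
      \<open>c\<close>, which have equal volume.\<close>
    let ?a = "max 0 (min a l)"
    define c :: "real^'n" where "c = (\<chi> j. if j = i then ?a else 0)"
    have v: "(\<lambda>x. x $ i) -` {a<..} \<inter> torus l = {x::real^'n. x \<in> torus l \<and> a < x $ i}" by auto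
    have sub1: "box c (\<chi> j. l) \<subseteq> {x. x \<in> torus l \<and> a < x $ i} \<union> {x. x $ i = l}"
    proof
      fix x :: "real^'n" assume x: "x \<in> box c (\<chi> j. l)"
      then have b: "c $ j < x $ j \<and> x $ j < l" for j by (simp add: mem_box_cart)
      have "0 \<le> x $ j" for j using b[of j] by (simp add: c_def split: if_splits)
      moreover have "a < x $ i" using b[of i] by (auto simp: c_def max_def min_def split: if_splits)
      ultimately show "x \<in> {x. x \<in> torus l \<and> a < x $ i} \<union> {x. x $ i = l}"
        using b by (auto simp: torus_def)
    qed
    have sub1': "box c (\<chi> j. l) \<subseteq> {x. x \<in> torus l \<and> a < x $ i}"
    proof
      fix x :: "real^'n" assume x: "x \<in> box c (\<chi> j. l)"
      then have "x $ i < l" by (simp add: mem_box_cart)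
      with x sub1 show "x \<in> {x. x \<in> torus l \<and> a < x $ i}" by auto
    qed
    have sub2: "{x. x \<in> torus l \<and> a < x $ i} \<subseteq> cbox c (\<chi> j. l)"
      by (auto simp: torus_def mem_box_cart c_def less_imp_le)
    have meas: "{x::real^'n. x \<in> torus l \<and> a < x $ i} \<in> sets borel"
      using measurable_sets_borel[of "\<lambda>x::real^'n. x $ i" borel "{a<..}"] sets_torus[of l]
      by (auto simp: Collect_conj_eq vimage_def intro!: sets.Int)
    have cl: "c $ j \<le> l" for j using l by (simp add: c_def)
    have prd: "(\<Prod>b\<in>Basis. ((\<chi> j. l) - c) \<bullet> b) = (l - ?a) * l ^ (CARD('n) - 1)"
    proof -
      have "(\<Prod>b\<in>Basis. ((\<chi> j. l) - c) \<bullet> b) = (\<Prod>j\<in>UNIV. l - c $ j)"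
        by (simp add: Basis_vec_def prod.UNION_disjoint axis_eq_axis inner_axis)
      also have "\<dots> = (l - c $ i) * (\<Prod>j\<in>UNIV - {i}. l - c $ j)"
        by (subst prod.remove[of _ i]) auto
      also have "(\<Prod>j\<in>UNIV - {i}. l - c $ j) = (\<Prod>j\<in>UNIV - {i}. l)"
        by (intro prod.cong) (auto simp: c_def)
      finally show ?thesis by (simp add: c_def card_Diff_singleton)
    qed
    have eb: "emeasure lborel (box c (\<chi> j. l)) = ennreal ((l - ?a) * l ^ (CARD('n) - 1))"
      unfolding prd[symmetric] using cl by (intro emeasure_lborel_box) (auto simp: Basis_vec_def inner_axis)
    have ec: "emeasure lborel (cbox c (\<chi> j. l)) = ennreal ((l - ?a) * l ^ (CARD('n) - 1))"
      unfolding prd[symmetric] using cl by (intro emeasure_lborel_cbox) (auto simp: Basis_vec_def inner_axis)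
    have "emeasure lborel {x::real^'n. x \<in> torus l \<and> a < x $ i} = ennreal ((l - ?a) * l ^ (CARD('n) - 1))"
    proof (rule antisym)
      show "emeasure lborel {x::real^'n. x \<in> torus l \<and> a < x $ i} \<le> ennreal ((l - ?a) * l ^ (CARD('n) - 1))"
        unfolding ec[symmetric] by (intro emeasure_mono sub2) auto
      show "ennreal ((l - ?a) * l ^ (CARD('n) - 1)) \<le> emeasure lborel {x::real^'n. x \<in> torus l \<and> a < x $ i}"
        unfolding eb[symmetric] by (intro emeasure_mono sub1') (use meas in auto)
    qed
    moreover have "emeasure ?M {a<..} = emeasure lborel {x::real^'n. x \<in> torus l \<and> a < x $ i}"
    proof -
      have "emeasure ?M {a<..} = emeasure (torus_measure l) {x::real^'n. x \<in> torus l \<and> a < x $ i}"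
        by (subst emeasure_distr[OF m]) (auto simp: v)
      also have "\<dots> = emeasure lebesgue {x::real^'n. x \<in> torus l \<and> a < x $ i}"
        unfolding torus_measure_def by (intro emeasure_restrict_space) auto
      also have "\<dots> = emeasure lborel {x::real^'n. x \<in> torus l \<and> a < x $ i}"
        using meas by simp
      finally show ?thesis .
    qed
    moreover have "emeasure lborel ({0..<l} \<inter> {a<..}) = ennreal (l - ?a)"
    proof -
      have "{0..<l} \<inter> {a<..} = (if a < 0 then {0..<l} else {a<..<l})" by auto
      then show ?thesis using l by (auto simp: max_def min_def ennreal_neg)
    qed
    ultimately show ?thesis using l by (simp add: ennreal_mult'[symmetric] mult.commute)
  qed
  have N: "emeasure ?N {a<..} = ennreal (l ^ (CARD('n) - 1)) * emeasure lborel ({0..<l} \<inter> {a<..})" for a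
  proof -
    have "emeasure ?N {a<..} = (\<integral>\<^sup>+t. ennreal (l ^ (CARD('n) - 1)) * indicator ({0..<l} \<inter> {a<..}) t \<partial>lborel)"
      by (subst emeasure_density) (auto intro!: nn_integral_cong simp: indicator_def)
    then show ?thesis by (simp add: nn_integral_cmult)
  qed
  show "emeasure ?M {a<..} < \<infinity>" for a
  proof -
    have "emeasure lborel ({0..<l} \<inter> {a<..}) \<le> emeasure lborel {0..<l}" by (intro emeasure_mono) auto
    then have "emeasure lborel ({0..<l} \<inter> {a<..}) < \<infinity>" using l by (simp add: le_less_trans)
    then show ?thesis unfolding M by (simp add: ennreal_mult_less_top)
  qed
  show "emeasure ?M {a<..} = emeasure ?N {a<..}" for a unfolding M N ..
qed

lemma integral_torus_coordinate:
  fixes f :: "real \<Rightarrow> real"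
  assumes l: "l > 0" and f: "f \<in> borel_measurable borel"
  shows "(\<integral>x. f (x $ i) \<partial>(torus_measure l :: (real^'n) measure)) = l ^ (CARD('n) - 1) * (LINT t:{0..<l}|lborel. f t)"
proof -
  have m: "(\<lambda>x::real^'n. x $ i) \<in> borel_measurable (torus_measure l)"
    by (rule torus_measure_borel_fun) simp
  have "(\<integral>x. f (x $ i) \<partial>(torus_measure l :: (real^'n) measure)) =
      (\<integral>t. f t \<partial>distr (torus_measure l :: (real^'n) measure) borel (\<lambda>x. x $ i))"
    by (rule integral_distr[symmetric, OF m f])
  also have "\<dots> = (\<integral>t. f t \<partial>density lborel (\<lambda>t. ennreal (l ^ (CARD('n) - 1) * indicator {0..<l} t)))"
    unfolding distr_torus_coordinate[OF l] by (simp add: ennreal_mult'' ennreal_indicator)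
  also have "\<dots> = (\<integral>t. (l ^ (CARD('n) - 1) * indicator {0..<l} t) *\<^sub>R f t \<partial>lborel)"
    using l f by (intro integral_density) auto
  also have "\<dots> = l ^ (CARD('n) - 1) * (LINT t:{0..<l}|lborel. f t)"
    unfolding set_lebesgue_integral_def by (simp add: mult.assoc)
  finally show ?thesis .
qed

definition slab :: "real \<Rightarrow> real \<Rightarrow> real \<Rightarrow> real" where
  "slab l a t = (if t - l * of_int \<lfloor>t / l\<rfloor> < a then 1 else 0)"

lemma slab_01: "slab l a t \<in> {0, 1}"
  by (simp add: slab_def)

lemma slab_periodic: "l > 0 \<Longrightarrow> slab l a (t + l) = slab l a t"
  by (simp add: slab_def add_divide_distrib algebra_simps)

lemma slab_borel [measurable]: "slab l a \<in> borel_measurable borel"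
  unfolding slab_def by measurable

lemma slab_eq: "0 \<le> t \<Longrightarrow> t < l \<Longrightarrow> slab l a t = (if t < a then 1 else 0)"
proof -
  assume "0 \<le> t" "t < l"
  then have "\<lfloor>t / l\<rfloor> = 0" by (simp add: floor_eq_iff)
  then show ?thesis by (simp add: slab_def)
qed

text \<open>The profile jumps at \<open>a\<close> and at the end of the period; a shift by
  \<open>h < l\<close> can change it only within \<open>h\<close> to the left of these two points.
  For \<open>h \<ge> l\<close> the length of the period is already at most
  \<open>2 * h\<close>.\<close>

lemma slab_shift_integral:
  assumes l: "l > 0" and a: "0 \<le> a" "a \<le> l" and h: "0 \<le> h"
  shows "(LINT t:{0..<l}|lborel. \<bar>slab l a (t + h) - slab l a t\<bar>) \<le> 2 * h"
proof (cases "h < l")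
  case False
  have "(LINT t:{0..<l}|lborel. \<bar>slab l a (t + h) - slab l a t\<bar>) \<le> (LINT t:{0..<l}|lborel. 1)"
  proof (rule set_integral_mono)
    have "\<bar>slab l a (t + h) - slab l a t\<bar> \<le> 1" for t using slab_01[of l a t] slab_01[of l a "t + h"] by auto
    then show "\<bar>slab l a (t + h) - slab l a t\<bar> \<le> 1" if "t \<in> {0..<l}" for t .
    show "set_integrable lborel {0..<l} (\<lambda>t. \<bar>slab l a (t + h) - slab l a t\<bar>)"
      unfolding set_integrable_def
    proof (rule Bochner_Integration.integrable_bound[where f = "indicat_real {0..<l}"])
      show "AE t in lborel. norm (indicator {0..<l} t *\<^sub>R \<bar>slab l a (t + h) - slab l a t\<bar>) \<le> norm (indicat_real {0..<l} t)"
        using \<open>\<And>t. \<bar>slab l a (t + h) - slab l a t\<bar> \<le> 1\<close> by (auto simp: indicator_def)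
    qed (use l in \<open>auto intro!: integrable_real_indicator\<close>)
  qed (use l in \<open>auto simp: set_integrable_def intro!: integrable_real_indicator\<close>)
  also have "\<dots> \<le> 2 * h" using False l by (simp add: set_lebesgue_integral_def)
  finally show ?thesis .
next
  case True
  let ?S = "{a - h..a} \<union> {l - h..l}"
  have "(LINT t:{0..<l}|lborel. \<bar>slab l a (t + h) - slab l a t\<bar>) \<le> (\<integral>t. indicator {a - h..a} t + indicator {l - h..l} t \<partial>lborel)"
    unfolding set_lebesgue_integral_def
  proof (rule integral_mono')
    show "integrable lborel (\<lambda>t. indicat_real {a - h..a} t + indicator {l - h..l} t)"
      using h by (intro Bochner_Integration.integrable_add integrable_real_indicator) auto
    fix t
    show "0 \<le> indicat_real {a - h..a} t + indicator {l - h..l} t" by simp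
    show "indicator {0..<l} t *\<^sub>R \<bar>slab l a (t + h) - slab l a t\<bar> \<le> indicat_real {a - h..a} t + indicator {l - h..l} t"
    proof (cases "t \<in> {0..<l} \<and> t \<notin> {a - h..a} \<and> t \<notin> {l - h..l}")
      case True
      then have t: "0 \<le> t" "t < l" "t + h < l" "t + h < a \<or> a < t" by auto
      then have "slab l a (t + h) = slab l a t" using h by (auto simp: slab_eq)
      then show ?thesis by simp
    next
      case False
      have "\<bar>slab l a (t + h) - slab l a t\<bar> \<le> 1" using slab_01[of l a t] slab_01[of l a "t + h"] by auto
      with False show ?thesis by (auto simp: indicator_def)
    qed
  qed
  also have "\<dots> = 2 * h" using h
    by (subst Bochner_Integration.integral_add) (auto intro!: integrable_real_indicator)
  finally show ?thesis .
qed

text \<open>The class of competitors has to be nonempty. A slab orthogonal to one axis has two faces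
  of area \<open>l ^ (CARD('n) - 1)\<close>, whence the constant passed to
  \<open>polar_gradient_exists\<close>.\<close>

lemma BV01_mean_exists:
  assumes l: "l > 0" and m: "0 \<le> m" "m \<le> 1"
  shows "\<exists>u :: real^'n \<Rightarrow> real. u \<in> BV01 l \<and> torus_mean l u = m"
proof -
  define i0 :: 'n where "i0 = undefined"
  define a where "a = m * l"
  have a: "0 \<le> a" "a \<le> l" using m l by (auto simp: a_def mult_le_cancel_right1)
  define u :: "real^'n \<Rightarrow> real" where "u x = slab l a (x $ i0)" for x
  let ?V = "l ^ (CARD('n) - 1)"
  have V: "l ^ CARD('n) = ?V * l" using l by (simp add: power_eq_if)
  have bp: "binary_periodic l u"
    unfolding binary_periodic_def
  proof (intro conjI allI)
    show "periodic l u" unfolding periodic_def u_def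
    proof (intro allI)
      fix x :: "real^'n" and i
      show "slab l a ((x + l *\<^sub>R axis i 1) $ i0) = slab l a (x $ i0)"
        using slab_periodic[OF l] by (cases "i = i0") (auto simp: axis_def)
    qed
    have "(\<lambda>x::real^'n. slab l a (x $ i0)) \<in> borel_measurable borel" by measurable
    then show "u \<in> borel_measurable (torus_measure l)" unfolding u_def by (rule torus_measure_borel_fun)
    show "u x \<in> {0, 1}" for x using slab_01 by (simp add: u_def)
  qed
  have A: "translation_diff l u ((1 / real (Suc n)) *\<^sub>R axis i 1) \<le> (2 * ?V) / real (Suc n)" for i n
  proof -
    define h where "h = (if i = i0 then 1 / real (Suc n) else 0)"
    have h: "0 \<le> h" "h \<le> 1 / real (Suc n)" by (auto simp: h_def)
    have "translation_diff l u ((1 / real (Suc n)) *\<^sub>R axis i 1) = (\<integral>x. \<bar>slab l a (x $ i0 + h) - slab l a (x $ i0)\<bar> \<partial>(torus_measure l :: (real^'n) measure))"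
      unfolding translation_diff_def u_def h_def by (intro Bochner_Integration.integral_cong) (auto simp: axis_def)
    also have "\<dots> = ?V * (LINT t:{0..<l}|lborel. \<bar>slab l a (t + h) - slab l a t\<bar>)"
      by (rule integral_torus_coordinate[OF l, where f = "\<lambda>t. \<bar>slab l a (t + h) - slab l a t\<bar>"]) measurable
    also have "\<dots> \<le> ?V * (2 * h)"
      using slab_shift_integral[OF l a h(1)] l by (intro mult_left_mono) auto
    also have "\<dots> \<le> ?V * (2 * (1 / real (Suc n)))" using h l by (intro mult_left_mono) auto
    finally show ?thesis by (simp add: mult.commute)
  qed
  have "u \<in> BV01 l"
    using polar_gradient_exists[OF l bp _ A] l by (intro BV01I[OF l bp]) simp
  moreover have "torus_mean l u = m"
  proof -
    have "(\<integral>x. u x \<partial>torus_measure l) = ?V * (LINT t:{0..<l}|lborel. slab l a t)"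
      unfolding u_def by (rule integral_torus_coordinate[OF l]) measurable
    also have "(LINT t:{0..<l}|lborel. slab l a t) = (\<integral>t. indicator {0..<a} t \<partial>lborel)"
      unfolding set_lebesgue_integral_def using a
      by (intro Bochner_Integration.integral_cong) (auto simp: indicator_def slab_eq)
    also have "\<dots> = a" using a by simp
    finally show ?thesis using l by (simp add: torus_mean_eq V a_def)
  qed
  ultimately show ?thesis by blast
qed

subsection \<open>The energy\<close>

text \<open>For \<open>u\<close> in \<open>BV01 l\<close> the gap is nonnegative by
  \<open>translation_diff_quotient_le\<close>, so \<open>ennreal\<close> truncates nothing; an
  infinite value of \<open>k\<close> causes no ambiguity.\<close>

definition near_energy :: "real \<Rightarrow> (real \<Rightarrow> ennreal) \<Rightarrow> (real^'n \<Rightarrow> real) \<Rightarrow> ennreal" where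
  "near_energy l k u = (\<integral>\<^sup>+z. k (norm z) * (indicator (ball 0 1) z *
     ennreal (directional_variation l u (z /\<^sub>R norm z) - translation_diff l u z / norm z)) \<partial>lborel)"

definition far_energy :: "real \<Rightarrow> (real \<Rightarrow> ennreal) \<Rightarrow> (real^'n \<Rightarrow> real) \<Rightarrow> ennreal" where
  "far_energy l k u = (\<integral>\<^sup>+z. k (norm z) * (indicator (- ball 0 1) z *
     ennreal (translation_diff l u z / norm z)) \<partial>lborel)"

lemma sets_borel_ball [measurable]: "ball a r \<in> sets (borel :: 'a::metric_space measure)"
  by (intro borel_open open_ball)

lemma translation_diff_quotient_le:
  assumes l: "l > 0" and u: "u \<in> BV01 l"
  shows "translation_diff l u z / norm z \<le> directional_variation l u (z /\<^sub>R norm z)"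
proof (cases "z = 0")
  case True
  then show ?thesis using directional_variation_nonneg[of l u 0] by simp
next
  case False
  have "directional_variation l u (norm z *\<^sub>R (z /\<^sub>R norm z)) = \<bar>norm z\<bar> * directional_variation l u (z /\<^sub>R norm z)"
    by (rule directional_variation_scaleR)
  then show ?thesis
    using translation_diff_le_directional_variation[OF l u, of z] False by (simp add: divide_le_eq mult.commute)
qed

text \<open>The kernel, hence \<open>c\<close>, may be infinite. Equality then fails in general: for
  positive \<open>f n\<close> tending to 0 the left side is 0 and the right side is
  infinite.\<close>

lemma ennreal_mult_liminf_le:
  fixes c :: ennreal
  shows "c * liminf f \<le> liminf (\<lambda>n. c * f n)"
proof -
  have "c * liminf f = (SUP n. c * (INF m\<in>{n..}. f m))"
    by (simp add: liminf_SUP_INF SUP_mult_left_ennreal)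
  also have "\<dots> \<le> (SUP n. INF m\<in>{n..}. c * f m)"
    by (intro SUP_mono' INF_greatest mult_left_mono INF_lower) auto
  finally show ?thesis by (simp add: liminf_SUP_INF)
qed

text \<open>The directional variation is the supremum over \<open>t\<close> of the quotients
  \<open>translation_diff l u (t *\<^sub>R \<omega>) / t\<close>, each of which converges along the
  sequence. One \<open>t\<close> nearly attaining the supremum for \<open>v\<close> is
  enough.\<close>

lemma gap_liminf:
  fixes v :: "real^'n \<Rightarrow> real"
  assumes l: "l > 0" and u: "\<And>n. u n \<in> BV01 l" and v: "v \<in> BV01 l"
    and lim: "\<And>z. (\<lambda>n. translation_diff l (u n) z) \<longlonglongrightarrow> translation_diff l v z"
  shows "ennreal (directional_variation l v \<omega> - translation_diff l v z / r)
    \<le> liminf (\<lambda>n. ennreal (directional_variation l (u n) \<omega> - translation_diff l (u n) z / r))"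
  unfolding le_Liminf_iff
proof (intro allI impI)
  let ?x = "directional_variation l v \<omega> - translation_diff l v z / r"
  fix y assume y: "y < ennreal ?x"
  then obtain y' where y': "y = ennreal y'" "y' \<ge> 0" by (cases y) auto
  then have y'x: "y' < ?x" using y by (simp add: ennreal_less_iff)
  \<comment> \<open>One \<open>e\<close> is lost in the variation and one in the quotient; a quarter
    of the distance leaves room for strict inequality.\<close>
  define e where "e = (?x - y') / 4"
  have "4 * e = ?x - y'" by (simp add: e_def)
  then have e: "e > 0" "y' < ?x - 2 * e" using y'x by linarith+
  have "\<exists>t>0. translation_diff l v (t *\<^sub>R \<omega>) > (directional_variation l v \<omega> - e) * t"
  proof (rule ccontr)
    assume "\<not> ?thesis"
    then have "translation_diff l v (t *\<^sub>R \<omega>) \<le> (directional_variation l v \<omega> - e) * t" if "t > 0" for t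
      using that by (meson not_less)
    then have "directional_variation l v \<omega> \<le> directional_variation l v \<omega> - e"
      by (rule directional_variation_le[OF l v])
    with e show False by simp
  qed
  then obtain t where t: "t > 0" "translation_diff l v (t *\<^sub>R \<omega>) > (directional_variation l v \<omega> - e) * t" by blast
  have ev1: "\<forall>\<^sub>F n in sequentially. translation_diff l (u n) (t *\<^sub>R \<omega>) > (directional_variation l v \<omega> - e) * t"
    using lim t(2) by (rule order_tendstoD(1))
  have "(\<lambda>n. translation_diff l (u n) z / r) \<longlonglongrightarrow> translation_diff l v z / r"
    unfolding divide_inverse by (intro tendsto_mult lim tendsto_const)
  then have ev2: "\<forall>\<^sub>F n in sequentially. translation_diff l (u n) z / r < translation_diff l v z / r + e"
    by (rule order_tendstoD(2)) (use e in auto)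
  show "\<forall>\<^sub>F n in sequentially. y < ennreal (directional_variation l (u n) \<omega> - translation_diff l (u n) z / r)"
    using ev1 ev2
  proof eventually_elim
    case (elim n)
    have "translation_diff l (u n) (t *\<^sub>R \<omega>) \<le> t * directional_variation l (u n) \<omega>"
      using translation_diff_le_directional_variation[OF l u, of n "t *\<^sub>R \<omega>"] directional_variation_scaleR[of l "u n" t \<omega>] t(1) by simp
    then have "t * (directional_variation l v \<omega> - e) < t * directional_variation l (u n) \<omega>"
      using elim(1) by (simp add: mult.commute)
    then have "directional_variation l v \<omega> - e < directional_variation l (u n) \<omega>"
      using t(1) by (simp add: mult_less_cancel_left_pos)
    then have "y' < directional_variation l (u n) \<omega> - translation_diff l (u n) z / r"
      using elim(2) e(2) by linarith
    then show ?case unfolding y' using y'(2) by (simp add: ennreal_less_iff)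
  qed
qed

lemma near_energy_liminf:
  fixes v :: "real^'n \<Rightarrow> real"
  assumes l: "l > 0" and u: "\<And>n. u n \<in> BV01 l" and v: "v \<in> BV01 l" and k[measurable]: "k \<in> borel_measurable borel"
    and lim: "\<And>z. (\<lambda>n. translation_diff l (u n) z) \<longlonglongrightarrow> translation_diff l v z"
  shows "near_energy l k v \<le> liminf (\<lambda>n. near_energy l k (u n))"
proof -
  let ?f = "\<lambda>n z. k (norm z) * (indicator (ball 0 1) z *
     ennreal (directional_variation l (u n) (z /\<^sub>R norm z) - translation_diff l (u n) z / norm z))"
  have m: "?f n \<in> borel_measurable lborel" for n
    using directional_variation_borel[OF l u, of n] translation_diff_borel[OF l u, of n] by measurable
  have "near_energy l k v \<le> (\<integral>\<^sup>+z. liminf (\<lambda>n. ?f n z) \<partial>lborel)"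
    unfolding near_energy_def
  proof (rule nn_integral_mono)
    fix z :: "real^'n"
    let ?g = "\<lambda>n. ennreal (directional_variation l (u n) (z /\<^sub>R norm z) - translation_diff l (u n) z / norm z)"
    let ?c = "k (norm z) * indicator (ball 0 1) z"
    have "?c * ennreal (directional_variation l v (z /\<^sub>R norm z) - translation_diff l v z / norm z) \<le> ?c * liminf ?g"
      by (intro mult_left_mono gap_liminf[OF l u v lim]) simp
    also have "\<dots> \<le> liminf (\<lambda>n. ?c * ?g n)" by (rule ennreal_mult_liminf_le)
    finally show "k (norm z) * (indicator (ball 0 1) z *
        ennreal (directional_variation l v (z /\<^sub>R norm z) - translation_diff l v z / norm z)) \<le> liminf (\<lambda>n. ?f n z)"
      by (simp add: mult.assoc)
  qed
  also have "\<dots> \<le> liminf (\<lambda>n. \<integral>\<^sup>+z. ?f n z \<partial>lborel)" using m by (rule nn_integral_liminf)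
  finally show ?thesis by (simp add: near_energy_def)
qed

text \<open>The majorant given by \<open>translation_diff_le_volume\<close>, independent of
  \<open>u\<close>.\<close>

definition far_bound :: "real \<Rightarrow> (real \<Rightarrow> ennreal) \<Rightarrow> real^'n \<Rightarrow> ennreal" where
  "far_bound l k z = k (norm z) * (indicator (- ball 0 1) z * ennreal (l ^ CARD('n) / norm z))"

lemma far_bound_borel:
  assumes [measurable]: "k \<in> borel_measurable borel"
  shows "far_bound l k \<in> borel_measurable (borel :: (real^'n) measure)"
  unfolding far_bound_def by measurable

lemma far_bound_finite:
  assumes l: "l > 0" and k[measurable]: "k \<in> borel_measurable borel"
    and tail: "(\<integral>\<^sup>+r. indicator {1..} r * (k r * ennreal (r ^ (CARD('n) - 1) / r)) \<partial>lborel) < \<infinity>"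
  shows "(\<integral>\<^sup>+z. far_bound l k (z :: real^'n) \<partial>lborel) < \<infinity>"
proof -
  let ?f = "\<lambda>r. indicator {1..} r * (k r * ennreal (1 / r)) :: ennreal"
  have "(\<integral>\<^sup>+z. far_bound l k (z :: real^'n) \<partial>lborel) = (\<integral>\<^sup>+z. ennreal (l ^ CARD('n)) * ?f (norm (z :: real^'n)) \<partial>lborel)"
    using l by (intro nn_integral_cong)
      (auto simp: far_bound_def indicator_def mult_ac ennreal_mult'[symmetric] not_less)
  also have "\<dots> = ennreal (l ^ CARD('n)) * (\<integral>\<^sup>+z. ?f (norm (z :: real^'n)) \<partial>lborel)"
    by (rule nn_integral_cmult) measurable
  also have "(\<integral>\<^sup>+z. ?f (norm (z :: real^'n)) \<partial>lborel) = ennreal (real DIM(real^'n) * unit_ball_vol (real DIM(real^'n))) *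
      (\<integral>\<^sup>+r. indicator {0<..} r * (?f r * ennreal (r ^ (DIM(real^'n) - 1))) \<partial>lborel)"
    by (rule nn_integral_radial_one) measurable
  also have "(\<integral>\<^sup>+r. indicator {0<..} r * (?f r * ennreal (r ^ (DIM(real^'n) - 1))) \<partial>lborel)
      = (\<integral>\<^sup>+r. indicator {1..} r * (k r * ennreal (r ^ (CARD('n) - 1) / r)) \<partial>lborel)"
    by (intro nn_integral_cong) (auto simp: indicator_def ennreal_mult'[symmetric] mult.assoc)
  finally show ?thesis using tail by (simp add: ennreal_mult_less_top)
qed

lemma far_energy_integrand_le:
  fixes u :: "real^'n \<Rightarrow> real"
  assumes l: "l > 0" and u: "u \<in> BV01 l"
  shows "k (norm z) * (indicator (- ball 0 1) z * ennreal (translation_diff l u z / norm z)) \<le> far_bound l k z"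
  unfolding far_bound_def
  by (intro mult_left_mono ennreal_leI divide_right_mono translation_diff_le_volume[OF l BV01_binary_periodic[OF u]]) auto

lemma far_energy_tendsto:
  fixes v :: "real^'n \<Rightarrow> real"
  assumes l: "l > 0" and u: "\<And>n. u n \<in> BV01 l" and v: "v \<in> BV01 l" and k[measurable]: "k \<in> borel_measurable borel"
    and tail: "(\<integral>\<^sup>+r. indicator {1..} r * (k r * ennreal (r ^ (CARD('n) - 1) / r)) \<partial>lborel) < \<infinity>"
    and lim: "\<And>z. (\<lambda>n. translation_diff l (u n) z) \<longlonglongrightarrow> translation_diff l v z"
  shows "(\<lambda>n. far_energy l k (u n)) \<longlonglongrightarrow> far_energy l k v"
  unfolding far_energy_def
proof (rule nn_integral_dominated_convergence[where w = "far_bound l k"])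
  have m: "(\<lambda>z. k (norm z) * (indicator (- ball 0 1) z * ennreal (translation_diff l w z / norm z))) \<in> borel_measurable lborel"
    if "w \<in> BV01 l" for w :: "real^'n \<Rightarrow> real"
    using translation_diff_borel[OF l that] by measurable
  show "(\<lambda>z. k (norm z) * (indicator (- ball 0 1) z * ennreal (translation_diff l (u i) z / norm z))) \<in> borel_measurable lborel" for i
    by (rule m[OF u])
  show "(\<lambda>z. k (norm z) * (indicator (- ball 0 1) z * ennreal (translation_diff l v z / norm z))) \<in> borel_measurable lborel"
    by (rule m[OF v])
  show bm: "far_bound l k \<in> borel_measurable (lborel :: (real^'n) measure)" using far_bound_borel[OF k] by simp
  show fin: "(\<integral>\<^sup>+z. far_bound l k (z :: real^'n) \<partial>lborel) < \<infinity>" by (rule far_bound_finite[OF l k tail])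
  show "AE z in lborel. k (norm z) * (indicator (- ball 0 1) z * ennreal (translation_diff l (u j) z / norm z)) \<le> far_bound l k z" for j
    by (intro AE_I2 far_energy_integrand_le[OF l u])
  have "AE z in lborel. far_bound l k (z :: real^'n) \<noteq> \<infinity>"
    by (rule nn_integral_PInf_AE[OF bm]) (use fin in auto)
  then show "AE z in lborel. (\<lambda>i. k (norm z) * (indicator (- ball 0 1) z * ennreal (translation_diff l (u i) z / norm z)))
      \<longlonglongrightarrow> k (norm z) * (indicator (- ball 0 1) z * ennreal (translation_diff l v z / norm z))"
  proof eventually_elim
    case (elim z)
    show ?case
    proof (cases "z \<in> ball 0 1")
      case False
      then have n1: "norm z \<ge> 1" by simp
      then have "ennreal (l ^ CARD('n) / norm z) \<noteq> 0"
        using l less_le_trans[OF zero_less_one n1] by (simp add: ennreal_eq_0_iff not_le)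
      \<comment> \<open>Multiplication by an infinite factor is not continuous at 0; integrability
        of the majorant excludes such a factor almost everywhere outside the ball.\<close>
      then have "k (norm z) \<noteq> \<infinity>" using elim False by (auto simp: far_bound_def ennreal_top_mult)
      then have kt: "k (norm z) < top" by (simp add: less_top)
      have "(\<lambda>i. translation_diff l (u i) z / norm z) \<longlonglongrightarrow> translation_diff l v z / norm z"
        unfolding divide_inverse by (intro tendsto_mult lim tendsto_const)
      then show ?thesis using False by (auto intro!: ennreal_tendsto_cmult[OF kt] tendsto_ennrealI)
    qed simp
  qed
qed

lemma far_energy_le:
  fixes u :: "real^'n \<Rightarrow> real"
  assumes "l > 0" "u \<in> BV01 l"
  shows "far_energy l k u \<le> (\<integral>\<^sup>+z. far_bound l k (z :: real^'n) \<partial>lborel)"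
  unfolding far_energy_def by (intro nn_integral_mono far_energy_integrand_le[OF assms])

text \<open>
  At distance at least \<open>\<delta>\<close> from the singularity the difference quotients are bounded, and the
  directional variations then control the total variation.
\<close>

lemma near_energy_coercive:
  assumes l: "l > 0" and k[measurable]: "k \<in> borel_measurable borel"
    and fin: "\<And>\<delta>. \<delta> > 0 \<Longrightarrow> (\<integral>\<^sup>+r. indicator {\<delta><..<1} r * (k r * ennreal (r ^ (CARD('n) - 1))) \<partial>lborel) < \<infinity>"
    and pos: "(\<integral>\<^sup>+r. indicator {0<..<1} r * (k r * ennreal (r ^ (CARD('n) - 1))) \<partial>lborel) \<noteq> 0"
    and b: "b < \<infinity>"
  shows "\<exists>C\<ge>0. \<forall>u :: real^'n \<Rightarrow> real. u \<in> BV01 l \<longrightarrow> near_energy l k u \<le> b \<longrightarrow> total_variation l u \<le> C"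
proof -
  let ?m = "\<lambda>\<delta>. \<integral>\<^sup>+r. indicator {\<delta><..<1} r * (k r * ennreal (r ^ (CARD('n) - 1))) \<partial>lborel"
  \<comment> \<open>The interval (0,1) is exhausted by the intervals from \<open>1 / Suc n\<close>
    to 1, so positive mass is already found away from 0.\<close>
  have "\<exists>\<delta>>0. ?m \<delta> \<noteq> 0"
  proof (rule ccontr)
    assume "\<not> ?thesis"
    then have z: "?m \<delta> = 0" if "\<delta> > 0" for \<delta> using that by auto
    have "AE r in lborel. indicator {1 / real (Suc n)<..<1} r * (k r * ennreal (r ^ (CARD('n) - 1))) = 0" for n
    proof -
      have "?m (1 / real (Suc n)) = 0" by (rule z) simp
      then show ?thesis by (subst (asm) nn_integral_0_iff_AE) auto
    qed
    then have "AE r in lborel. \<forall>n. indicator {1 / real (Suc n)<..<1} r * (k r * ennreal (r ^ (CARD('n) - 1))) = 0"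
      by (subst AE_all_countable) auto
    then have "AE r in lborel. indicator {0<..<1} r * (k r * ennreal (r ^ (CARD('n) - 1))) = 0"
    proof eventually_elim
      case (elim r)
      show ?case
      proof (cases "r \<in> {0<..<1}")
        case True
        then obtain n where "1 / real (Suc n) < r" using nat_approx_posE[of r] by auto
        then have "r \<in> {1 / real (Suc n)<..<1}" using True by auto
        then show ?thesis using elim[rule_format, of n] True by simp
      qed simp
    qed
    then have "?m 0 = 0" by (subst nn_integral_0_iff_AE) auto
    with pos show False by simp
  qed
  then obtain \<delta> where \<delta>: "\<delta> > 0" "?m \<delta> \<noteq> 0" by blast
  let ?f = "\<lambda>r. indicator {\<delta><..<1} r * k r :: ennreal"
  have fm[measurable]: "?f \<in> borel_measurable borel" by measurable
  have rad: "(\<integral>\<^sup>+r. indicator {0<..} r * (?f r * ennreal (r ^ (CARD('n) - 1))) \<partial>lborel) = ?m \<delta>"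
    using \<delta>(1) by (intro nn_integral_cong) (auto simp: indicator_def)
  let ?S = "\<integral>\<^sup>+z. ?f (norm (z :: real^'n)) \<partial>lborel"
  have S: "?S < \<infinity>"
    using fin[OF \<delta>(1)] rad by (subst nn_integral_radial_one[OF fm]) (simp add: ennreal_mult_less_top)
  \<comment> \<open>The bound on the near energy plus the most that the difference quotients can
    contribute on the annulus, where they are at most
    \<open>l ^ CARD('n) / \<delta>\<close>.\<close>
  let ?B = "b + ennreal (l ^ CARD('n) / \<delta>) * ?S"
  have Bf: "?B < \<infinity>" using b S by (simp add: ennreal_mult_less_top)
  define W where "W = 2 * unit_ball_vol (real CARD('n) - 1)"
  have W: "W > 0"
    unfolding W_def by (intro mult_pos_pos unit_ball_vol_pos) (simp_all add: Suc_leI)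
  \<comment> \<open>The factor that multiplies the total variation when the directional variations
    are integrated over the annulus.\<close>
  let ?c = "ennreal W * ?m \<delta>"
  have c0: "?c \<noteq> 0" "?c \<noteq> \<infinity>"
    using W \<delta>(2) fin[OF \<delta>(1)] by (auto simp: ennreal_mult_eq_top_iff)
  obtain c where c: "?c = ennreal c" "c > 0"
  proof (cases ?c)
    case (real c)
    with c0(1) have "c \<noteq> 0" by auto
    with real show thesis by (intro that[of c]) auto
  qed (use c0(2) in auto)
  obtain B where B: "?B = ennreal B" "B \<ge> 0" using Bf by (cases ?B) auto
  have "total_variation l u \<le> B / c" if u: "u \<in> BV01 l" and J: "near_energy l k u \<le> b" for u :: "real^'n \<Rightarrow> real"
  proof -
    let ?D = "\<lambda>z. directional_variation l u (z /\<^sub>R norm z)" and ?A = "\<lambda>z. translation_diff l u z / norm z"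
    note [measurable] = directional_variation_borel[OF l u] translation_diff_borel[OF l u]
    have "ennreal (total_variation l u) * ?c = (\<integral>\<^sup>+z. ?f (norm z) * ennreal (?D z) \<partial>lborel)"
      unfolding nn_integral_radial_directional_variation[OF l u fm] rad W_def[symmetric] by (simp add: mult_ac)
    also have "\<dots> \<le> (\<integral>\<^sup>+z. k (norm z) * (indicator (ball 0 1) z * ennreal (?D z - ?A z)) + ennreal (l ^ CARD('n) / \<delta>) * ?f (norm z) \<partial>lborel)"
    proof (rule nn_integral_mono)
      fix z :: "real^'n"
      show "?f (norm z) * ennreal (?D z) \<le> k (norm z) * (indicator (ball 0 1) z * ennreal (?D z - ?A z)) + ennreal (l ^ CARD('n) / \<delta>) * ?f (norm z)"
      proof (cases "\<delta> < norm z \<and> norm z < 1")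
        case True
        then have "?A z \<le> l ^ CARD('n) / \<delta>"
          using translation_diff_le_volume[OF l BV01_binary_periodic[OF u], of z] translation_diff_nonneg[of l u z] \<delta>(1) l
          by (intro frac_le) auto
        then have "ennreal (?D z) \<le> ennreal ((?D z - ?A z) + l ^ CARD('n) / \<delta>)" by (intro ennreal_leI) simp
        also have "\<dots> = ennreal (?D z - ?A z) + ennreal (l ^ CARD('n) / \<delta>)"
          using translation_diff_quotient_le[OF l u, of z] l \<delta>(1) by (intro ennreal_plus) auto
        finally have "k (norm z) * ennreal (?D z) \<le> k (norm z) * (ennreal (?D z - ?A z) + ennreal (l ^ CARD('n) / \<delta>))"
          by (rule mult_left_mono) simp
        then show ?thesis using True by (simp add: distrib_left mult_ac)
      qed auto
    qed
    also have "\<dots> = near_energy l k u + ennreal (l ^ CARD('n) / \<delta>) * ?S"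
      unfolding near_energy_def by (subst nn_integral_add, measurable, subst nn_integral_cmult, measurable)
    also have "\<dots> \<le> ?B" using J by (intro add_right_mono)
    finally have "ennreal (total_variation l u * c) \<le> ennreal B"
      unfolding c B using c(2) by (simp add: ennreal_mult'' total_variation_nonneg)
    then have "total_variation l u * c \<le> B" using B(2) by (simp add: ennreal_le_iff)
    then show ?thesis using c(2) by (simp add: pos_le_divide_eq)
  qed
  moreover have "B / c \<ge> 0" using B(2) c(2) by simp
  ultimately show ?thesis by blast
qed

text \<open>The bound \<open>C * norm z\<close> on translation differences survives the L1 limit,
  and \<open>polar_gradient_exists\<close> turns it into a gradient of the limit. The mean is
  continuous under L1 convergence.\<close>

lemma BV01_mean_compact:
  fixes u :: "nat \<Rightarrow> real^'n \<Rightarrow> real"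
  assumes l: "l > 0" and u: "\<And>n. u n \<in> BV01 l" "\<And>n. torus_mean l (u n) = m"
    and C: "C \<ge> 0" "\<And>n. total_variation l (u n) \<le> C"
  shows "\<exists>r v. strict_mono r \<and> v \<in> BV01 l \<and> torus_mean l v = m \<and>
    (\<forall>z. (\<lambda>n. translation_diff l (u (r n)) z) \<longlonglongrightarrow> translation_diff l v z)"
proof -
  have bp: "binary_periodic l (u n)" for n by (rule BV01_binary_periodic[OF u(1)])
  have A: "translation_diff l (u n) z \<le> C * norm z" for n z
    using translation_diff_le_total_variation[OF l u(1), of n z] mult_right_mono[OF C(2), of "norm z" n] by simp
  obtain r v where r: "strict_mono r" "binary_periodic l v" "(\<lambda>n. \<integral>x. \<bar>u (r n) x - v x\<bar> \<partial>torus_measure l) \<longlonglongrightarrow> 0"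
    using binary_periodic_compact[of l u, OF l bp C(1) A] by blast
  have lim: "(\<lambda>n. translation_diff l (u (r n)) z) \<longlonglongrightarrow> translation_diff l v z" for z
    by (rule translation_diff_tendsto[OF l bp r(2,3)])
  have vA: "translation_diff l v z \<le> C * norm z" for z
    using lim by (rule LIMSEQ_le_const2) (use A in auto)
  \<comment> \<open>The constant has to be positive, and \<open>C\<close> may be 0; hence
    \<open>C + 1\<close>.\<close>
  have "translation_diff l v ((1 / real (Suc n)) *\<^sub>R axis i 1) \<le> (C + 1) / real (Suc n)" for i n
  proof -
    have "translation_diff l v ((1 / real (Suc n)) *\<^sub>R axis i 1) \<le> C * (1 / real (Suc n))"
      using vA[of "(1 / real (Suc n)) *\<^sub>R axis i 1"] by simp
    also have "\<dots> \<le> (C + 1) / real (Suc n)" by (simp add: divide_right_mono)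
    finally show ?thesis .
  qed
  then have v: "v \<in> BV01 l"
    using C(1) by (intro BV01I[OF l r(2)] polar_gradient_exists[OF l r(2), of "C + 1"]) auto
  have i: "integrable (torus_measure l) w" if "binary_periodic l w" for w :: "real^'n \<Rightarrow> real"
    using binary_periodicD(2,6)[OF that] by (intro integrable_torus_bounded[OF l, of _ 1]) auto
  have "norm ((\<integral>x. u (r n) x \<partial>torus_measure l) - (\<integral>x. v x \<partial>torus_measure l)) \<le> (\<integral>x. \<bar>u (r n) x - v x\<bar> \<partial>torus_measure l)" for n
    using integral_abs_bound[of "torus_measure l" "\<lambda>x. u (r n) x - v x"] i[OF bp] i[OF r(2)] by simp
  then have "(\<lambda>n. (\<integral>x. u (r n) x \<partial>torus_measure l) - (\<integral>x. v x \<partial>torus_measure l)) \<longlonglongrightarrow> 0"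
    using r(3) by (intro Lim_null_comparison[OF always_eventually[OF allI] r(3)])
  moreover have "(\<integral>x. u (r n) x \<partial>torus_measure l) = m * l ^ CARD('n)" for n
    using u(2)[of "r n"] l by (simp add: torus_mean_eq field_simps)
  ultimately have "(\<lambda>n::nat. m * l ^ CARD('n) - (\<integral>x. v x \<partial>torus_measure l)) \<longlonglongrightarrow> 0" by simp
  then have "m * l ^ CARD('n) - (\<integral>x. v x \<partial>torus_measure l) = 0"
    by (simp only: LIMSEQ_const_iff)
  then have "torus_mean l v = m" using l by (simp add: torus_mean_eq field_simps)
  with r(1) v lim show ?thesis by blast
qed

text \<open>Along a minimizing sequence the far parts converge, hence so do the near parts, and
  semicontinuity is asked of the latter only. The infimum is taken in the extended reals: near
  energies may be infinite, far energies are bounded by one constant \<open>Nb\<close>.\<close>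

theorem minimizer_exists:
  assumes l: "l > 0" and m: "0 \<le> m" "m \<le> 1" and k: "k \<in> borel_measurable borel"
    and tail: "(\<integral>\<^sup>+r. indicator {1..} r * (k r * ennreal (r ^ (CARD('n) - 1) / r)) \<partial>lborel) < \<infinity>"
    and fin: "\<And>\<delta>. \<delta> > 0 \<Longrightarrow> (\<integral>\<^sup>+r. indicator {\<delta><..<1} r * (k r * ennreal (r ^ (CARD('n) - 1))) \<partial>lborel) < \<infinity>"
    and pos: "(\<integral>\<^sup>+r. indicator {0<..<1} r * (k r * ennreal (r ^ (CARD('n) - 1))) \<partial>lborel) \<noteq> 0"
  shows "\<exists>u :: real^'n \<Rightarrow> real. u \<in> BV01 l \<and> torus_mean l u = m \<and>
    (\<forall>v :: real^'n \<Rightarrow> real. v \<in> BV01 l \<longrightarrow> torus_mean l v = m \<longrightarrow>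
      enn2ereal (near_energy l k u) - enn2ereal (far_energy l k u) \<le>
      enn2ereal (near_energy l k v) - enn2ereal (far_energy l k v))"
proof -
  let ?F = "\<lambda>u :: real^'n \<Rightarrow> real. enn2ereal (near_energy l k u) - enn2ereal (far_energy l k u)"
  define P where "P = {u :: real^'n \<Rightarrow> real. u \<in> BV01 l \<and> torus_mean l u = m}"
  have P0: "P \<noteq> {}" using BV01_mean_exists[OF l m, where 'n = 'n] by (auto simp: P_def)
  define I where "I = Inf (?F ` P)"
  have I_le: "I \<le> ?F v" if "v \<in> P" for v unfolding I_def using that by (intro Inf_lower) auto
  obtain Nb where Nb: "(\<integral>\<^sup>+z. far_bound l k (z :: real^'n) \<partial>lborel) = ennreal Nb" "Nb \<ge> 0"
    using far_bound_finite[OF l k tail] by (cases "\<integral>\<^sup>+z. far_bound l k (z :: real^'n) \<partial>lborel") auto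
  have N_le: "far_energy l k v \<le> ennreal Nb" if "v \<in> P" for v
    using far_energy_le[OF l, of v k] that Nb by (auto simp: P_def)
  have N_real: "\<exists>a\<ge>0. a \<le> Nb \<and> far_energy l k v = ennreal a" if "v \<in> P" for v
    using N_le[OF that] Nb(2) by (cases "far_energy l k v") (auto simp: ennreal_le_iff top_unique)
  have "\<exists>u\<in>P. ?F u \<le> I"
  proof (cases "I = \<infinity>")
    \<comment> \<open>If the infimum is plus infinity, every admissible function is a
      minimizer.\<close>
    case True
    then show ?thesis using P0 by auto
  next
    case False
    have "\<exists>f. (\<forall>n. f n \<in> ?F ` P) \<and> f \<longlonglongrightarrow> I" unfolding I_def using P0 by (intro Inf_as_limit) auto
    then obtain f where f: "\<And>n. f n \<in> ?F ` P" "f \<longlonglongrightarrow> I" by blast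
    have "\<exists>w. w \<in> P \<and> f n = ?F w" for n using f(1)[of n] by auto
    then obtain w0 where w0: "\<And>n. w0 n \<in> P" "\<And>n. f n = ?F (w0 n)" by metis
    \<comment> \<open>At this point \<open>I\<close> may still be minus infinity, for which the
      witness is 0.\<close>
    obtain c where c: "I < ereal c" using False by (cases I) (auto intro: that[of "real_of_ereal I + 1"] that[of 0])
    have "\<forall>\<^sub>F n in sequentially. f n < ereal c" using f(2) c by (rule order_tendstoD(2))
    then obtain n0 where n0: "\<And>n. n \<ge> n0 \<Longrightarrow> f n < ereal c" by (auto simp: eventually_sequentially)
    define w where "w n = w0 (n + n0)" for n
    have wP: "w n \<in> P" for n using w0 by (simp add: w_def)
    have wF: "(\<lambda>n. ?F (w n)) \<longlonglongrightarrow> I"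
      unfolding w_def w0(2)[symmetric] using f(2) by (rule LIMSEQ_ignore_initial_segment)
    have wc: "?F (w n) < ereal c" for n unfolding w_def w0(2)[symmetric] by (rule n0) simp
    have J: "near_energy l k (w n) \<le> ennreal (max 0 (c + Nb))" for n
    proof -
      obtain a where a: "a \<ge> 0" "a \<le> Nb" "far_energy l k (w n) = ennreal a" using N_real[OF wP] by blast
      show ?thesis
      proof (cases "near_energy l k (w n)")
        case (real j)
        then have "ereal (j - a) < ereal c" using wc[of n] a by (simp add: enn2ereal_ennreal)
        then have "j \<le> max 0 (c + Nb)" using a by simp
        then show ?thesis unfolding real by (rule ennreal_leI)
      next
        case top
        then show ?thesis using wc[of n] a by (simp add: enn2ereal_ennreal)
      qed
    qed
    have wB: "w n \<in> BV01 l" "torus_mean l (w n) = m" for n using wP[of n] by (auto simp: P_def)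
    obtain C where C: "C \<ge> 0" "\<And>u :: real^'n \<Rightarrow> real. u \<in> BV01 l \<Longrightarrow> near_energy l k u \<le> ennreal (max 0 (c + Nb)) \<Longrightarrow> total_variation l u \<le> C"
      using near_energy_coercive[OF l k fin pos, of "ennreal (max 0 (c + Nb))"] by auto
    have TV: "total_variation l (w n) \<le> C" for n by (rule C(2)[OF wB(1) J])
    obtain r v where r: "strict_mono r" "v \<in> BV01 l" "torus_mean l v = m"
      "\<And>z. (\<lambda>n. translation_diff l (w (r n)) z) \<longlonglongrightarrow> translation_diff l v z"
      using BV01_mean_compact[of l w, OF l wB C(1) TV] by blast
    have vP: "v \<in> P" using r by (simp add: P_def)
    obtain a where a: "a \<ge> 0" "a \<le> Nb" "far_energy l k v = ennreal a" using N_real[OF vP] by blast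
    have J_le: "near_energy l k v \<le> liminf (\<lambda>n. near_energy l k (w (r n)))"
      by (rule near_energy_liminf[OF l wB(1) r(2) k r(4)])
    have "\<exists>j. j \<ge> 0 \<and> near_energy l k (w n) = ennreal j" for n
      using J[of n] by (cases "near_energy l k (w n)") (auto simp: top_unique)
    then obtain j where j: "\<And>n. j n \<ge> 0" "\<And>n. near_energy l k (w n) = ennreal (j n)" by metis
    obtain a' where a': "\<And>n. a' n \<ge> 0" "\<And>n. a' n \<le> Nb" "\<And>n. far_energy l k (w n) = ennreal (a' n)"
      using N_real[OF wP] by metis
    have F: "?F (w n) = ereal (j n - a' n)" for n
      using j(1)[of n] a'(1)[of n] by (simp add: j(2) a'(3) enn2ereal_ennreal)
    have "- Nb \<le> j n - a' n" for n using j(1)[of n] a'(2)[of n] by linarith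
    then have "ereal (- Nb) \<le> ?F (w n)" for n unfolding F by simp
    \<comment> \<open>This lower bound makes the infimum a real number, so that the limits can be
      taken in the reals.\<close>
    then have "ereal (- Nb) \<le> I"
      using wF by (intro LIMSEQ_le_const) auto
    then obtain i where i: "I = ereal i" using False by (cases I) auto
    have "(\<lambda>n. far_energy l k (w (r n))) \<longlonglongrightarrow> far_energy l k v"
      by (rule far_energy_tendsto[OF l wB(1) r(2) k tail r(4)])
    then have alim: "(\<lambda>n. a' (r n)) \<longlonglongrightarrow> a"
      using a(1) a'(1) unfolding a'(3) a(3) by (subst (asm) tendsto_ennreal_iff) auto
    have "(\<lambda>n. ?F (w (r n))) \<longlonglongrightarrow> I"
      using LIMSEQ_subseq_LIMSEQ[OF wF r(1)] by (simp add: o_def)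
    then have "(\<lambda>n. j (r n) - a' (r n)) \<longlonglongrightarrow> i" unfolding F i by simp
    \<comment> \<open>Adding the far part back: the near energies converge to \<open>i + a\<close>,
      where \<open>a\<close> is the far energy of the limit \<open>v\<close>.\<close>
    from tendsto_add[OF this alim] have jlim: "(\<lambda>n. j (r n)) \<longlonglongrightarrow> i + a" by simp
    have nonneg: "0 \<le> i + a" using jlim by (rule LIMSEQ_le_const) (use j(1) in auto)
    have "(\<lambda>n. near_energy l k (w (r n))) \<longlonglongrightarrow> ennreal (i + a)"
      unfolding j(2) using jlim by (rule tendsto_ennrealI)
    then have "near_energy l k v \<le> ennreal (i + a)"
      using J_le lim_imp_Liminf[OF sequentially_bot, of "\<lambda>n. near_energy l k (w (r n))"] by simp
    then obtain j' where j': "j' \<ge> 0" "near_energy l k v = ennreal j'" "j' \<le> i + a"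
      using nonneg by (cases "near_energy l k v") (auto simp: top_unique ennreal_le_iff)
    then have "?F v \<le> I" using a(1) by (simp add: a(3) i enn2ereal_ennreal)
    then show ?thesis using vP by blast
  qed
  then obtain u where u: "u \<in> P" "?F u \<le> I" by (rule bexE)
  have "?F u \<le> ?F v" if "v \<in> BV01 l" "torus_mean l v = m" for v
    using that by (intro order_trans[OF u(2) I_le]) (simp add: P_def)
  then show ?thesis using u(1) unfolding P_def by (intro exI[of _ u]) simp
qed

section \<open>Both energies as a multiple of near minus far part\<close>

lemma e2ennreal_mult_ereal: "e2ennreal (enn2ereal a * ereal x) = a * ennreal x"
proof (cases "x \<ge> 0")
  case True
  then have "enn2ereal a * ereal x = enn2ereal (a * ennreal x)"
    by (simp add: times_ennreal.rep_eq)
  then show ?thesis by simp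
next
  case False
  then have "enn2ereal a * ereal x \<le> 0"
    by (simp add: ereal_mult_le_0_iff)
  then show ?thesis using False by (simp add: e2ennreal_neg ennreal_neg)
qed

text \<open>The gap is nonnegative in the ball and the integrand is nonpositive outside, so the
  positive and negative parts of the integrand are, up to a factor, the near and far integrands. The
  factor collects 1/2 from the definition and \<open>1 / l ^ CARD('n)\<close> from the means;
  \<open>far\<close> excludes infinity minus infinity.\<close>

lemma energy_zero_eq:
  fixes u :: "real^'n \<Rightarrow> real"
  assumes l: "l > 0" and u: "u \<in> BV01 l" and k[measurable]: "k \<in> borel_measurable borel"
    and ae: "AE z::real^'n in lborel. K\<^sub>0 (norm z) = k (norm z)"
    and far: "far_energy l k u < \<infinity>"
  shows "energy_zero l K\<^sub>0 u = ereal (1 / (2 * l ^ CARD('n))) *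
    (enn2ereal (near_energy l k u) - enn2ereal (far_energy l k u))"
proof -
  note [measurable] = directional_variation_borel[OF l u] translation_diff_borel[OF l u]
  define c where "c = 1 / l ^ CARD('n)"
  have c: "c > 0" using l by (simp add: c_def)
  define D T where "D z = directional_variation l u (z /\<^sub>R norm z)" and "T z = translation_diff l u z / norm z"
    for z :: "real^'n"
  have T: "0 \<le> T z" "T z \<le> D z" for z
    using translation_diff_quotient_le[OF l u] by (auto simp: T_def D_def translation_diff_nonneg)
  define f where "f z = enn2ereal (K\<^sub>0 (norm z)) * ereal (c * (D z * indicat_real (ball 0 1) z - T z))" for z
  have e: "energy_zero l K\<^sub>0 u = ereal (1/2) * ereal_integral lebesgue f"
    unfolding energy_zero_def f_def torus_mean_translation_diff
    by (intro arg_cong[where f = "\<lambda>f. ereal (1/2) * ereal_integral lebesgue f"] ext arg_cong2[where f = times] refl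
        arg_cong[where f = ereal]) (simp add: D_def T_def c_def right_diff_distrib divide_inverse mult_ac)
  have 1: "e2ennreal (f z) = ennreal c * (K\<^sub>0 (norm z) * (indicator (ball 0 1) z * ennreal (D z - T z)))" for z
    using T[of z] c unfolding f_def e2ennreal_mult_ereal
    by (auto simp: indicator_def ennreal_neg ennreal_mult' mult_ac)
  have "- f z = enn2ereal (K\<^sub>0 (norm z)) * ereal (c * (T z - D z * indicat_real (ball 0 1) z))" for z
  proof -
    have "- (ereal (c * (D z * indicat_real (ball 0 1) z - T z))) = ereal (c * (T z - D z * indicat_real (ball 0 1) z))"
      by (simp add: algebra_simps)
    then show ?thesis unfolding f_def by (metis ereal_mult_minus_right)
  qed
  then have "e2ennreal (- f z) = K\<^sub>0 (norm z) * ennreal (c * (T z - D z * indicat_real (ball 0 1) z))" for z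
    by (simp only: e2ennreal_mult_ereal)
  then have 2: "e2ennreal (- f z) = ennreal c * (K\<^sub>0 (norm z) * (indicator (- ball 0 1) z * ennreal (T z)))" for z
    using T[of z] c
    by (auto simp: indicator_def ennreal_neg ennreal_mult' mult_nonneg_nonpos mult_ac)
  have 3: "(\<integral>\<^sup>+z. e2ennreal (f z) \<partial>lebesgue) = ennreal c * near_energy l k u"
  proof -
    have "(\<integral>\<^sup>+z. e2ennreal (f z) \<partial>lborel) =
      (\<integral>\<^sup>+z. ennreal c * (k (norm z) * (indicator (ball 0 1) z * ennreal (D z - T z))) \<partial>lborel)"
      unfolding 1 using ae by (intro nn_integral_cong_AE) auto
    also have "\<dots> = ennreal c * near_energy l k u"
      unfolding near_energy_def D_def T_def by (intro nn_integral_cmult) measurable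
    finally show ?thesis by (simp add: nn_integral_completion)
  qed
  have 4: "(\<integral>\<^sup>+z. e2ennreal (- f z) \<partial>lebesgue) = ennreal c * far_energy l k u"
  proof -
    have "(\<integral>\<^sup>+z. e2ennreal (- f z) \<partial>lborel) =
      (\<integral>\<^sup>+z. ennreal c * (k (norm z) * (indicator (- ball 0 1) z * ennreal (T z))) \<partial>lborel)"
      unfolding 2 using ae by (intro nn_integral_cong_AE) auto
    also have "\<dots> = ennreal c * far_energy l k u"
      unfolding far_energy_def T_def by (intro nn_integral_cmult) measurable
    finally show ?thesis by (simp add: nn_integral_completion)
  qed
  obtain b where b: "far_energy l k u = ennreal b" "b \<ge> 0" using far by (cases "far_energy l k u") auto
  have h: "1 / (2 * l ^ CARD('n)) = c / 2" by (simp add: c_def)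
  show ?thesis
    unfolding e ereal_integral_def 3 4 h b(1)
    using c b(2)
    by (cases "near_energy l k u") (auto simp: ennreal_mult'[symmetric] ennreal_mult_top algebra_simps top_ereal_def)
qed

text \<open>The Bochner integral of a function that is not integrable is 0, so a positive mass
  certifies integrability, and the value agrees with the nonnegative integral. The endpoints 0 and 1
  are null.\<close>

lemma kernel_mass_nn_integral:
  assumes k: "AE r in lborel. r > 0 \<longrightarrow> ennreal (K r) = k r" and nonneg: "\<And>r. r \<ge> 0 \<Longrightarrow> K r \<ge> 0"
    and mass_pos: "kernel_mass d K > 0"
  shows "ennreal (LINT t:{0..1}|lebesgue. K t * t ^ (d - 1)) =
    (\<integral>\<^sup>+r. indicator {0<..<1} r * (k r * ennreal (r ^ (d - 1))) \<partial>lborel)"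
    (is "ennreal ?L = _")
    and "0 < (LINT t:{0..1}|lebesgue. K t * t ^ (d - 1))"
proof -
  have "?L \<noteq> 0" using mass_pos by (auto simp: kernel_mass_def)
  then have i: "integrable lebesgue (\<lambda>t. indicat_real {0..1} t * (K t * t ^ (d - 1)))"
    using not_integrable_integral_eq by (auto simp: set_lebesgue_integral_def)
  have nn: "0 \<le> indicat_real {0..1} t * (K t * t ^ (d - 1))" for t
    using nonneg[of t] by (auto simp: indicator_def)
  have "?L \<ge> 0" unfolding set_lebesgue_integral_def using nn by (intro Bochner_Integration.integral_nonneg) simp
  with \<open>?L \<noteq> 0\<close> show "0 < ?L" by simp
  have "ennreal ?L = (\<integral>\<^sup>+t. ennreal (indicat_real {0..1} t * (K t * t ^ (d - 1))) \<partial>lebesgue)"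
    using nn_integral_eq_integral[OF i] nn by (simp add: set_lebesgue_integral_def)
  also have "\<dots> = (\<integral>\<^sup>+t. ennreal (indicat_real {0..1} t * (K t * t ^ (d - 1))) \<partial>lborel)"
    by (rule nn_integral_completion)
  also have "\<dots> = (\<integral>\<^sup>+r. indicator {0<..<1} r * (k r * ennreal (r ^ (d - 1))) \<partial>lborel)"
  proof (rule nn_integral_cong_AE)
    show "AE t in lborel. ennreal (indicat_real {0..1} t * (K t * t ^ (d - 1))) = indicator {0<..<1} t * (k t * ennreal (t ^ (d - 1)))"
      using k AE_lborel_singleton[of "0::real"] AE_lborel_singleton[of "1::real"]
    proof eventually_elim
      case (elim t)
      then show ?case using nonneg[of t] by (auto simp: indicator_def ennreal_mult)
    qed
  qed
  finally show "ennreal ?L = (\<integral>\<^sup>+r. indicator {0<..<1} r * (k r * ennreal (r ^ (d - 1))) \<partial>lborel)" .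
qed

text \<open>By the radial formula the total variation term is \<open>c\<close> times
  \<open>Y\<close>, the kernel integrated against the directional variations over the ball.
  \<open>Y\<close> splits into the near energy and \<open>X\<close>, and \<open>X\<close> cancels
  against the part of the double integral inside the ball.\<close>

lemma energy_pos_eq:
  fixes u :: "real^'n \<Rightarrow> real"
  assumes l: "l > 0" and u: "u \<in> BV01 l" and k[measurable]: "k \<in> borel_measurable borel"
    and ae: "AE z::real^'n in lborel. ennreal (K (norm z)) = k (norm z)"
    and ae1: "AE r in lborel. r > 0 \<longrightarrow> ennreal (K r) = k r"
    and nonneg: "\<And>r. r \<ge> 0 \<Longrightarrow> K r \<ge> 0" and mass_pos: "kernel_mass CARD('n) K > 0"
    and far: "far_energy l k u < \<infinity>"
  shows "energy_pos l K u = ereal (1 / (2 * l ^ CARD('n))) *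
    (enn2ereal (near_energy l k u) - enn2ereal (far_energy l k u))"
proof -
  note [measurable] = directional_variation_borel[OF l u] translation_diff_borel[OF l u]
  define c where "c = 1 / (2 * l ^ CARD('n))"
  have c: "c > 0" using l by (simp add: c_def)
  define D T where "D z = directional_variation l u (z /\<^sub>R norm z)" and "T z = translation_diff l u z / norm z"
    for z :: "real^'n"
  have T: "0 \<le> T z" "T z \<le> D z" for z
    using translation_diff_quotient_le[OF l u] by (auto simp: T_def D_def translation_diff_nonneg)
  have [measurable]: "D \<in> borel_measurable borel" "T \<in> borel_measurable borel"
    unfolding D_def[abs_def] T_def[abs_def] by measurable
  let ?L = "LINT t:{0..1}|lebesgue. K t * t ^ (CARD('n) - 1)"
  have mass: "ennreal ?L = (\<integral>\<^sup>+r. indicator {0<..<1} r * (k r * ennreal (r ^ (CARD('n) - 1))) \<partial>lborel)" "0 < ?L"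
    using kernel_mass_nn_integral[of K k "CARD('n)"] ae1 nonneg mass_pos by auto
  define X where "X = (\<integral>\<^sup>+z. k (norm z) * (indicator (ball 0 1) z * ennreal (T z)) \<partial>lborel)"
  define Y where "Y = (\<integral>\<^sup>+z. k (norm z) * (indicator (ball 0 1) z * ennreal (D z)) \<partial>lborel)"
  have Y: "Y = near_energy l k u + X"
  proof -
    have "near_energy l k u + X = (\<integral>\<^sup>+z. k (norm z) * (indicator (ball 0 1) z * ennreal (D z - T z)) +
        k (norm z) * (indicator (ball 0 1) z * ennreal (T z)) \<partial>lborel)"
      unfolding near_energy_def X_def D_def[symmetric] T_def[symmetric] by (intro nn_integral_add[symmetric]) measurable
    also have "\<dots> = Y"
      unfolding Y_def using T by (intro nn_integral_cong) (simp add: distrib_left[symmetric] ennreal_plus[symmetric] del: ennreal_plus)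
    finally show ?thesis by simp
  qed
  have M: "kernel_mass CARD('n) K / l ^ CARD('n) * total_variation l u
      = c * (2 * unit_ball_vol (real CARD('n) - 1) * total_variation l u * ?L)"
    by (simp add: kernel_mass_def c_def field_simps)
  have Y_eq: "Y = ennreal (2 * unit_ball_vol (real CARD('n) - 1) * total_variation l u * ?L)"
  proof -
    have "Y = (\<integral>\<^sup>+z. (k (norm z) * indicator {..<1} (norm z)) * ennreal (directional_variation l u (z /\<^sub>R norm z)) \<partial>lborel)"
      unfolding Y_def D_def by (intro nn_integral_cong) (auto simp: indicator_def)
    also have "\<dots> = ennreal (2 * unit_ball_vol (real CARD('n) - 1)) * ennreal (total_variation l u) *
        (\<integral>\<^sup>+r. indicator {0<..} r * ((k r * indicator {..<1} r) * ennreal (r ^ (CARD('n) - 1))) \<partial>lborel)"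
      by (rule nn_integral_radial_directional_variation[OF l u]) measurable
    also have "(\<integral>\<^sup>+r. indicator {0<..} r * ((k r * indicator {..<1} r) * ennreal (r ^ (CARD('n) - 1))) \<partial>lborel) = ennreal ?L"
      unfolding mass(1) by (intro nn_integral_cong) (auto simp: indicator_def)
    finally show ?thesis
      using mass(2) total_variation_nonneg[of l u] by (simp add: ennreal_mult)
  qed
  have far_eq: "(\<integral>\<^sup>+z. ennreal (K (norm z) * torus_mean l (\<lambda>x. \<bar>u (x + z) - u x\<bar> / (2 * norm z))) \<partial>lebesgue)
      = ennreal c * (X + far_energy l k u)"
  proof -
    have "(\<integral>\<^sup>+z. ennreal (K (norm z) * torus_mean l (\<lambda>x. \<bar>u (x + z) - u x\<bar> / (2 * norm z))) \<partial>lborel)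
      = (\<integral>\<^sup>+z. ennreal c * (k (norm z) * (indicator (ball 0 1) z * ennreal (T z)) +
          k (norm z) * (indicator (- ball 0 1) z * ennreal (T z))) \<partial>lborel)"
    proof (rule nn_integral_cong_AE, use ae in eventually_elim)
      case (elim z)
      have "K (norm z) * torus_mean l (\<lambda>x. \<bar>u (x + z) - u x\<bar> / (2 * norm z)) = c * (K (norm z) * T z)"
        unfolding torus_mean_translation_diff by (simp add: c_def T_def)
      also have "ennreal \<dots> = ennreal c * (k (norm z) * ennreal (T z))"
        using c T[of z] nonneg[of "norm z"] by (simp add: ennreal_mult elim)
      finally show ?case by (auto simp: indicator_def)
    qed
    also have "\<dots> = ennreal c * (X + far_energy l k u)"
      unfolding X_def far_energy_def T_def[symmetric]
      by (subst nn_integral_cmult, measurable, subst nn_integral_add, measurable)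
    finally show ?thesis by (simp add: nn_integral_completion)
  qed
  \<comment> \<open>The finite kernel mass makes \<open>Y\<close>, hence \<open>X\<close>, finite,
    which the cancellation requires.\<close>
  have "Y < \<infinity>" by (simp add: Y_eq)
  then obtain n x b where r: "near_energy l k u = ennreal n" "X = ennreal x" "far_energy l k u = ennreal b"
    "n \<ge> 0" "x \<ge> 0" "b \<ge> 0"
    using far unfolding Y by (cases "near_energy l k u"; cases X; cases "far_energy l k u") auto
  have "2 * unit_ball_vol (real CARD('n) - 1) * total_variation l u * ?L = n + x"
  proof (rule ennreal_inj[THEN iffD1])
    show "ennreal (2 * unit_ball_vol (real CARD('n) - 1) * total_variation l u * ?L) = ennreal (n + x)"
      using Y r by (simp add: Y_eq)
  qed (use mass(2) total_variation_nonneg[of l u] r in auto)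
  then show ?thesis
    unfolding energy_pos_def far_eq M c_def[symmetric] r using r c
    by (simp add: ennreal_mult'[symmetric] ennreal_plus[symmetric] algebra_simps del: ennreal_plus)
qed

section \<open>From the kernel hypotheses to the minimizer\<close>

lemma tail_weight:
  fixes r :: real
  assumes "r > 0" "d \<ge> 1"
  shows "min (r powi (int d - 2)) (r powi (int d - 1)) = (if r \<ge> 1 then r ^ (d - 1) / r else r ^ (d - 1))"
proof -
  have 1: "r powi (int d - 1) = r ^ (d - 1)"
    using assms by (simp add: power_int_of_nat[symmetric] of_nat_diff)
  \<comment> \<open>In dimension 1 the exponent is -1, hence integer powers and the form
    \<open>r ^ (d - 1) / r\<close>.\<close>
  have "r powi (int d - 2) = r powi ((int d - 1) - 1)" by simp
  also have "\<dots> = r ^ (d - 1) / r" using assms 1 by (subst power_int_diff) auto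
  finally show ?thesis
    using assms 1 by (auto simp: min_def divide_le_eq le_divide_eq mult_le_cancel_left1 mult_le_cancel_left2 not_le)
qed

lemma tail_finite:
  assumes tail: "\<And>\<delta>. \<delta> > 0 \<Longrightarrow>
      (\<integral>\<^sup>+r\<in>{\<delta><..}. K\<^sub>0 r * ennreal (min (r powi (int d - 2)) (r powi (int d - 1))) \<partial>lebesgue) < \<infinity>"
    and le: "AE r in lborel. r > 0 \<longrightarrow> k r \<le> K\<^sub>0 r" and d: "d \<ge> 1"
  shows "(\<integral>\<^sup>+r. indicator {1..} r * (k r * ennreal (r ^ (d - 1) / r)) \<partial>lborel) < \<infinity>"
    and "\<delta> > 0 \<Longrightarrow> (\<integral>\<^sup>+r. indicator {\<delta><..<1} r * (k r * ennreal (r ^ (d - 1))) \<partial>lborel) < \<infinity>"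
proof -
  let ?w = "\<lambda>r :: real. K\<^sub>0 r * ennreal (min (r powi (int d - 2)) (r powi (int d - 1)))"
  have T: "(\<integral>\<^sup>+r. ?w r * indicator {\<delta><..} r \<partial>lborel) < \<infinity>" if "\<delta> > 0" for \<delta>
    using tail[OF that] by (simp add: nn_integral_completion)
  \<comment> \<open>The tail hypothesis concerns open half-lines; starting at 1/2 includes the
    radius 1.\<close>
  have "(\<integral>\<^sup>+r. indicator {1..} r * (k r * ennreal (r ^ (d - 1) / r)) \<partial>lborel) \<le> (\<integral>\<^sup>+r. ?w r * indicator {1/2<..} r \<partial>lborel)"
  proof (rule nn_integral_mono_AE, use le in eventually_elim)
    case (elim r)
    then show ?case
      using d by (auto simp: indicator_def tail_weight intro!: mult_right_mono)
  qed
  also have "\<dots> < \<infinity>" by (rule T) simp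
  finally show "(\<integral>\<^sup>+r. indicator {1..} r * (k r * ennreal (r ^ (d - 1) / r)) \<partial>lborel) < \<infinity>" .
  assume \<delta>: "\<delta> > 0"
  have "(\<integral>\<^sup>+r. indicator {\<delta><..<1} r * (k r * ennreal (r ^ (d - 1))) \<partial>lborel) \<le> (\<integral>\<^sup>+r. ?w r * indicator {\<delta><..} r \<partial>lborel)"
  proof (rule nn_integral_mono_AE, use le in eventually_elim)
    case (elim r)
    then show ?case
      using d \<delta> by (auto simp: indicator_def tail_weight intro!: mult_right_mono)
  qed
  also have "\<dots> < \<infinity>" by (rule T[OF \<delta>])
  finally show "(\<integral>\<^sup>+r. indicator {\<delta><..<1} r * (k r * ennreal (r ^ (d - 1))) \<partial>lborel) < \<infinity>" .
qed

lemma ennreal_radial_profile_measurable: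
  fixes f :: "real \<Rightarrow> real"
  assumes "(\<lambda>z::'a::euclidean_space. f (norm z)) \<in> borel_measurable lebesgue"
  shows "(\<lambda>r. indicator {0<..} r * ennreal (f r)) \<in> borel_measurable lebesgue"
proof -
  have "(\<lambda>r. ennreal (indicat_real {0<..} r * f r)) \<in> borel_measurable lebesgue"
    using radial_profile_measurable[OF assms] by measurable
  also have "(\<lambda>r. ennreal (indicat_real {0<..} r * f r)) = (\<lambda>r. indicator {0<..} r * ennreal (f r))"
    by (auto simp: indicator_def)
  finally show ?thesis .
qed

theorem proposition1p2:
  fixes l :: real
    and K :: "real \<Rightarrow> real \<Rightarrow> real"
    and K\<^sub>0 :: "real \<Rightarrow> ennreal"
  assumes "l > 0"
    and nonneg: "\<And>\<epsilon> r. \<epsilon> > 0 \<Longrightarrow> r \<ge> 0 \<Longrightarrow> K \<epsilon> r \<ge> 0"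
    and measurable: "\<And>\<epsilon>. \<epsilon> > 0 \<Longrightarrow> (\<lambda>z::real^'n. K \<epsilon> (norm z)) \<in> borel_measurable lebesgue"
    and L1: "\<And>\<epsilon>. \<epsilon> > 0 \<Longrightarrow> set_integrable lebesgue (ball 0 1) (\<lambda>z::real^'n. K \<epsilon> (norm z))"
    and mass_pos: "\<And>\<epsilon>. \<epsilon> > 0 \<Longrightarrow> kernel_mass CARD('n) (K \<epsilon>) > 0"
    and increasing: "\<And>\<epsilon> \<epsilon>' r. 0 < \<epsilon> \<Longrightarrow> \<epsilon> \<le> \<epsilon>' \<Longrightarrow> r \<ge> 0 \<Longrightarrow> K \<epsilon>' r \<le> K \<epsilon> r"
    and limit: "\<And>r. r \<ge> 0 \<Longrightarrow> ((\<lambda>\<epsilon>. ennreal (K \<epsilon> r)) \<longlongrightarrow> K\<^sub>0 r) (at_right 0)"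
    and singular: "(\<integral>\<^sup>+r\<in>{0<..<1}. K\<^sub>0 r * ennreal (r ^ (CARD('n) - 1)) \<partial>lebesgue) = \<infinity>"
    and tail: "\<And>\<delta>. \<delta> > 0 \<Longrightarrow>
      (\<integral>\<^sup>+r\<in>{\<delta><..}. K\<^sub>0 r * ennreal (min (r powi (int CARD('n) - 2)) (r powi (int CARD('n) - 1)))
        \<partial>lebesgue) < \<infinity>"
  shows "\<forall>m\<in>{0..1}. \<forall>\<epsilon>\<ge>0. \<exists>u :: real^'n \<Rightarrow> real.
    is_arg_min (energy l K K\<^sub>0 \<epsilon>) (\<lambda>v. v \<in> BV01 l \<and> torus_mean l v = m) u"
proof (intro ballI allI impI)
  fix m \<epsilon> :: real assume m: "m \<in> {0..1}" and \<epsilon>: "\<epsilon> \<ge> 0"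
  note l = \<open>l > 0\<close>
  have card: "CARD('n) \<ge> 1" by (simp add: Suc_leI)
  \<comment> \<open>One kernel for all \<open>\<epsilon> \<ge> 0\<close>; the two cases part again
    only for the mass in the unit interval and for the energy formula.\<close>
  define \<kappa> where "\<kappa> = (if \<epsilon> = 0 then K\<^sub>0 else (\<lambda>r. ennreal (K \<epsilon> r)))"
  have Km: "(\<lambda>r. indicator {0<..} r * ennreal (K e r)) \<in> borel_measurable lebesgue" if "e > 0" for e
    by (rule ennreal_radial_profile_measurable[OF measurable[OF that]])
  \<comment> \<open>Measurability of \<open>K\<^sub>0\<close> is inherited from the kernels along
    the sequence \<open>1 / Suc n\<close>.\<close>
  have K0m: "(\<lambda>r. indicator {0<..} r * K\<^sub>0 r) \<in> borel_measurable lebesgue"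
  proof (rule borel_measurable_LIMSEQ_order)
    show "(\<lambda>r. indicator {0<..} r * ennreal (K (inverse (real (Suc n))) r)) \<in> borel_measurable lebesgue" for n
      by (rule Km) simp
    have "filterlim (\<lambda>n. inverse (real (Suc n))) (at_right 0) sequentially"
      by (rule tendsto_imp_filterlim_at_right[OF LIMSEQ_inverse_real_of_nat]) auto
    then have *: "(\<lambda>n. ennreal (K (inverse (real (Suc n))) r)) \<longlonglongrightarrow> K\<^sub>0 r" if "r > 0" for r
      using that by (intro filterlim_compose[OF limit]) auto
    show "(\<lambda>n. indicator {0<..} r * ennreal (K (inverse (real (Suc n))) r)) \<longlonglongrightarrow> indicator {0<..} r * K\<^sub>0 r" for r
      using *[of r] by (cases "r > 0") auto
  qed
  \<comment> \<open>Monotonicity in \<open>\<epsilon>\<close> puts every kernel below the limit, so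
    the tail hypothesis on \<open>K\<^sub>0\<close> covers all of them.\<close>
  have le: "\<kappa> r \<le> K\<^sub>0 r" if "r > 0" for r
  proof (cases "\<epsilon> = 0")
    case False
    have "eventually (\<lambda>e. ennreal (K \<epsilon> r) \<le> ennreal (K e r)) (at_right 0)"
      unfolding eventually_at_right_field using False \<epsilon> that
      by (intro exI[of _ \<epsilon>]) (auto intro!: ennreal_leI increasing)
    then show ?thesis
      using that False tendsto_lowerbound[OF limit[of r], of "ennreal (K \<epsilon> r)"] by (simp add: \<kappa>_def)
  qed (simp add: \<kappa>_def)
  have "(\<lambda>r. indicator {0<..} r * \<kappa> r) \<in> borel_measurable lebesgue"
    using Km K0m \<epsilon> by (auto simp: \<kappa>_def)
  then obtain k where k: "k \<in> borel_measurable borel" and k1: "AE r in lborel. r > 0 \<longrightarrow> \<kappa> r = k r"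
    and k2: "AE z::real^'n in lborel. \<kappa> (norm z) = k (norm z)"
    by (rule radial_borel_representative)
  have "AE r in lborel. r > 0 \<longrightarrow> k r \<le> K\<^sub>0 r"
    using k1 by eventually_elim (metis le)
  note fin = tail_finite[OF tail this card]
  have "(\<integral>\<^sup>+r. indicator {0<..<1} r * (k r * ennreal (r ^ (CARD('n) - 1))) \<partial>lborel) \<noteq> 0"
  \<comment> \<open>For \<open>\<epsilon> = 0\<close> the mass is infinite by the singularity; for
    \<open>\<epsilon> > 0\<close> it is \<open>kernel_mass\<close> up to a positive factor.\<close>
  proof (cases "\<epsilon> = 0")
    case True
    have "(\<integral>\<^sup>+r. indicator {0<..<1} r * (k r * ennreal (r ^ (CARD('n) - 1))) \<partial>lborel) =
      (\<integral>\<^sup>+r\<in>{0<..<1}. K\<^sub>0 r * ennreal (r ^ (CARD('n) - 1)) \<partial>lborel)"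
      by (rule nn_integral_cong_AE, use k1 in eventually_elim) (auto simp: \<kappa>_def True indicator_def)
    then show ?thesis using singular by (simp add: nn_integral_completion)
  next
    case False
    then show ?thesis
      using kernel_mass_nn_integral[of "K \<epsilon>" k "CARD('n)"] k1 nonneg mass_pos \<epsilon> by (auto simp: \<kappa>_def)
  qed
  then obtain u :: "real^'n \<Rightarrow> real" where u: "u \<in> BV01 l" "torus_mean l u = m"
    and min: "\<And>v :: real^'n \<Rightarrow> real. v \<in> BV01 l \<Longrightarrow> torus_mean l v = m \<Longrightarrow>
      enn2ereal (near_energy l k u) - enn2ereal (far_energy l k u) \<le>
      enn2ereal (near_energy l k v) - enn2ereal (far_energy l k v)"
    using minimizer_exists[where 'n = 'n, OF l _ _ k fin] m by auto blast
  have energy: "energy l K K\<^sub>0 \<epsilon> v = ereal (1 / (2 * l ^ CARD('n))) *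
      (enn2ereal (near_energy l k v) - enn2ereal (far_energy l k v))" if v: "v \<in> BV01 l" for v :: "real^'n \<Rightarrow> real"
  proof -
    have far: "far_energy l k v < \<infinity>"
      using far_energy_le[OF l v, of k] far_bound_finite[where 'n = 'n, OF l k fin(1)] by (rule le_less_trans)
    show ?thesis
    proof (cases "\<epsilon> = 0")
      case True
      then show ?thesis using energy_zero_eq[OF l v k _ far] k2 by (simp add: energy_def \<kappa>_def)
    next
      case False
      then show ?thesis
        using energy_pos_eq[OF l v k _ _ _ _ far] k1 k2 nonneg mass_pos \<epsilon> by (simp add: energy_def \<kappa>_def)
    qed
  qed
  have "energy l K K\<^sub>0 \<epsilon> u \<le> energy l K K\<^sub>0 \<epsilon> v" if "v \<in> BV01 l" "torus_mean l v = m" for v :: "real^'n \<Rightarrow> real"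
    unfolding energy[OF u(1)] energy[OF that(1)] using l by (intro ereal_mult_left_mono min that) simp
  then show "\<exists>u :: real^'n \<Rightarrow> real.
      is_arg_min (energy l K K\<^sub>0 \<epsilon>) (\<lambda>v. v \<in> BV01 l \<and> torus_mean l v = m) u"
    using u by (intro exI[of _ u]) (auto simp: is_arg_min_def not_less)
qed

end
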